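(* A map $\operatorname{z}\colon\operatorname{Conv}_{\mathrm{sc}}(\mathbb{R}^n)\to\mathbb{R}^n$ is a continuous, translation covariant, vertically translation invariant valuation that is epi-homogeneous of degree $n+1$ if and only if there exists $\zeta\in C_c(\mathbb{R}^n)$ such that $\operatorname{z}(u)=\int_{\operatorname{dom}(u)}\zeta(\nabla u(x))\,x\,\mathrm{d}x$ for every $u\in\operatorname{Conv}_{\mathrm{sc}}(\mathbb{R}^n)$. For $n\geq2$, such a $\operatorname{z}$ is in addition rotation equivariant if and only if there exists $\alpha\in C_c([0,\infty))$ with $\operatorname{z}=\operatorname{m}_\alpha$. For $n=1$ the same holds with rotation equivariance replaced by reflection equivariance.
   Context: $\operatorname{Conv}_{\mathrm{sc}}(\mathbb{R}^n)$: proper, lower semicontinuous, convex $u\colon\mathbb{R}^n\to(-\infty,\infty]$ with $\lim_{|x|\to\infty}u(x)/|x|=\infty$, topology of epi-convergence; $\operatorname{dom}(u)=\{u<\infty\}$. Valuation: $\operatorname{z}(u\vee w)+\operatorname{z}(u\wedge w)=\operatorname{z}(u)+\operatorname{z}(w)$ whenever $u,w$ and their pointwise max/min lie in the space. Translation covariant: there is $\operatorname{z}^0\colon\operatorname{Conv}_{\mathrm{sc}}(\mathbb{R}^n)\to\mathbb{R}$ with $\operatorname{z}(u\circ\tau_x^{-1})=\operatorname{z}(u)+\operatorname{z}^0(u)x$, $\tau_x(y)=y+x$. Vertically translation invariant: $\operatorname{z}(u+c)=\operatorname{z}(u)$ for $c\in\mathbb{R}$. Epi-homogeneous of degree $s$: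 $\operatorname{z}(\lambda\,\square\,u)=\lambda^s\operatorname{z}(u)$ for $\lambda>0$, $(\lambda\,\square\,u)(x)=\lambda u(x/\lambda)$. Rotation equivariant: $\operatorname{z}(u\circ\vartheta^{-1})=\vartheta\operatorname{z}(u)$ for $\vartheta\in\operatorname{SO}(n)$; reflection equivariant ($n=1$): $\operatorname{z}(u(-\,\cdot))=-\operatorname{z}(u)$. $\operatorname{m}_\alpha(u)=\int_{\operatorname{dom}(u)}\alpha(|\nabla u(x)|)\,x\,\mathrm{d}x$. *)

theory Defs
  imports "HOL-Analysis.Analysis"
begin

text \<open>Functions u : R^n -> (-inf, inf] are modelled as maps real^'n => ereal
  that never take the value -inf.\<close>

type_synonym 'n efun = "real^('n::finite) \<Rightarrow> ereal"

definition edom :: "('n::finite) efun \<Rightarrow> (real^'n) set" where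
  "edom u = {x. u x < \<infinity>}"

definition lsc_efun :: "('n::finite) efun \<Rightarrow> bool" where
  "lsc_efun u \<longleftrightarrow> (\<forall>x. u x \<le> Liminf (at x) u)"

definition convex_efun :: "('n::finite) efun \<Rightarrow> bool" where
  "convex_efun u \<longleftrightarrow> convex {(x, t::real). u x \<le> ereal t}"

definition Conv_sc :: "('n::finite) efun set" where
  "Conv_sc = {u. (\<forall>x. u x \<noteq> -\<infinity>) \<and> (\<exists>x. u x < \<infinity>) \<and> lsc_efun u \<and> convex_efun u
               \<and> ((\<lambda>x. u x / ereal (norm x)) \<longlongrightarrow> \<infinity>) at_infinity}"

definition epi_conv :: "(nat \<Rightarrow> ('n::finite) efun) \<Rightarrow> ('n::finite) efun \<Rightarrow> bool" where
  "epi_conv uk u \<longleftrightarrow> (\<forall>x.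
     (\<forall>xk. xk \<longlonglongrightarrow> x \<longrightarrow> u x \<le> Liminf sequentially (\<lambda>k. uk k (xk k))) \<and>
     (\<exists>xk. xk \<longlonglongrightarrow> x \<and> (\<lambda>k. uk k (xk k)) \<longlonglongrightarrow> u x))"

text \<open>Gradient (where it exists; elsewhere an arbitrary value, which only happens on a
  Lebesgue null subset of the domain for u in Conv_sc).\<close>
definition egrad :: "('n::finite) efun \<Rightarrow> real^'n \<Rightarrow> real^'n" where
  "egrad u x = (SOME g. ((\<lambda>y. real_of_ereal (u y)) has_derivative (\<lambda>h. g \<bullet> h)) (at x))"

definition epi_mult :: "real \<Rightarrow> ('n::finite) efun \<Rightarrow> ('n::finite) efun" where
  "epi_mult t u = (\<lambda>x. ereal t * u (x /\<^sub>R t))"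

definition z_continuous :: "(('n::finite) efun \<Rightarrow> real^'n) \<Rightarrow> bool" where
  "z_continuous z \<longleftrightarrow> (\<forall>uk u. (\<forall>k. uk k \<in> Conv_sc) \<and> u \<in> Conv_sc \<and> epi_conv uk u
       \<longrightarrow> (\<lambda>k. z (uk k)) \<longlonglongrightarrow> z u)"

definition z_valuation :: "(('n::finite) efun \<Rightarrow> real^'n) \<Rightarrow> bool" where
  "z_valuation z \<longleftrightarrow> (\<forall>u\<in>Conv_sc. \<forall>w\<in>Conv_sc.
      (\<lambda>x. max (u x) (w x)) \<in> Conv_sc \<and> (\<lambda>x. min (u x) (w x)) \<in> Conv_sc \<longrightarrow>
      z (\<lambda>x. max (u x) (w x)) + z (\<lambda>x. min (u x) (w x)) = z u + z w)"

definition z_trans_covariant :: "(('n::finite) efun \<Rightarrow> real^'n) \<Rightarrow> bool" where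
  "z_trans_covariant z \<longleftrightarrow> (\<exists>z0 :: ('n::finite) efun \<Rightarrow> real. \<forall>u\<in>Conv_sc. \<forall>x.
      z (\<lambda>y. u (y - x)) = z u + z0 u *\<^sub>R x)"

definition z_vert_invariant :: "(('n::finite) efun \<Rightarrow> real^'n) \<Rightarrow> bool" where
  "z_vert_invariant z \<longleftrightarrow> (\<forall>u\<in>Conv_sc. \<forall>c::real. z (\<lambda>x. u x + ereal c) = z u)"

definition z_epi_homogeneous :: "real \<Rightarrow> (('n::finite) efun \<Rightarrow> real^'n) \<Rightarrow> bool" where
  "z_epi_homogeneous s z \<longleftrightarrow> (\<forall>u\<in>Conv_sc. \<forall>t>0. z (epi_mult t u) = t powr s *\<^sub>R z u)"

definition z_rot_equivariant :: "(('n::finite) efun \<Rightarrow> real^'n) \<Rightarrow> bool" where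
  "z_rot_equivariant z \<longleftrightarrow> (\<forall>u\<in>Conv_sc. \<forall>\<theta>::real^'n^'n.
      orthogonal_matrix \<theta> \<and> det \<theta> = 1 \<longrightarrow>
      z (\<lambda>x. u (matrix_inv \<theta> *v x)) = \<theta> *v z u)"

definition z_refl_equivariant :: "(('n::finite) efun \<Rightarrow> real^'n) \<Rightarrow> bool" where
  "z_refl_equivariant z \<longleftrightarrow> (\<forall>u\<in>Conv_sc. z (\<lambda>x. u (- x)) = - z u)"

definition Cc_Rn :: "(real^'n \<Rightarrow> real) set" where
  "Cc_Rn = {\<zeta>. continuous_on UNIV \<zeta> \<and> compact (closure {x. \<zeta> x \<noteq> 0})}"

definition Cc_halfline :: "(real \<Rightarrow> real) set" where
  "Cc_halfline = {\<alpha>. continuous_on {0..} \<alpha> \<and> (\<exists>R. \<forall>t\<ge>R. \<alpha> t = 0)}"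

definition zeta_moment :: "(real^'n \<Rightarrow> real) \<Rightarrow> ('n::finite) efun \<Rightarrow> real^'n" where
  "zeta_moment \<zeta> u = (LINT x : edom u | lebesgue. \<zeta> (egrad u x) *\<^sub>R x)"

definition m_alpha :: "(real \<Rightarrow> real) \<Rightarrow> ('n::finite) efun \<Rightarrow> real^'n" where
  "m_alpha \<alpha> u = (LINT x : edom u | lebesgue. \<alpha> (norm (egrad u x)) *\<^sub>R x)"

end

theory Submission
  imports Defs "HOL-Complex_Analysis.Great_Picard" "HOL-Real_Asymp.Real_Asymp"
begin

text \<open>
  The moment with density \<open>\<zeta>\<close> is a continuous valuation because gradients converge almost
  everywhere along epi-convergent sequences, and gradients of bounded length only occur in a
  bounded region.

  Conversely, let \<open>z\<close> be a valuation as in the theorem, with associated \<open>z0\<close>, and let \<open>\<zeta> y\<close> be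
  the value of \<open>z0\<close> at the linear function \<open>y\<close> restricted to the unit cube. Homogeneity of degree
  \<open>n + 1\<close> together with compactness of the set of Lipschitz functions on the unit cube bounds \<open>z\<close>
  on a cube of side \<open>s\<close> by a multiple of \<open>s ^ n\<close>. Since a degenerate box is covered by only
  \<open>s ^ (- d)\<close> such cubes with \<open>d < n\<close>, \<open>z\<close> vanishes on degenerate boxes and is therefore additive
  under cutting boxes. The support of \<open>\<zeta>\<close> is bounded, so the moment with density \<open>\<zeta>\<close> can be
  subtracted and one may assume \<open>\<zeta> = 0\<close>. Cutting a cube into small cubes and blowing them up at
  points of differentiability then shows that \<open>z\<close> vanishes on Lipschitz functions on cubes, and
  these are dense.
\<close>

section \<open>Differentiability of convex functions\<close>

text \<open>By covariance the value on a cube of side \<open>s\<close> with corner \<open>a\<close>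
  is \<open>s^n * s * z v + s^n * z0 v * a\<close>, where \<open>v\<close> is the blow-up to the
  unit cube. The first term is of smaller order than the volume \<open>s^n\<close>, so on small
  cubes only \<open>z0\<close> counts. This is why the density is read off \<open>z0\<close>, and
  why subtracting the moment with the same \<open>z0\<close> on linear functions leaves nothing of
  the order of the volume wherever blow-ups become linear.

  Two obstacles shape the argument. The minimum of two restrictions has to stay convex, so a box is
  cut by one whole hyperplane at a time, and the common face enters the valuation identity with a
  sign; additivity has to wait until faces are known to contribute nothing. Moreover, blow-ups
  converge at no rate that is uniform in the point, and at points without a gradient only the crude
  bound by the volume remains. So no sum over small cubes is estimated: bisection singles out one
  nested sequence of bad cubes, and its limit point decides which of the two estimates gives the
  contradiction.\<close>

lemma nn_integral_indicator_shift:
  fixes N :: "'a::euclidean_space set"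
  assumes "N \<in> sets borel"
  shows "(\<integral>\<^sup>+x. indicator N (x + v) \<partial>lborel) = emeasure lborel N"
proof -
  have "emeasure lborel N = (\<integral>\<^sup>+x. indicator N x \<partial>(distr lborel borel ((+) v)))"
    using assms by (simp add: lborel_distr_plus)
  also have "\<dots> = (\<integral>\<^sup>+x. indicator N (v + x) \<partial>lborel)"
    using assms by (intro nn_integral_distr) auto
  finally show ?thesis
    by (simp add: add.commute)
qed

text \<open>Averaging the translates of the set along the direction and exchanging integrals
  avoids choosing coordinates adapted to the direction.\<close>

lemma null_sets_lborel_countable_lines:
  fixes N :: "'a::euclidean_space set" and e :: 'a
  assumes N[measurable]: "N \<in> sets borel"
    and cnt: "\<And>x. countable {t::real. x + t *\<^sub>R e \<in> N}"
  shows "N \<in> null_sets lborel"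
proof -
  let ?I = "{0..1::real}"
  have "emeasure lborel N = (\<integral>\<^sup>+t. indicator ?I t * emeasure lborel N \<partial>lborel)"
    by (simp add: nn_integral_multc)
  also have "\<dots> = (\<integral>\<^sup>+t. \<integral>\<^sup>+x. indicator ?I t * indicator N (x + t *\<^sub>R e) \<partial>lborel \<partial>lborel)"
    by (simp add: nn_integral_cmult nn_integral_indicator_shift)
  also have "\<dots> = (\<integral>\<^sup>+x. \<integral>\<^sup>+t. indicator ?I t * indicator N (x + t *\<^sub>R e) \<partial>lborel \<partial>lborel)"
    by (rule lborel_pair.Fubini') measurable
  also have "\<dots> = (\<integral>\<^sup>+x. 0 \<partial>(lborel :: 'a measure))"
  proof (rule nn_integral_cong)
    fix x :: 'a
    have "(\<integral>\<^sup>+t. indicator ?I t * indicator N (x + t *\<^sub>R e) \<partial>lborel)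
        \<le> (\<integral>\<^sup>+t. indicator {t::real. x + t *\<^sub>R e \<in> N} t \<partial>lborel)"
      by (intro nn_integral_mono) (auto simp: indicator_def)
    also have "\<dots> = emeasure lborel {t::real. x + t *\<^sub>R e \<in> N}"
      by (rule nn_integral_indicator) simp
    also have "\<dots> = 0"
      by (rule emeasure_lborel_countable[OF cnt])
    finally show "(\<integral>\<^sup>+t. indicator ?I t * indicator N (x + t *\<^sub>R e) \<partial>lborel) = 0"
      by simp
  qed
  finally show ?thesis
    by (auto intro!: null_setsI)
qed

section \<open>Monotone difference quotients, one-sided slopes and kinks\<close>

lemma convex_on_increment_le:
  assumes "convex_on S f" "x \<in> S" "x + v \<in> S" "0 \<le> c" "c \<le> (1::real)"
  shows "f (x + c *\<^sub>R v) - f x \<le> c * (f (x + v) - f x)"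
proof -
  have "f ((1 - c) *\<^sub>R x + c *\<^sub>R (x + v)) \<le> (1 - c) * f x + c * f (x + v)"
    using assms by (intro convex_onD) auto
  moreover have "(1 - c) *\<^sub>R x + c *\<^sub>R (x + v) = x + c *\<^sub>R v"
    by (simp add: algebra_simps)
  ultimately show ?thesis by (simp add: algebra_simps)
qed

text \<open>Monotonicity of slopes with the denominators cleared: \<open>x\<close> divides the
  segment between the outer points in the ratio \<open>s\<close> to \<open>t\<close>.\<close>

lemma convex_on_opposite_increments:
  assumes "convex_on S f" "x - s *\<^sub>R e \<in> S" "x + t *\<^sub>R e \<in> S" "0 < s" "0 < (t::real)"
  shows "t * (f x - f (x - s *\<^sub>R e)) \<le> s * (f (x + t *\<^sub>R e) - f x)"
proof -
  have eq: "x = (1 - s / (s + t)) *\<^sub>R (x - s *\<^sub>R e) + (s / (s + t)) *\<^sub>R (x + t *\<^sub>R e)"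
  proof -
    have "(1 - s / (s + t)) *\<^sub>R (x - s *\<^sub>R e) + (s / (s + t)) *\<^sub>R (x + t *\<^sub>R e)
      = x + (- s + s * (s / (s + t)) + s / (s + t) * t) *\<^sub>R e"
      by (simp add: algebra_simps)
    moreover have "- s + s * (s / (s + t)) + s / (s + t) * t = 0"
      using assms by (simp add: field_simps)
    ultimately show ?thesis by simp
  qed
  have "f x \<le> (1 - s / (s + t)) * f (x - s *\<^sub>R e) + (s / (s + t)) * f (x + t *\<^sub>R e)"
    using convex_onD[OF assms(1), of "s / (s + t)" "x - s *\<^sub>R e" "x + t *\<^sub>R e"] assms eq
    by (auto simp: field_simps)
  also have "1 - s / (s + t) = t / (s + t)"
    using assms by (simp add: field_simps)
  finally have "(s + t) * f x \<le> (s + t) * (t / (s + t) * f (x - s *\<^sub>R e) + s / (s + t) * f (x + t *\<^sub>R e))"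
    using assms by (intro mult_left_mono) auto
  also have "\<dots> = t * f (x - s *\<^sub>R e) + s * f (x + t *\<^sub>R e)"
  proof -
    have "k * (t / k * A + s / k * B) = t * A + s * B" if "k \<noteq> 0" for k A B
      using that by (simp add: field_simps)
    then show ?thesis using assms by simp
  qed
  finally show ?thesis by (simp add: algebra_simps)
qed

text \<open>For convex \<open>f\<close> on an open \<open>S\<close> the difference quotients
  decrease with the step, so this is the one-sided directional derivative. Taking only the countably
  many steps \<open>1 / Suc m\<close> makes it Borel measurable, and steps that leave
  \<open>S\<close> do not affect the infimum.\<close>

definition right_slope :: "'a::real_vector set \<Rightarrow> ('a \<Rightarrow> real) \<Rightarrow> 'a \<Rightarrow> 'a \<Rightarrow> ereal" where
  "right_slope S f e x = (INF m. if x + (1 / real (Suc m)) *\<^sub>R e \<in> S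
     then ereal (real (Suc m) * (f (x + (1 / real (Suc m)) *\<^sub>R e) - f x)) else \<infinity>)"

lemma right_slope_le:
  "x + (1 / real (Suc m)) *\<^sub>R e \<in> S \<Longrightarrow>
    right_slope S f e x \<le> ereal (real (Suc m) * (f (x + (1 / real (Suc m)) *\<^sub>R e) - f x))"
  unfolding right_slope_def by (rule INF_lower2[of m]) auto

lemma right_slope_less:
  assumes "right_slope S f e x < ereal c"
  obtains m where "x + (1 / real (Suc m)) *\<^sub>R e \<in> S"
    "real (Suc m) * (f (x + (1 / real (Suc m)) *\<^sub>R e) - f x) < c"
proof -
  obtain m where "(if x + (1 / real (Suc m)) *\<^sub>R e \<in> S
     then ereal (real (Suc m) * (f (x + (1 / real (Suc m)) *\<^sub>R e) - f x)) else \<infinity>) < ereal c"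
    using assms unfolding right_slope_def INF_less_iff by blast
  then show ?thesis
    by (intro that[of m]) (auto split: if_splits)
qed

lemma borel_measurable_right_slope:
  fixes f :: "'a::euclidean_space \<Rightarrow> real"
  assumes [measurable]: "S \<in> sets borel" "f \<in> borel_measurable borel"
  shows "right_slope S f e \<in> borel_measurable borel"
  unfolding right_slope_def by measurable

text \<open>A kink is a point where the left slope, i.e. minus the right slope in the opposite
  direction, is smaller than the right slope.\<close>

definition kinks :: "'a::real_vector set \<Rightarrow> ('a \<Rightarrow> real) \<Rightarrow> 'a \<Rightarrow> 'a set" where
  "kinks S f e = {x\<in>S. - right_slope S f (- e) x < right_slope S f e x}"

text \<open>The slope of the chord between the two points separates the two sides; one step
  \<open>h < d\<close> is compared with it from both ends.\<close>

lemma right_slope_le_left_slope: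
  assumes cvx: "convex_on S f" and S: "x \<in> S" "x + d *\<^sub>R e \<in> S" and d: "0 < (d::real)"
  shows "right_slope S f e x \<le> - right_slope S f (- e) (x + d *\<^sub>R e)"
proof -
  define y where "y = x + d *\<^sub>R e"
  obtain m where m: "1 / real (Suc m) < d"
    using reals_Archimedean[OF d] by (auto simp: inverse_eq_divide)
  define h where "h = 1 / real (Suc m)"
  have h: "0 < h" "h < d" "real (Suc m) = 1 / h"
    using m by (auto simp: h_def)
  define c where "c = h / d"
  have c: "0 \<le> c" "c \<le> 1" "c * d = h"
    using h d by (auto simp: c_def)
  have "convex S"
    using cvx by (rule convex_on_imp_convex)
  have xh: "x + h *\<^sub>R e = x + c *\<^sub>R (d *\<^sub>R e)" and yh: "y + h *\<^sub>R (- e) = y + c *\<^sub>R (- d *\<^sub>R e)"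
    using c by simp_all
  have yS: "y \<in> S" "y + (- d *\<^sub>R e) \<in> S"
    using S by (simp_all add: y_def)
  have mem: "u + c *\<^sub>R v \<in> S" if "u \<in> S" "u + v \<in> S" for u v
  proof -
    have "(1 - c) *\<^sub>R u + c *\<^sub>R (u + v) \<in> S"
      using \<open>convex S\<close> that c by (intro convexD) auto
    then show ?thesis
      by (simp add: algebra_simps)
  qed
  have 1: "f (x + h *\<^sub>R e) - f x \<le> c * (f y - f x)"
    unfolding xh y_def using S c cvx by (intro convex_on_increment_le) auto
  have 2: "f (y + h *\<^sub>R (- e)) - f y \<le> c * (f x - f y)"
    using convex_on_increment_le[OF cvx yS c(1,2)] c S by (simp add: y_def)
  have A: "right_slope S f e x \<le> ereal (1 / h * (f (x + h *\<^sub>R e) - f x))"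
    using right_slope_le[of x m e S f] mem[of x "d *\<^sub>R e"] S
    unfolding h_def[symmetric] xh[symmetric] unfolding h(3) by simp
  have B: "right_slope S f (- e) y \<le> ereal (1 / h * (f (y + h *\<^sub>R (- e)) - f y))"
    using right_slope_le[of y m "- e" S f] mem[OF yS]
    unfolding h_def[symmetric] yh[symmetric] unfolding h(3) by simp
  have "1 / h * (f (x + h *\<^sub>R e) - f x) \<le> - (1 / h * (f (y + h *\<^sub>R (- e)) - f y))"
  proof -
    have "f (x + h *\<^sub>R e) - f x \<le> - (f (y + h *\<^sub>R (- e)) - f y)"
      using 1 2 by (simp add: algebra_simps)
    then have "1 / h * (f (x + h *\<^sub>R e) - f x) \<le> 1 / h * - (f (y + h *\<^sub>R (- e)) - f y)"
      using h by (intro mult_left_mono) auto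
    then show ?thesis by (simp only: mult_minus_right)
  qed
  then have "ereal (1 / h * (f (x + h *\<^sub>R e) - f x)) \<le> - ereal (1 / h * (f (y + h *\<^sub>R (- e)) - f y))"
    by simp
  also have "\<dots> \<le> - right_slope S f (- e) y"
    using B by (simp only: ereal_minus_le_minus)
  finally show ?thesis
    using A by (simp add: y_def)
qed

text \<open>Each kink gets a rational strictly between its left and right slopes. Slopes increase
  along the line, so these rationals increase strictly and the choice is injective.\<close>

lemma countable_kinks_on_lines:
  assumes cvx: "convex_on S f"
  shows "countable {t::real. x + t *\<^sub>R e \<in> kinks S f e}"
proof -
  let ?T = "{t::real. x + t *\<^sub>R e \<in> kinks S f e}"
  let ?R = "\<lambda>t. right_slope S f e (x + t *\<^sub>R e)"
  let ?L = "\<lambda>t. - right_slope S f (- e) (x + t *\<^sub>R e)"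
  have "\<exists>q::rat. ?L t < ereal (of_rat q) \<and> ereal (of_rat q) < ?R t" if "t \<in> ?T" for t
  proof -
    have "?L t < ?R t"
      using that by (simp add: kinks_def)
    then show ?thesis
      using ereal_dense3 by blast
  qed
  then obtain q :: "real \<Rightarrow> rat"
    where q: "\<And>t. t \<in> ?T \<Longrightarrow> ?L t < ereal (of_rat (q t)) \<and> ereal (of_rat (q t)) < ?R t"
    by metis
  have less: "q t < q t'" if "t \<in> ?T" "t' \<in> ?T" "t < t'" for t t'
  proof -
    have "?R t \<le> - right_slope S f (- e) (x + t *\<^sub>R e + (t' - t) *\<^sub>R e)"
      using that by (intro right_slope_le_left_slope[OF cvx]) (auto simp: kinks_def algebra_simps)
    also have "x + t *\<^sub>R e + (t' - t) *\<^sub>R e = x + t' *\<^sub>R e"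
      by (simp add: algebra_simps)
    finally have "?R t \<le> ?L t'" .
    with q[OF that(1)] q[OF that(2)] have "ereal (of_rat (q t)) < ereal (of_rat (q t'))"
      by (meson less_le_trans less_trans)
    then show ?thesis
      by (simp add: of_rat_less)
  qed
  have "inj_on q ?T"
    by (rule inj_onI) (metis less less_irrefl linorder_neqE_linordered_idom)
  then show ?thesis
    by (rule countable_image_inj_on[rotated]) auto
qed

text \<open>A single difference quotient close to the one-sided slope controls all smaller steps on
  its own side from above and, by monotonicity, all steps on the other side from below. Without a
  kink the bounds from both sides meet at the same number.\<close>

lemma partial_derivative_outside_kinks:
  fixes S :: "'a::real_normed_vector set"
  assumes cvx: "convex_on S f" and "open S" "x \<in> S" and nk: "x \<notin> kinks S f e"
  obtains p where
    "\<And>\<epsilon>. 0 < \<epsilon> \<Longrightarrow> \<exists>\<delta>>0. \<forall>t. \<bar>t\<bar> < \<delta> \<longrightarrow> \<bar>f (x + t *\<^sub>R e) - f x - t * p\<bar> \<le> \<epsilon> * \<bar>t\<bar>"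
proof -
  have "((\<lambda>t. x + t *\<^sub>R e) \<longlongrightarrow> x + 0 *\<^sub>R e) (at 0)"
    by (intro tendsto_intros)
  then have "\<forall>\<^sub>F t in at 0. x + t *\<^sub>R e \<in> S"
    using \<open>open S\<close> \<open>x \<in> S\<close> by (auto dest: topological_tendstoD)
  then obtain r where r: "r > 0" "\<And>t. t \<noteq> 0 \<Longrightarrow> \<bar>t\<bar> < r \<Longrightarrow> x + t *\<^sub>R e \<in> S"
    by (auto simp: eventually_at dist_real_def)
  have inS: "x + t *\<^sub>R e \<in> S" if "\<bar>t\<bar> < r" for t
    using r(2)[of t] that \<open>x \<in> S\<close> by (cases "t = 0") auto
  obtain m0 where m0: "1 / real (Suc m0) < r"
    using reals_Archimedean[OF r(1)] by (auto simp: inverse_eq_divide)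
  have up: "f (x + t *\<^sub>R e) - f x \<le> t * (real (Suc m) * (f (x + (1 / real (Suc m)) *\<^sub>R e) - f x))"
    if "x + (1 / real (Suc m)) *\<^sub>R e \<in> S" "0 \<le> t" "t \<le> 1 / real (Suc m)" for t m e
  proof -
    have "(t * real (Suc m)) *\<^sub>R ((1 / real (Suc m)) *\<^sub>R e) = t *\<^sub>R e"
      by (simp del: of_nat_Suc)
    moreover have "t * real (Suc m) \<le> 1"
      using that(3) by (simp add: field_simps)
    ultimately show ?thesis
      using convex_on_increment_le[OF cvx \<open>x \<in> S\<close> that(1), of "t * real (Suc m)"] that(2)
      by (simp only: mult.assoc) simp
  qed
  have low: "t * (real (Suc m) * (f x - f (x - (1 / real (Suc m)) *\<^sub>R e))) \<le> f (x + t *\<^sub>R e) - f x"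
    if "x - (1 / real (Suc m)) *\<^sub>R e \<in> S" "0 < t" "x + t *\<^sub>R e \<in> S" for t m e
    using convex_on_opposite_increments[OF cvx that(1,3) _ that(2)] that
    by (simp add: field_simps)
  let ?R = "right_slope S f e x" and ?L = "- right_slope S f (- e) x"
  define k where "k = real (Suc m0)"
  have k: "0 < k" "1 / k < r" by (auto simp: k_def m0 simp del: of_nat_Suc)
  have km: "x + (1 / k) *\<^sub>R e \<in> S" "x - (1 / k) *\<^sub>R e \<in> S"
    using inS[of "1 / k"] inS[of "- (1 / k)"] k by auto
  have R1: "?R \<le> ereal (k * (f (x + (1 / k) *\<^sub>R e) - f x))"
    using km unfolding k_def by (intro right_slope_le)
  \<comment> \<open>The left quotient at step \<open>1 / k\<close> lies below every right quotient,
    so the infimum is finite.\<close>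
  have R0: "ereal (k * (f x - f (x - (1 / k) *\<^sub>R e))) \<le> ?R"
    unfolding right_slope_def
  proof (rule INF_greatest)
    fix m
    show "ereal (k * (f x - f (x - (1 / k) *\<^sub>R e))) \<le>
      (if x + (1 / real (Suc m)) *\<^sub>R e \<in> S
       then ereal (real (Suc m) * (f (x + (1 / real (Suc m)) *\<^sub>R e) - f x)) else \<infinity>)"
      using low[of m0 e "1 / real (Suc m)"] km by (auto simp: k_def field_simps)
  qed
  obtain c where c: "?R = ereal c"
    using R0 R1 by (cases ?R) auto
  have L: "ereal c \<le> ?L"
    using nk \<open>x \<in> S\<close> c by (auto simp: kinks_def)
  show thesis
  proof (rule that[of c])
    fix \<epsilon> :: real assume \<epsilon>: "0 < \<epsilon>"
    have "?R < ereal (c + \<epsilon>)" using c \<epsilon> by simp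
    then obtain m where m: "x + (1 / real (Suc m)) *\<^sub>R e \<in> S"
      "real (Suc m) * (f (x + (1 / real (Suc m)) *\<^sub>R e) - f x) < c + \<epsilon>"
      by (rule right_slope_less)
    have "right_slope S f (- e) x \<le> - ereal c"
      using L by (metis ereal_minus_le_minus ereal_uminus_uminus)
    also have "\<dots> < ereal (\<epsilon> - c)" using \<epsilon> by simp
    finally obtain l where l: "x + (1 / real (Suc l)) *\<^sub>R (- e) \<in> S"
      "real (Suc l) * (f (x + (1 / real (Suc l)) *\<^sub>R (- e)) - f x) < \<epsilon> - c"
      by (rule right_slope_less)
    define \<delta> where "\<delta> = Min {r, 1 / real (Suc m), 1 / real (Suc l)}"
    have \<delta>: "0 < \<delta>" "\<delta> \<le> r" "\<delta> \<le> 1 / real (Suc m)" "\<delta> \<le> 1 / real (Suc l)"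
      using r by (auto simp: \<delta>_def)
    have main: "\<bar>f (x + t *\<^sub>R e) - f x - t * c\<bar> \<le> \<epsilon> * \<bar>t\<bar>" if t: "\<bar>t\<bar> < \<delta>" for t
    proof (cases t "0::real" rule: linorder_cases)
      case greater
      have "f (x + t *\<^sub>R e) - f x \<le> t * (c + \<epsilon>)"
        using up[OF m(1), of t] m(2) greater t \<delta>
        by (smt (verit) mult_left_mono)
      moreover have "t * (c - \<epsilon>) \<le> f (x + t *\<^sub>R e) - f x"
      proof -
        have "t * (c - \<epsilon>) \<le> t * (real (Suc l) * (f x - f (x - (1 / real (Suc l)) *\<^sub>R e)))"
          using l(2) greater by (intro mult_left_mono) (auto simp: algebra_simps)
        also have "\<dots> \<le> f (x + t *\<^sub>R e) - f x"
          using l(1) greater inS[of t] t \<delta> by (intro low) auto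
        finally show ?thesis .
      qed
      ultimately show ?thesis
        using greater by (auto simp: abs_le_iff algebra_simps)
    next
      \<comment> \<open>The positive case for the direction \<open>- e\<close>, with the roles of
        \<open>m\<close> and \<open>l\<close> exchanged.\<close>
      case less
      have "f (x + (- t) *\<^sub>R (- e)) - f x \<le> (- t) * (\<epsilon> - c)"
        using up[OF l(1), of "- t"] l(2) less t \<delta>
        by (smt (verit) mult_left_mono)
      moreover have "(- t) * (- c - \<epsilon>) \<le> f (x + (- t) *\<^sub>R (- e)) - f x"
      proof -
        have "(- t) * (- c - \<epsilon>) \<le> (- t) * (real (Suc m) * (f x - f (x - (1 / real (Suc m)) *\<^sub>R (- e))))"
          using m(2) less by (intro mult_left_mono) (auto simp: algebra_simps)
        also have "\<dots> \<le> f (x + (- t) *\<^sub>R (- e)) - f x"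
          using m(1) less inS[of t] t \<delta> by (intro low) auto
        finally show ?thesis .
      qed
      ultimately show ?thesis
        using less by (auto simp: abs_le_iff algebra_simps)
    qed auto
    show "\<exists>\<delta>>0. \<forall>t. \<bar>t\<bar> < \<delta> \<longrightarrow> \<bar>f (x + t *\<^sub>R e) - f x - t * c\<bar> \<le> \<epsilon> * \<bar>t\<bar>"
      using main \<delta> by blast
  qed
qed

text \<open>The point \<open>x + h\<close> is the average of the \<open>n\<close> points
  \<open>x + n * (h \<bullet> b) * b\<close> on the coordinate axes through \<open>x\<close>, so
  Jensen's inequality turns the partial derivatives into an upper bound. The lower bound is the
  upper one for \<open>- h\<close>, reflected by convexity.\<close>

lemma convex_on_has_derivative_if_partials:
  fixes f :: "'a::euclidean_space \<Rightarrow> real"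
  assumes cvx: "convex_on S f" and "open S" "x \<in> S"
    and part: "\<And>b \<epsilon>. b \<in> Basis \<Longrightarrow> 0 < \<epsilon> \<Longrightarrow>
      \<exists>\<delta>>0. \<forall>t. \<bar>t\<bar> < \<delta> \<longrightarrow> \<bar>f (x + t *\<^sub>R b) - f x - t * p b\<bar> \<le> \<epsilon> * \<bar>t\<bar>"
  shows "(f has_derivative (\<lambda>h. (\<Sum>b\<in>Basis. p b *\<^sub>R b) \<bullet> h)) (at x)"
proof -
  define g where "g = (\<Sum>b\<in>Basis. p b *\<^sub>R b)"
  have gb: "g \<bullet> h = (\<Sum>b\<in>Basis. p b * (b \<bullet> h))" for h
    by (simp add: g_def inner_sum_left)
  define n where "n = real (DIM('a))"
  have n: "n \<ge> 1" using DIM_positive[where 'a='a] by (simp add: n_def Suc_leI)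
  obtain r where r: "r > 0" "ball x r \<subseteq> S"
    using \<open>open S\<close> \<open>x \<in> S\<close> by (auto simp: open_contains_ball)
  have "\<exists>\<delta>>0. \<forall>h. norm h < \<delta> \<longrightarrow> \<bar>f (x + h) - f x - g \<bullet> h\<bar> \<le> \<epsilon> * norm h" if "\<epsilon> > 0" for \<epsilon>
  proof -
    have "\<exists>\<delta>>0. \<forall>t. \<bar>t\<bar> < \<delta> \<longrightarrow> \<bar>f (x + t *\<^sub>R b) - f x - t * p b\<bar> \<le> \<epsilon> / n * \<bar>t\<bar>" if "b \<in> Basis" for b
      using part[OF that, of "\<epsilon> / n"] \<open>\<epsilon> > 0\<close> n by simp
    then obtain d where d: "\<And>b. b \<in> Basis \<Longrightarrow> d b > 0"
      "\<And>b t. b \<in> Basis \<Longrightarrow> \<bar>t\<bar> < d b \<Longrightarrow> \<bar>f (x + t *\<^sub>R b) - f x - t * p b\<bar> \<le> \<epsilon> / n * \<bar>t\<bar>"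
      by metis
    define \<delta> where "\<delta> = Min (insert r (d ` Basis)) / n"
    have Mpos: "Min (insert r (d ` Basis)) > 0"
      using r d by (subst Min_gr_iff) auto
    then have \<delta>: "\<delta> > 0" using n by (simp add: \<delta>_def)
    have n\<delta>: "n * \<delta> \<le> r" "\<And>b. b \<in> Basis \<Longrightarrow> n * \<delta> \<le> d b"
      using n by (auto simp: \<delta>_def intro!: min.coboundedI2)
    have "\<delta> \<le> r"
      using n\<delta>(1) \<delta> n by (smt (verit) mult_le_cancel_right1)
    have upper: "f (x + h) - f x - g \<bullet> h \<le> \<epsilon> * norm h" if h: "norm h < \<delta>" for h
    proof -
      have comp: "\<bar>n * (h \<bullet> b)\<bar> < n * \<delta>" if "b \<in> Basis" for b
        using Basis_le_norm[OF that, of h] h n by (simp add: abs_mult)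
      have inS: "x + (n * (h \<bullet> b)) *\<^sub>R b \<in> S" if "b \<in> Basis" for b
      proof -
        have "norm ((n * (h \<bullet> b)) *\<^sub>R b) < r"
          using comp[OF that] n\<delta>(1) that by simp
        then show ?thesis using r by (auto simp: dist_norm)
      qed
      have eq: "x + h = (\<Sum>b\<in>Basis. (1 / n) *\<^sub>R (x + (n * (h \<bullet> b)) *\<^sub>R b))"
      proof -
        have "(\<Sum>b\<in>Basis. (1 / n) *\<^sub>R (x + (n * (h \<bullet> b)) *\<^sub>R b))
          = (\<Sum>b\<in>(Basis::'a set). (1 / n) *\<^sub>R x) + (\<Sum>b\<in>Basis. (h \<bullet> b) *\<^sub>R b)"
          using n by (simp add: scaleR_add_right sum.distrib)
        also have "(\<Sum>b\<in>(Basis::'a set). (1 / n) *\<^sub>R x) = x"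
          using n by (simp add: sum_constant_scaleR n_def)
        finally show ?thesis by (simp add: euclidean_representation)
      qed
      have "f (x + h) \<le> (\<Sum>b\<in>Basis. (1 / n) * f (x + (n * (h \<bullet> b)) *\<^sub>R b))"
        unfolding eq using n cvx inS
        by (intro convex_on_sum) (auto simp: n_def)
      also have "\<dots> \<le> (\<Sum>b\<in>Basis. (1 / n) * (f x + (n * (h \<bullet> b)) * p b + \<epsilon> * norm h))"
      proof (intro sum_mono mult_left_mono)
        fix b :: 'a assume b: "b \<in> Basis"
        have "\<bar>f (x + (n * (h \<bullet> b)) *\<^sub>R b) - f x - (n * (h \<bullet> b)) * p b\<bar> \<le> \<epsilon> / n * \<bar>n * (h \<bullet> b)\<bar>"
          using d(2)[OF b, of "n * (h \<bullet> b)"] comp[OF b] n\<delta>(2)[OF b] by linarith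
        also have "\<dots> = \<epsilon> * \<bar>h \<bullet> b\<bar>"
          using n by (simp add: abs_mult)
        also have "\<dots> \<le> \<epsilon> * norm h"
          using Basis_le_norm[OF b] \<open>\<epsilon> > 0\<close> by (intro mult_left_mono) auto
        finally show "f (x + (n * (h \<bullet> b)) *\<^sub>R b) \<le> f x + (n * (h \<bullet> b)) * p b + \<epsilon> * norm h"
          by (simp add: abs_le_iff)
      qed (use n in auto)
      also have "\<dots> = f x + g \<bullet> h + \<epsilon> * norm h"
      proof -
        have "(\<Sum>b\<in>Basis. (1 / n) * (f x + (n * (h \<bullet> b)) * p b + \<epsilon> * norm h))
          = (\<Sum>b\<in>(Basis::'a set). (1 / n) * (f x + \<epsilon> * norm h)) + (\<Sum>b\<in>Basis. p b * (b \<bullet> h))"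
          unfolding sum.distrib[symmetric] using n
          by (intro sum.cong) (auto simp: distrib_left inner_commute)
        also have "(\<Sum>b\<in>(Basis::'a set). (1 / n) * (f x + \<epsilon> * norm h)) = f x + \<epsilon> * norm h"
          using n by (simp add: n_def)
        finally show ?thesis by (simp add: gb)
      qed
      finally show ?thesis by simp
    qed
    have "\<bar>f (x + h) - f x - g \<bullet> h\<bar> \<le> \<epsilon> * norm h" if h: "norm h < \<delta>" for h
    proof -
      have xh: "x + h \<in> S" "x - h \<in> S"
        using h \<open>\<delta> \<le> r\<close> r by (auto simp: dist_norm)
      have "f x - f (x - h) \<le> f (x + h) - f x"
        using convex_on_opposite_increments[OF cvx, of x 1 h 1] xh by simp
      with upper[OF h] upper[of "- h"] h show ?thesis
        by (simp add: abs_le_iff)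
    qed
    with \<delta> show ?thesis by blast
  qed
  then have "(f has_derivative (\<lambda>h. g \<bullet> h)) (at x)"
    unfolding has_derivative_at_alt
    by (auto simp: bounded_linear_inner_right) (metis diff_add_cancel add.commute)
  then show ?thesis unfolding g_def .
qed

theorem convex_on_AE_differentiable:
  fixes f :: "'a::euclidean_space \<Rightarrow> real"
  assumes cvx: "convex_on S f" and "open S"
  shows "AE x in lborel. x \<in> S \<longrightarrow> (\<exists>g. (f has_derivative (\<lambda>h. g \<bullet> h)) (at x))"
proof -
  \<comment> \<open>Outside \<open>S\<close> nothing is known about \<open>f\<close>; the extension
    by 0 is Borel measurable, so its slopes are too.\<close>
  define f0 where "f0 = (\<lambda>x. indicator S x *\<^sub>R f x)"
  have f0: "f0 x = f x" if "x \<in> S" for x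
    using that by (simp add: f0_def)
  have cvx0: "convex_on S f0"
    using cvx f0 by (auto simp: convex_on_def convexD)
  have [measurable]: "S \<in> sets borel"
    using assms by auto
  have [measurable]: "f0 \<in> borel_measurable borel"
    unfolding f0_def using assms
    by (intro borel_measurable_continuous_on_indicator convex_on_continuous) auto
  have null: "kinks S f0 b \<in> null_sets lborel" for b
  proof (rule null_sets_lborel_countable_lines)
    have [measurable]: "right_slope S f0 b \<in> borel_measurable borel"
      "right_slope S f0 (- b) \<in> borel_measurable borel"
      by (auto intro!: borel_measurable_right_slope)
    show "kinks S f0 b \<in> sets borel"
      unfolding kinks_def by measurable
  qed (rule countable_kinks_on_lines[OF cvx0])
  have "AE x in lborel. \<forall>b\<in>Basis. x \<notin> kinks S f0 b"
    using null by (subst AE_ball_countable) (auto intro!: countable_finite AE_not_in)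
  then show ?thesis
  proof eventually_elim
    case (elim x)
    show ?case
    proof
      assume x: "x \<in> S"
      have "\<exists>p. \<forall>\<epsilon>>0. \<exists>\<delta>>0. \<forall>t. \<bar>t\<bar> < \<delta> \<longrightarrow> \<bar>f0 (x + t *\<^sub>R b) - f0 x - t * p\<bar> \<le> \<epsilon> * \<bar>t\<bar>"
        if "b \<in> Basis" for b
        using partial_derivative_outside_kinks[OF cvx0 \<open>open S\<close> x, of b] elim that by metis
      then obtain p where "\<And>b \<epsilon>. b \<in> Basis \<Longrightarrow> 0 < \<epsilon> \<Longrightarrow>
        \<exists>\<delta>>0. \<forall>t. \<bar>t\<bar> < \<delta> \<longrightarrow> \<bar>f0 (x + t *\<^sub>R b) - f0 x - t * p b\<bar> \<le> \<epsilon> * \<bar>t\<bar>"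
        by metis
      then have "(f0 has_derivative (\<lambda>h. (\<Sum>b\<in>Basis. p b *\<^sub>R b) \<bullet> h)) (at x)"
        by (rule convex_on_has_derivative_if_partials[OF cvx0 \<open>open S\<close> x])
      then have "(f has_derivative (\<lambda>h. (\<Sum>b\<in>Basis. p b *\<^sub>R b) \<bullet> h)) (at x)"
        by (rule has_derivative_transform_within_open[OF _ \<open>open S\<close> x]) (simp add: f0)
      then show "\<exists>g. (f has_derivative (\<lambda>h. g \<bullet> h)) (at x)"
        by blast
    qed
  qed
qed

section \<open>Super-coercive convex functions and epi-convergence\<close>

lemma lsc_efun_iff:
  "lsc_efun u \<longleftrightarrow> (\<forall>x c. c < u x \<longrightarrow> (\<forall>\<^sub>F y in nhds x. c < u y))"
  unfolding lsc_efun_def le_Liminf_iff by (auto simp: eventually_nhds_conv_at)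

lemma supercoercive_iff:
  fixes u :: "('n::finite) efun"
  shows "((\<lambda>x. u x / ereal (norm x)) \<longlongrightarrow> \<infinity>) at_infinity \<longleftrightarrow>
    (\<forall>M. \<exists>R. \<forall>x. R \<le> norm x \<longrightarrow> ereal (M * norm x) \<le> u x)" (is "?l \<longleftrightarrow> ?r")
proof
  assume l: ?l
  show ?r
  proof
    fix M
    have "\<forall>\<^sub>F x in at_infinity. ereal M < u x / ereal (norm x)"
      using l by (simp add: tendsto_PInfty)
    then obtain R where R: "\<And>x. R \<le> norm x \<Longrightarrow> ereal M < u x / ereal (norm x)"
      by (auto simp: eventually_at_infinity)
    have "ereal (M * norm x) \<le> u x" if "max R 1 \<le> norm x" for x
    proof -
      have "0 < norm x" using that by linarith
      then show ?thesis
        using R[of x, THEN less_imp_le] that ereal_le_divide_pos[of "ereal (norm x)" "ereal M" "u x"]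
        by (auto simp: mult.commute)
    qed
    then show "\<exists>R. \<forall>x. R \<le> norm x \<longrightarrow> ereal (M * norm x) \<le> u x"
      by blast
  qed
next
  assume r: ?r
  show ?l
    unfolding tendsto_PInfty
  proof
    fix M :: real
    obtain R where R: "\<And>x. R \<le> norm x \<Longrightarrow> ereal ((M + 1) * norm x) \<le> u x"
      using r by blast
    have "ereal M < u x / ereal (norm x)" if "max R 1 \<le> norm x" for x
    proof -
      have "ereal (M + 1) \<le> u x / ereal (norm x)"
        using R[of x] that by (subst ereal_le_divide_pos) (auto simp: mult.commute)
      then show ?thesis
        by (rule less_le_trans[rotated]) simp
    qed
    then show "\<forall>\<^sub>F x in at_infinity. ereal M < u x / ereal (norm x)"
      unfolding eventually_at_infinity by blast
  qed
qed

lemma convex_efun_iff: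
  "convex_efun u \<longleftrightarrow> (\<forall>x y s t a. u x \<le> ereal s \<longrightarrow> u y \<le> ereal t \<longrightarrow> 0 \<le> a \<longrightarrow> a \<le> 1 \<longrightarrow>
    u ((1 - a) *\<^sub>R x + a *\<^sub>R y) \<le> ereal ((1 - a) * s + a * t))"
  unfolding convex_efun_def convex_alt by (auto simp: split_beta)

lemma Conv_sc_iff:
  "u \<in> Conv_sc \<longleftrightarrow> (\<forall>x. u x \<noteq> -\<infinity>) \<and> (\<exists>x. u x < \<infinity>)
    \<and> (\<forall>x c. c < u x \<longrightarrow> (\<forall>\<^sub>F y in nhds x. c < u y))
    \<and> (\<forall>x y s t a. u x \<le> ereal s \<longrightarrow> u y \<le> ereal t \<longrightarrow> 0 \<le> a \<longrightarrow> a \<le> 1 \<longrightarrow>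
         u ((1 - a) *\<^sub>R x + a *\<^sub>R y) \<le> ereal ((1 - a) * s + a * t))
    \<and> (\<forall>M. \<exists>R. \<forall>x. R \<le> norm x \<longrightarrow> ereal (M * norm x) \<le> u x)"
  unfolding Conv_sc_def lsc_efun_iff convex_efun_iff supercoercive_iff by simp

lemma
  assumes u: "u \<in> Conv_sc"
  shows Conv_sc_not_MInf: "u x \<noteq> -\<infinity>"
    and Conv_sc_proper: "\<exists>x. u x < \<infinity>"
    and Conv_sc_lsc: "c < u x \<Longrightarrow> \<forall>\<^sub>F y in nhds x. c < u y"
    and Conv_sc_convex: "u x \<le> ereal s \<Longrightarrow> u y \<le> ereal t \<Longrightarrow> 0 \<le> a \<Longrightarrow> a \<le> 1 \<Longrightarrow>
         u ((1 - a) *\<^sub>R x + a *\<^sub>R y) \<le> ereal ((1 - a) * s + a * t)"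
    and Conv_sc_supercoercive: "\<exists>R. \<forall>x. R \<le> norm x \<longrightarrow> ereal (M * norm x) \<le> u x"
proof -
  note u' = u[unfolded Conv_sc_iff]
  show "u x \<noteq> -\<infinity>" "\<exists>x. u x < \<infinity>" "\<exists>R. \<forall>x. R \<le> norm x \<longrightarrow> ereal (M * norm x) \<le> u x"
    "c < u x \<Longrightarrow> \<forall>\<^sub>F y in nhds x. c < u y"
    using u' by blast+
  show "u x \<le> ereal s \<Longrightarrow> u y \<le> ereal t \<Longrightarrow> 0 \<le> a \<Longrightarrow> a \<le> 1 \<Longrightarrow>
         u ((1 - a) *\<^sub>R x + a *\<^sub>R y) \<le> ereal ((1 - a) * s + a * t)"
    using u' by simp
qed

lemma edom_iff: "x \<in> edom u \<longleftrightarrow> u x < \<infinity>"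
  by (simp add: edom_def)

lemma Conv_sc_real:
  assumes "u \<in> Conv_sc" "x \<in> edom u"
  shows "u x = ereal (real_of_ereal (u x))"
  using assms Conv_sc_not_MInf[of u x] by (cases "u x") (auto simp: edom_iff)

lemma convex_on_edom:
  assumes u: "u \<in> Conv_sc"
  shows "convex_on (edom u) (\<lambda>x. real_of_ereal (u x))"
proof -
  have key: "u ((1 - a) *\<^sub>R x + a *\<^sub>R y)
      \<le> ereal ((1 - a) * real_of_ereal (u x) + a * real_of_ereal (u y))"
    if "x \<in> edom u" "y \<in> edom u" "0 \<le> a" "a \<le> 1" for x y a
    using that Conv_sc_real[OF u] by (intro Conv_sc_convex[OF u]) auto
  have cvx: "convex (edom u)"
    unfolding convex_alt
  proof (intro ballI allI impI)
    fix x y and a :: real assume "x \<in> edom u" "y \<in> edom u" "0 \<le> a \<and> a \<le> 1"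
    then show "(1 - a) *\<^sub>R x + a *\<^sub>R y \<in> edom u"
      unfolding edom_iff[of "(1 - a) *\<^sub>R x + a *\<^sub>R y"]
      by (intro le_less_trans[OF key]) auto
  qed
  show ?thesis
  proof (rule convex_onI)
    fix t x y assume t: "0 < t" "t < (1::real)" and xy: "x \<in> edom u" "y \<in> edom u"
    have "(1 - t) *\<^sub>R x + t *\<^sub>R y \<in> edom u"
      using cvx xy t by (auto simp: convex_alt)
    from Conv_sc_real[OF u this] key[OF xy, of t] t
    show "real_of_ereal (u ((1 - t) *\<^sub>R x + t *\<^sub>R y))
      \<le> (1 - t) * real_of_ereal (u x) + t * real_of_ereal (u y)"
      by (metis ereal_less_eq(3) less_imp_le)
  qed (rule cvx)
qed

lemma convex_edom: "u \<in> Conv_sc \<Longrightarrow> convex (edom u)"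
  using convex_on_edom convex_on_imp_convex by blast

lemma borel_measurable_Conv_sc:
  assumes "u \<in> Conv_sc"
  shows "u \<in> borel_measurable borel"
proof (rule borel_measurableI_greater)
  fix c
  have "open {x. c < u x}"
    unfolding open_contains_ball
  proof
    fix x assume "x \<in> {x. c < u x}"
    then have "\<forall>\<^sub>F y in nhds x. c < u y"
      using Conv_sc_lsc[OF assms] by simp
    then show "\<exists>e>0. ball x e \<subseteq> {x. c < u x}"
      by (auto simp: eventually_nhds_metric dist_commute)
  qed
  then show "{x \<in> space borel. c < u x} \<in> sets borel"
    by simp
qed

text \<open>Growth with slope 0 handles the outside of a ball; inside, lower semicontinuity on a
  compact set gives the bound.\<close>

lemma Conv_sc_bounded_below:
  assumes u: "u \<in> Conv_sc"
  obtains m where "\<And>x. ereal m \<le> u x"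
proof -
  obtain R where R: "\<And>x. R \<le> norm x \<Longrightarrow> ereal (0 * norm x) \<le> u x"
    using Conv_sc_supercoercive[OF u, of 0] by blast
  have "\<exists>m. \<forall>x\<in>cball 0 R. ereal m \<le> u x"
  proof (rule ccontr)
    assume "\<nexists>m. \<forall>x\<in>cball 0 R. ereal m \<le> u x"
    then have "\<forall>k::nat. \<exists>x\<in>cball 0 R. u x < ereal (- real k)"
      by (auto simp: not_le)
    then obtain X where X: "\<And>k. X k \<in> cball 0 R" "\<And>k::nat. u (X k) < ereal (- real k)"
      by metis
    obtain x r where r: "strict_mono (r :: nat \<Rightarrow> nat)" "(X \<circ> r) \<longlonglongrightarrow> x"
      using compact_cball[of "0::real^'a" R, unfolded compact_def] X by metis
    have "- \<infinity> < u x" using Conv_sc_not_MInf[OF u, of x] by (cases "u x") auto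
    then obtain c where c: "ereal c < u x" using ereal_dense2 by blast
    have "\<forall>\<^sub>F k in sequentially. ereal c < u ((X \<circ> r) k)"
      using r(2)[unfolded filterlim_iff] Conv_sc_lsc[OF u c] by blast
    then have "\<forall>\<^sub>F k in sequentially. ereal c < u (X (r k))"
      by (simp only: o_def)
    moreover have "\<forall>\<^sub>F k in sequentially. - c \<le> real k"
      by real_asymp
    ultimately have "\<forall>\<^sub>F k in sequentially. False"
    proof eventually_elim
      case (elim k)
      have "ereal c < ereal (- real (r k))"
        using elim(1) X(2)[of "r k"] by (rule less_trans)
      moreover have "k \<le> r k" using seq_suble[OF r(1)] .
      ultimately show ?case using elim(2) by simp
    qed
    then show False by simp
  qed
  then obtain m where m: "\<And>x. x \<in> cball 0 R \<Longrightarrow> ereal m \<le> u x" by blast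
  show thesis
  proof (rule that[of "min m 0"])
    fix x
    show "ereal (min m 0) \<le> u x"
    proof (cases "R \<le> norm x")
      case True
      then have "0 \<le> u x" using R[of x] by (simp add: zero_ereal_def)
      then show ?thesis by (rule order_trans[rotated]) (simp add: zero_ereal_def del: ereal_min)
    next
      case False
      then have "ereal m \<le> u x" by (intro m) auto
      then show ?thesis by (rule order_trans[rotated]) simp
    qed
  qed
qed

text \<open>One closure property for translations, vertical shifts, epi-multiplication and
  orthogonal maps. The lower bound on \<open>norm (L x)\<close> carries the growth over.\<close>

lemma Conv_sc_affine:
  fixes u :: "('n::finite) efun" and L :: "real^'n \<Rightarrow> real^'n"
  assumes u: "u \<in> Conv_sc" and t: "t > 0" and m: "m > 0"
    and L: "linear L" "surj L" "\<And>x. m * norm x \<le> norm (L x)"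
  shows "(\<lambda>x. ereal t * u (L x + b) + ereal c) \<in> Conv_sc"
proof -
  define w where "w = (\<lambda>x. ereal t * u (L x + b) + ereal c)"
  have le: "w x \<le> ereal s \<longleftrightarrow> u (L x + b) \<le> ereal ((s - c) / t)" for x s
    using t by (cases "u (L x + b)") (auto simp: w_def field_simps)
  have ge: "ereal s \<le> w x \<longleftrightarrow> ereal ((s - c) / t) \<le> u (L x + b)" for x s
    using t by (cases "u (L x + b)") (auto simp: w_def field_simps)
  have nm: "w x \<noteq> -\<infinity>" for x
    using t Conv_sc_not_MInf[OF u, of "L x + b"] by (cases "u (L x + b)") (auto simp: w_def)
  have "w \<in> Conv_sc"
    unfolding Conv_sc_iff
  proof (intro conjI allI impI)
    obtain y where y: "u y < \<infinity>" using Conv_sc_proper[OF u] by blast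
    obtain x where "L x = y - b" using \<open>surj L\<close> by (metis surjD)
    then have "w x < \<infinity>"
      using y t Conv_sc_not_MInf[OF u, of y] by (cases "u y") (auto simp: w_def)
    then show "\<exists>x. w x < \<infinity>" by blast
  next
    fix x s assume s: "s < w x"
    show "\<forall>\<^sub>F y in nhds x. s < w y"
    proof (cases s)
      case (real r)
      have "isCont L x" using \<open>linear L\<close> linear_continuous_at linear_conv_bounded_linear by blast
      then have "isCont (\<lambda>x. L x + b) x" by (intro continuous_intros)
      moreover have "\<forall>\<^sub>F y in nhds (L x + b). ereal ((r - c) / t) < u y"
        using s le[of x r] by (intro Conv_sc_lsc[OF u]) (auto simp: real not_le[symmetric])
      ultimately have "\<forall>\<^sub>F y in nhds x. ereal ((r - c) / t) < u (L y + b)"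
        by (auto simp: isCont_def tendsto_def filterlim_iff continuous_within eventually_nhds_conv_at)
      then show ?thesis
        by (rule eventually_mono) (use le in \<open>auto simp: real not_le[symmetric]\<close>)
    next
      case PInf then show ?thesis using s by simp
    next
      case MInf then show ?thesis using nm by auto
    qed
  next
    fix x y :: "real^'n" and r s a :: real
    assume xy: "w x \<le> ereal r" "w y \<le> ereal s" and a: "0 \<le> a" "a \<le> 1"
    have eq: "L ((1 - a) *\<^sub>R x + a *\<^sub>R y) + b = (1 - a) *\<^sub>R (L x + b) + a *\<^sub>R (L y + b)"
      using linear_add[OF \<open>linear L\<close>] linear_scale[OF \<open>linear L\<close>] by (simp add: scaleR_add_right)
    have "u (L ((1 - a) *\<^sub>R x + a *\<^sub>R y) + b) \<le> ereal ((1 - a) * ((r - c) / t) + a * ((s - c) / t))"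
      unfolding eq using xy a le by (intro Conv_sc_convex[OF u]) auto
    also have "(1 - a) * ((r - c) / t) + a * ((s - c) / t) = ((1 - a) * r + a * s - c) / t"
      using t by (simp add: field_simps)
    finally show "w ((1 - a) *\<^sub>R x + a *\<^sub>R y) \<le> ereal ((1 - a) * r + a * s)"
      by (simp add: le)
  next
    fix M :: real
    \<comment> \<open>After the shift by \<open>b\<close> half of the growth
      \<open>m * norm x\<close> remains. \<open>M'\<close> is chosen so that this half yields the
      slope \<open>\<bar>M\<bar> + 1\<close>, whose surplus \<open>norm x\<close> absorbs
      \<open>c\<close>.\<close>
    define M' where "M' = 2 * (\<bar>M\<bar> + 1) / (t * m)"
    have M': "M' \<ge> 0" "t * M' * (m / 2) = \<bar>M\<bar> + 1"
      using t m by (auto simp: M'_def)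
    obtain R where R: "\<And>x. R \<le> norm x \<Longrightarrow> ereal (M' * norm x) \<le> u x"
      using Conv_sc_supercoercive[OF u] by blast
    show "\<exists>R. \<forall>x. R \<le> norm x \<longrightarrow> ereal (M * norm x) \<le> w x"
    proof (intro exI allI impI)
      fix x :: "real^'n" assume x: "Max {2 * norm b / m, \<bar>c\<bar>, 2 * \<bar>R\<bar> / m} \<le> norm x"
      then have x': "2 * norm b \<le> m * norm x" "\<bar>c\<bar> \<le> norm x" "2 * \<bar>R\<bar> \<le> m * norm x"
        using m by (auto simp: field_simps)
      have "norm (L x) \<le> norm (L x + b) + norm b"
        by (metis add_diff_cancel_right' norm_triangle_ineq4)
      then have n: "m / 2 * norm x \<le> norm (L x + b)"
        using x' L(3)[of x] by simp
      have "M * norm x - c \<le> (\<bar>M\<bar> + 1) * norm x"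
      proof -
        have "M * norm x \<le> \<bar>M\<bar> * norm x" by (intro mult_right_mono) auto
        with x'(2) show ?thesis by (simp add: distrib_right)
      qed
      also have "\<dots> = t * (M' * (m / 2 * norm x))"
        using M'(2) by (metis mult.assoc)
      also have "\<dots> \<le> t * (M' * norm (L x + b))"
        using n t M'(1) by (intro mult_left_mono) auto
      finally have "(M * norm x - c) / t \<le> M' * norm (L x + b)"
        using t by (simp add: field_simps)
      moreover have "R \<le> norm (L x + b)"
        using n x'(3) by simp
      ultimately show "ereal (M * norm x) \<le> w x"
        unfolding ge using R[of "L x + b"] by (metis ereal_less_eq(3) order_trans)
    qed
  qed (rule nm)
  then show ?thesis by (simp add: w_def)
qed

lemma Conv_sc_add_const: "u \<in> Conv_sc \<Longrightarrow> (\<lambda>x. u x + ereal c) \<in> Conv_sc"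
  using Conv_sc_affine[of u 1 1 "\<lambda>x. x" 0 c] by (simp add: linear_ident one_ereal_def[symmetric])

lemma Conv_sc_translate: "u \<in> Conv_sc \<Longrightarrow> (\<lambda>y. u (y - x)) \<in> Conv_sc"
  using Conv_sc_affine[of u 1 1 "\<lambda>x. x" "- x" 0]
  by (simp add: linear_ident one_ereal_def[symmetric] zero_ereal_def[symmetric])

lemma Conv_sc_epi_mult: "u \<in> Conv_sc \<Longrightarrow> t > 0 \<Longrightarrow> epi_mult t u \<in> Conv_sc"
proof -
  assume u: "u \<in> Conv_sc" and t: "t > 0"
  have "surj (\<lambda>x::real^'a. x /\<^sub>R t)"
    by (rule surjI[of _ "\<lambda>x. t *\<^sub>R x"]) (use t in auto)
  then show ?thesis
    using Conv_sc_affine[OF u t, of "inverse t" "\<lambda>x. x /\<^sub>R t" 0 0] t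
    by (simp add: epi_mult_def zero_ereal_def[symmetric] linear_scale_self)
qed

text \<open>The sum of \<open>f\<close> and the convex indicator function of
  \<open>K\<close>.\<close>

definition rest :: "(real^'n) set \<Rightarrow> (real^'n \<Rightarrow> real) \<Rightarrow> ('n::finite) efun" where
  "rest K f = (\<lambda>x. if x \<in> K then ereal (f x) else \<infinity>)"

lemma edom_rest [simp]: "edom (rest K f) = K"
  by (auto simp: edom_def rest_def)

lemma rest_in_Conv_sc:
  fixes K :: "(real^'n) set"
  assumes K: "compact K" "K \<noteq> {}" and f: "convex_on K f" "continuous_on K f"
  shows "rest K f \<in> Conv_sc"
  unfolding Conv_sc_iff
proof (intro conjI allI impI)
  show "\<exists>x. rest K f x < \<infinity>" using K by (auto simp: rest_def)
next
  fix x c assume c: "c < rest K f x"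
  show "\<forall>\<^sub>F y in nhds x. c < rest K f y"
  proof (cases "x \<in> K")
    case False
    then have "\<forall>\<^sub>F y in nhds x. y \<in> - K"
      using K by (intro eventually_nhds_in_open) (auto simp: compact_imp_closed open_Compl)
    then show ?thesis
      by (rule eventually_mono) (use c False in \<open>auto simp: rest_def\<close>)
  next
    case True
    have "((\<lambda>y. ereal (f y)) \<longlongrightarrow> ereal (f x)) (at x within K)"
      using f(2) True by (auto simp: continuous_on_def)
    then have "\<forall>\<^sub>F y in at x within K. c < ereal (f y)"
      using c True by (auto simp: rest_def order_tendsto_iff)
    then show ?thesis
      using c by (auto simp: eventually_at_filter rest_def elim!: eventually_mono)
  qed
next
  fix x y :: "real^'n" and s t a :: real
  assume xy: "rest K f x \<le> ereal s" "rest K f y \<le> ereal t" and a: "0 \<le> a" "a \<le> 1"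
  then have "x \<in> K" "y \<in> K" "f x \<le> s" "f y \<le> t"
    by (auto simp: rest_def split: if_splits)
  moreover from this have "f ((1 - a) *\<^sub>R x + a *\<^sub>R y) \<le> (1 - a) * f x + a * f y"
    using f(1) a by (intro convex_onD) auto
  moreover have "(1 - a) *\<^sub>R x + a *\<^sub>R y \<in> K"
    using convex_on_imp_convex[OF f(1)] \<open>x \<in> K\<close> \<open>y \<in> K\<close> a by (auto simp: convex_alt)
  moreover have "(1 - a) * f x + a * f y \<le> (1 - a) * s + a * t"
    using \<open>f x \<le> s\<close> \<open>f y \<le> t\<close> a by (intro add_mono mult_left_mono) auto
  ultimately show "rest K f ((1 - a) *\<^sub>R x + a *\<^sub>R y) \<le> ereal ((1 - a) * s + a * t)"
    by (simp add: rest_def)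
next
  fix M :: real
  obtain R where "\<And>x. x \<in> K \<Longrightarrow> norm x < R"
    using compact_imp_bounded[OF K(1)] by (auto simp: bounded_pos_less)
  then show "\<exists>R. \<forall>x. R \<le> norm x \<longrightarrow> ereal (M * norm x) \<le> rest K f x"
    by (intro exI[of _ R]) (force simp: rest_def)
qed (auto simp: rest_def)

lemma rest_cbox_in_Conv_sc:
  fixes a b :: "real^'n"
  shows "cbox a b \<noteq> {} \<Longrightarrow> convex_on UNIV f \<Longrightarrow> rest (cbox a b) f \<in> Conv_sc"
  by (intro rest_in_Conv_sc) (auto intro: convex_on_subset continuous_on_subset convex_on_continuous)

section \<open>Epi-convergence\<close>

lemma epi_conv_eventually_gt:
  assumes "epi_conv U u" "X \<longlonglongrightarrow> x" "c < u x"
  shows "\<forall>\<^sub>F k in sequentially. c < U k (X k)"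
  using assms unfolding epi_conv_def le_Liminf_iff by blast

lemma epi_conv_recovery:
  assumes "epi_conv U u"
  obtains X where "X \<longlonglongrightarrow> x" "(\<lambda>k. U k (X k)) \<longlonglongrightarrow> u x"
  using assms unfolding epi_conv_def by blast

text \<open>Real thresholds suffice by density. Where \<open>u\<close> is infinite, the liminf
  condition makes the constant sequence a recovery sequence.\<close>

lemma epi_convI:
  assumes liminf: "\<And>X x c. X \<longlonglongrightarrow> x \<Longrightarrow> ereal c < u x \<Longrightarrow> \<forall>\<^sub>F k in sequentially. ereal c < U k (X k)"
    and rec: "\<And>x. u x < \<infinity> \<Longrightarrow> \<exists>X. X \<longlonglongrightarrow> x \<and> (\<lambda>k. U k (X k)) \<longlonglongrightarrow> u x"
  shows "epi_conv U u"
  unfolding epi_conv_def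
proof (intro allI conjI impI)
  fix x and X :: "nat \<Rightarrow> real^'a" assume X: "X \<longlonglongrightarrow> x"
  show "u x \<le> Liminf sequentially (\<lambda>k. U k (X k))"
  proof (rule ccontr)
    assume "\<not> ?thesis"
    then obtain c where c: "Liminf sequentially (\<lambda>k. U k (X k)) < ereal c" "ereal c < u x"
      by (auto simp: not_le dest: ereal_dense2)
    have "ereal c \<le> Liminf sequentially (\<lambda>k. U k (X k))"
      by (rule Liminf_bounded) (use liminf[OF X c(2)] in \<open>auto elim: eventually_mono\<close>)
    with c show False by simp
  qed
next
  fix x
  show "\<exists>X. X \<longlonglongrightarrow> x \<and> (\<lambda>k. U k (X k)) \<longlonglongrightarrow> u x"
  proof (cases "u x < \<infinity>")
    case True then show ?thesis by (rule rec)
  next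
    case False
    then have "u x = \<infinity>" by auto
    with liminf[of "\<lambda>_. x" x] show ?thesis
      by (intro exI[of _ "\<lambda>_. x"]) (simp add: tendsto_PInfty)
  qed
qed

lemma epi_conv_subseq:
  assumes U: "epi_conv U u" and r: "strict_mono (r :: nat \<Rightarrow> nat)"
  shows "epi_conv (\<lambda>k. U (r k)) u"
proof (rule epi_convI)
  fix X x c assume X: "X \<longlonglongrightarrow> x" and c: "ereal c < u x"
  \<comment> \<open>The test sequence along the selected indices becomes a full sequence by
    inserting the limit \<open>x\<close> at all other indices.\<close>
  define Y where "Y j = (if j \<in> range r then X (inv r j) else x)" for j
  have "Y \<longlonglongrightarrow> x"
  proof (rule topological_tendstoI)
    fix S assume S: "open S" "x \<in> S"
    then obtain N where N: "\<And>k. k \<ge> N \<Longrightarrow> X k \<in> S"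
      using topological_tendstoD[OF X] by (auto simp: eventually_sequentially)
    have "Y j \<in> S" if "j \<ge> r N" for j
    proof (cases "j \<in> range r")
      case True
      then obtain k where k: "j = r k" by auto
      with that have "k \<ge> N" using r by (simp add: strict_mono_less_eq)
      then show ?thesis using N k strict_mono_imp_inj_on[OF r] by (simp add: Y_def)
    qed (use S in \<open>simp add: Y_def\<close>)
    then show "\<forall>\<^sub>F j in sequentially. Y j \<in> S"
      by (auto simp: eventually_sequentially)
  qed
  from epi_conv_eventually_gt[OF U this c]
  have "\<forall>\<^sub>F k in sequentially. ereal c < U (r k) (Y (r k))"
    by (rule eventually_subseq[OF r])
  then show "\<forall>\<^sub>F k in sequentially. ereal c < U (r k) (X k)"
    using strict_mono_imp_inj_on[OF r] by (simp add: Y_def)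
next
  fix x
  obtain X where X: "X \<longlonglongrightarrow> x" "(\<lambda>k. U k (X k)) \<longlonglongrightarrow> u x"
    using epi_conv_recovery[OF U] by blast
  show "\<exists>X. X \<longlonglongrightarrow> x \<and> (\<lambda>k. U (r k) (X k)) \<longlonglongrightarrow> u x"
    using X[THEN LIMSEQ_subseq_LIMSEQ, OF r] by (intro exI[of _ "\<lambda>k. X (r k)"]) (simp add: o_def)
qed

text \<open>The hypothesis on \<open>f\<close> is continuous convergence along points of the boxes.
  Clamping coordinates to the boxes supplies recovery sequences, and it also repairs test sequences:
  where a test point leaves its box the value is infinite, and the clamped point may stand in for
  it.\<close>

lemma epi_conv_rest_cbox:
  fixes a b :: "nat \<Rightarrow> real^'n"
  assumes a: "a \<longlonglongrightarrow> a'" and b: "b \<longlonglongrightarrow> b'" and ne: "\<And>k. cbox (a k) (b k) \<noteq> {}"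
    and f: "\<And>X x. X \<longlonglongrightarrow> x \<Longrightarrow> (\<And>k. X k \<in> cbox (a k) (b k)) \<Longrightarrow> x \<in> cbox a' b' \<Longrightarrow>
      (\<lambda>k. f k (X k)) \<longlonglongrightarrow> f' x"
  shows "epi_conv (\<lambda>k. rest (cbox (a k) (b k)) (f k)) (rest (cbox a' b') f')"
proof -
  define P where "P k x = (\<chi> i. max (a k $ i) (min (x $ i) (b k $ i)))" for k and x :: "real^'n"
  have P_in: "P k x \<in> cbox (a k) (b k)" for k x
    using ne[of k] by (auto simp: P_def mem_box_cart max_def min_def interval_ne_empty_cart)
  have P_lim: "(\<lambda>k. P k x) \<longlonglongrightarrow> x" if "x \<in> cbox a' b'" for x
  proof (rule vec_tendstoI)
    fix i
    have "(\<lambda>k. P k x $ i) \<longlonglongrightarrow> max (a' $ i) (min (x $ i) (b' $ i))"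
      unfolding P_def by (auto intro!: tendsto_max tendsto_min tendsto_vec_nth a b)
    then show "(\<lambda>k. P k x $ i) \<longlonglongrightarrow> x $ i"
      using that by (simp add: mem_box_cart min_absorb1 max_absorb2)
  qed
  show ?thesis
  proof (rule epi_convI)
    fix X x c assume X: "X \<longlonglongrightarrow> x" and c: "ereal c < rest (cbox a' b') f' x"
    show "\<forall>\<^sub>F k in sequentially. ereal c < rest (cbox (a k) (b k)) (f k) (X k)"
    proof (cases "x \<in> cbox a' b'")
      case True
      define Y where "Y k = (if X k \<in> cbox (a k) (b k) then X k else P k x)" for k
      have Y: "Y \<longlonglongrightarrow> x"
      proof (rule topological_tendstoI)
        fix S assume "open S" "x \<in> S"
        with topological_tendstoD[OF X] topological_tendstoD[OF P_lim[OF True]]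
        have "\<forall>\<^sub>F k in sequentially. X k \<in> S" "\<forall>\<^sub>F k in sequentially. P k x \<in> S" by auto
        then show "\<forall>\<^sub>F k in sequentially. Y k \<in> S"
          by eventually_elim (simp add: Y_def)
      qed
      have "(\<lambda>k. f k (Y k)) \<longlonglongrightarrow> f' x"
        using P_in by (intro f Y True) (auto simp: Y_def)
      moreover have "c < f' x" using c True by (simp add: rest_def)
      ultimately have "\<forall>\<^sub>F k in sequentially. c < f k (Y k)"
        by (simp add: order_tendsto_iff)
      then show ?thesis
        by (rule eventually_mono) (auto simp: rest_def Y_def)
    next
      case False
      then obtain i where i: "x $ i < a' $ i \<or> b' $ i < x $ i"
        by (auto simp: mem_box_cart not_le)
      have Xi: "(\<lambda>k. a k $ i - X k $ i) \<longlonglongrightarrow> a' $ i - x $ i"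
        "(\<lambda>k. X k $ i - b k $ i) \<longlonglongrightarrow> x $ i - b' $ i"
        by (auto intro!: tendsto_diff tendsto_vec_nth X a b)
      have "\<forall>\<^sub>F k in sequentially. a k $ i - X k $ i > 0 \<or> X k $ i - b k $ i > 0"
        using i
      proof
        assume "x $ i < a' $ i"
        then have "\<forall>\<^sub>F k in sequentially. a k $ i - X k $ i > 0"
          by (intro order_tendstoD(1)[OF Xi(1)]) simp
        then show ?thesis by eventually_elim simp
      next
        assume "b' $ i < x $ i"
        then have "\<forall>\<^sub>F k in sequentially. X k $ i - b k $ i > 0"
          by (intro order_tendstoD(1)[OF Xi(2)]) simp
        then show ?thesis by eventually_elim simp
      qed
      then show ?thesis
      proof eventually_elim
        case (elim k)
        then have "X k \<notin> cbox (a k) (b k)"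
          by (auto simp: mem_box_cart not_le intro!: exI[of _ i])
        then show ?case by (simp add: rest_def)
      qed
    qed
  next
    fix x assume "rest (cbox a' b') f' x < \<infinity>"
    then have x: "x \<in> cbox a' b'" by (auto simp: rest_def split: if_splits)
    then show "\<exists>X. X \<longlonglongrightarrow> x \<and> (\<lambda>k. rest (cbox (a k) (b k)) (f k) (X k)) \<longlonglongrightarrow> rest (cbox a' b') f' x"
      using f[OF P_lim[OF x] P_in x] P_lim[OF x] P_in x
      by (intro exI[of _ "\<lambda>k. P k x"]) (simp add: rest_def)
  qed
qed


text \<open>The Pasch-Hausdorff envelope: the infimal convolution of \<open>u\<close> with
  \<open>k\<close> times the norm. For \<open>u\<close> in \<open>Conv_sc\<close> and
  \<open>k \<ge> 0\<close> it is finite, convex and \<open>k\<close>-Lipschitz on the whole space,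
  and it does not exceed \<open>u\<close>.\<close>

definition lipschitz_reg :: "('n::finite) efun \<Rightarrow> real \<Rightarrow> real^'n \<Rightarrow> real" where
  "lipschitz_reg u k x = (INF y\<in>edom u. real_of_ereal (u y) + k * norm (x - y))"

context
  fixes u :: "('n::finite) efun" and k :: real
  assumes u: "u \<in> Conv_sc" and k: "k \<ge> 0"
begin

lemma bdd_below_lipschitz_reg: "bdd_below ((\<lambda>y. real_of_ereal (u y) + k * norm (x - y)) ` edom u)"
proof -
  obtain m where m: "\<And>x. ereal m \<le> u x"
    using Conv_sc_bounded_below[OF u] by blast
  show ?thesis
  proof (rule bdd_belowI2[of _ m])
    fix y assume "y \<in> edom u"
    then have "m \<le> real_of_ereal (u y)"
      using m[of y] Conv_sc_real[OF u] by (metis ereal_less_eq(3))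
    then show "m \<le> real_of_ereal (u y) + k * norm (x - y)"
      using k by (simp add: add_increasing2)
  qed
qed

lemma edom_nonempty: "edom u \<noteq> {}"
  using Conv_sc_proper[OF u] by (auto simp: edom_iff)

lemma lipschitz_reg_le:
  "y \<in> edom u \<Longrightarrow> lipschitz_reg u k x \<le> real_of_ereal (u y) + k * norm (x - y)"
  unfolding lipschitz_reg_def by (rule cINF_lower[OF bdd_below_lipschitz_reg])

lemma lipschitz_reg_less:
  assumes "lipschitz_reg u k x < c"
  obtains y where "y \<in> edom u" "real_of_ereal (u y) + k * norm (x - y) < c"
  using assms cINF_less_iff[OF edom_nonempty bdd_below_lipschitz_reg, of x c]
  unfolding lipschitz_reg_def by blast

lemma lipschitz_reg_ge:
  "(\<And>y. y \<in> edom u \<Longrightarrow> c \<le> real_of_ereal (u y) + k * norm (x - y)) \<Longrightarrow> c \<le> lipschitz_reg u k x"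
  unfolding lipschitz_reg_def by (rule cINF_greatest[OF edom_nonempty])

lemma lipschitz_reg_diff_le: "lipschitz_reg u k x \<le> lipschitz_reg u k y + k * norm (x - y)"
proof -
  have "lipschitz_reg u k x - k * norm (x - y) \<le> lipschitz_reg u k y"
  proof (rule lipschitz_reg_ge)
    fix v assume "v \<in> edom u"
    from lipschitz_reg_le[OF this, of x]
    have "lipschitz_reg u k x \<le> real_of_ereal (u v) + k * norm (x - v)" .
    also have "k * norm (x - v) \<le> k * (norm (x - y) + norm (y - v))"
      using k norm_triangle_ineq[of "x - y" "y - v"] by (intro mult_left_mono) auto
    finally show "lipschitz_reg u k x - k * norm (x - y) \<le> real_of_ereal (u v) + k * norm (y - v)"
      by (simp add: algebra_simps)
  qed
  then show ?thesis by simp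
qed

lemma lipschitz_reg_lipschitz: "\<bar>lipschitz_reg u k x - lipschitz_reg u k y\<bar> \<le> k * norm (x - y)"
  using lipschitz_reg_diff_le[of x y] lipschitz_reg_diff_le[of y x]
  by (simp add: norm_minus_commute abs_le_iff)

text \<open>The convex combination of near-minimisers for \<open>x\<close> and \<open>y\<close> is a
  competitor for the combined point.\<close>

lemma convex_on_lipschitz_reg: "convex_on UNIV (lipschitz_reg u k)"
proof (rule convex_onI)
  fix t :: real and x y :: "real^'n" assume t: "0 < t" "t < 1"
  let ?f = "lipschitz_reg u k"
  show "?f ((1 - t) *\<^sub>R x + t *\<^sub>R y) \<le> (1 - t) * ?f x + t * ?f y"
  proof (rule field_le_epsilon)
    fix e :: real assume e: "e > 0"
    obtain v where v: "v \<in> edom u" "real_of_ereal (u v) + k * norm (x - v) < ?f x + e"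
      using lipschitz_reg_less[of x "?f x + e"] e by auto
    obtain w where w: "w \<in> edom u" "real_of_ereal (u w) + k * norm (y - w) < ?f y + e"
      using lipschitz_reg_less[of y "?f y + e"] e by auto
    let ?z = "(1 - t) *\<^sub>R v + t *\<^sub>R w"
    have z: "?z \<in> edom u"
      using convex_edom[OF u] v w t by (auto simp: convex_alt)
    have "?f ((1 - t) *\<^sub>R x + t *\<^sub>R y)
        \<le> real_of_ereal (u ?z) + k * norm ((1 - t) *\<^sub>R x + t *\<^sub>R y - ?z)"
      by (rule lipschitz_reg_le[OF z])
    also have "real_of_ereal (u ?z) \<le> (1 - t) * real_of_ereal (u v) + t * real_of_ereal (u w)"
      using convex_on_edom[OF u] v w t by (intro convex_onD) auto
    also have "k * norm ((1 - t) *\<^sub>R x + t *\<^sub>R y - ?z) \<le> k * ((1 - t) * norm (x - v) + t * norm (y - w))"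
    proof (intro mult_left_mono)
      have "(1 - t) *\<^sub>R x + t *\<^sub>R y - ?z = (1 - t) *\<^sub>R (x - v) + t *\<^sub>R (y - w)"
        by (simp add: algebra_simps)
      also have "norm \<dots> \<le> norm ((1 - t) *\<^sub>R (x - v)) + norm (t *\<^sub>R (y - w))"
        by (rule norm_triangle_ineq)
      finally show "norm ((1 - t) *\<^sub>R x + t *\<^sub>R y - ?z) \<le> (1 - t) * norm (x - v) + t * norm (y - w)"
        using t by simp
    qed (rule k)
    finally have "?f ((1 - t) *\<^sub>R x + t *\<^sub>R y)
        \<le> (1 - t) * (real_of_ereal (u v) + k * norm (x - v)) + t * (real_of_ereal (u w) + k * norm (y - w))"
      by (simp add: algebra_simps)
    also have "\<dots> \<le> (1 - t) * (?f x + e) + t * (?f y + e)"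
      using v w t by (intro add_mono[OF mult_left_mono mult_left_mono]) auto
    finally show "?f ((1 - t) *\<^sub>R x + t *\<^sub>R y) \<le> (1 - t) * ?f x + t * ?f y + e"
      by (simp add: algebra_simps)
  qed
qed simp

end

text \<open>The envelopes grow at most linearly, so only their restrictions to boxes lie in
  \<open>Conv_sc\<close>. For the lower bound, competitors near \<open>x\<close> are handled by
  lower semicontinuity; the others pay a penalty of at least \<open>k * (d / 2)\<close>, which
  outweighs the lower bound \<open>m\<close> of \<open>u\<close>.\<close>

lemma epi_conv_lipschitz_reg:
  fixes u :: "('n::finite) efun"
  assumes u: "u \<in> Conv_sc"
  shows "epi_conv (\<lambda>k. rest (cbox (- (\<chi> i. real k)) (\<chi> i. real k)) (lipschitz_reg u (real k))) u"
    (is "epi_conv (\<lambda>k. ?U k) u")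
proof -
  have liminf: "\<forall>\<^sub>F k in sequentially. ereal c < ?U k (X k)" if X: "X \<longlonglongrightarrow> x" and c: "ereal c < u x" for X x c
  proof -
    obtain c' where c': "c < c'" "ereal c' < u x"
      using ereal_dense2[OF c] by auto
    obtain m where m: "\<And>x. ereal m \<le> u x"
      using Conv_sc_bounded_below[OF u] by blast
    obtain d where d: "d > 0" "\<And>y. dist y x < d \<Longrightarrow> ereal c' < u y"
      using Conv_sc_lsc[OF u c'(2)] by (auto simp: eventually_nhds_metric)
    have "\<forall>\<^sub>F k in sequentially. dist (X k) x < d / 2"
      using tendstoD[OF X, of "d / 2"] d by auto
    moreover have "\<forall>\<^sub>F k in sequentially. m + real k * (d / 2) \<ge> c'"
      using d by real_asymp
    ultimately show ?thesis
    proof eventually_elim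
      case (elim k)
      have "c' \<le> lipschitz_reg u (real k) (X k)"
      proof (rule lipschitz_reg_ge[OF u])
        fix y assume y: "y \<in> edom u"
        then have r: "u y = ereal (real_of_ereal (u y))" by (rule Conv_sc_real[OF u])
        show "c' \<le> real_of_ereal (u y) + real k * norm (X k - y)"
        proof (cases "dist y x < d")
          case True
          then have "c' < real_of_ereal (u y)" using d(2) r by (metis less_ereal.simps(1))
          then show ?thesis by (simp add: add_increasing2)
        next
          case False
          then have "d / 2 \<le> norm (X k - y)"
            using elim(1) dist_triangle[of x y "X k"] by (simp add: dist_norm dist_commute norm_minus_commute)
          then have "real k * (d / 2) \<le> real k * norm (X k - y)" by (intro mult_left_mono) auto
          moreover have "m \<le> real_of_ereal (u y)" using m[of y] r by (metis ereal_less_eq(3))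
          ultimately show ?thesis using elim(2) by linarith
        qed
      qed simp
      with c' have "c < lipschitz_reg u (real k) (X k)" by linarith
      then show ?case by (simp add: rest_def)
    qed
  qed
  show ?thesis
  proof (rule epi_convI)
    fix x assume x: "u x < \<infinity>"
    then have xd: "x \<in> edom u" by (simp add: edom_iff)
    have "(\<lambda>k. ?U k x) \<longlonglongrightarrow> u x"
    proof (rule order_tendstoI)
      fix a assume a: "a < u x"
      show "\<forall>\<^sub>F k in sequentially. a < ?U k x"
      proof -
        obtain c where "a < ereal c" "ereal c < u x" using ereal_dense2[OF a] by blast
        from liminf[OF tendsto_const this(2)] this(1) show ?thesis
          by (auto elim!: eventually_mono)
      qed
    next
      fix a assume a: "u x < a"
      have "\<forall>\<^sub>F k in sequentially. norm x \<le> real k" by real_asymp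
      then show "\<forall>\<^sub>F k in sequentially. ?U k x < a"
      proof eventually_elim
        case (elim k)
        have "x \<in> cbox (- (\<chi> i. real k)) (\<chi> i. real k)"
          unfolding mem_box_cart using order_trans[OF component_le_norm_cart elim] by (auto simp: abs_le_iff)
            (metis minus_le_iff)
        then have "?U k x = ereal (lipschitz_reg u (real k) x)" by (simp add: rest_def)
        also have "\<dots> \<le> ereal (real_of_ereal (u x))"
          using lipschitz_reg_le[OF u _ xd, of "real k" x] by simp
        also have "\<dots> = u x" using Conv_sc_real[OF u xd] by simp
        finally show ?case using a by (rule le_less_trans)
      qed
    qed
    then show "\<exists>X. X \<longlonglongrightarrow> x \<and> (\<lambda>k. ?U k (X k)) \<longlonglongrightarrow> u x"
      by (intro exI[of _ "\<lambda>_. x"]) simp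
  qed (rule liminf)
qed

subsection \<open>Gradients\<close>

text \<open>\<open>real_of_ereal\<close> sends infinity to 0, so differentiability of the
  real-valued function speaks about \<open>u\<close> only in the interior of the domain.\<close>

definition has_egrad :: "('n::finite) efun \<Rightarrow> real^'n \<Rightarrow> real^'n \<Rightarrow> bool" where
  "has_egrad u x g \<longleftrightarrow> x \<in> interior (edom u) \<and>
     ((\<lambda>y. real_of_ereal (u y)) has_derivative (\<lambda>h. g \<bullet> h)) (at x)"

lemma has_egrad_in_edom: "has_egrad u x g \<Longrightarrow> x \<in> edom u"
  using interior_subset by (auto simp: has_egrad_def)

lemma has_egrad_directional:
  assumes "has_egrad u x g"
  shows "((\<lambda>t. real_of_ereal (u (x + t *\<^sub>R e))) has_field_derivative (g \<bullet> e)) (at 0)"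
proof -
  have "((\<lambda>t. x + t *\<^sub>R e) has_derivative (\<lambda>t. t *\<^sub>R e)) (at (0::real))"
    by (auto intro!: derivative_eq_intros)
  moreover have "((\<lambda>y. real_of_ereal (u y)) has_derivative (\<lambda>h. g \<bullet> h)) (at (x + 0 *\<^sub>R e))"
    using assms by (simp add: has_egrad_def)
  ultimately have "((\<lambda>t. real_of_ereal (u (x + t *\<^sub>R e))) has_derivative (\<lambda>t. g \<bullet> (t *\<^sub>R e))) (at 0)"
    by (rule has_derivative_compose)
  then show ?thesis
    by (simp add: has_field_derivative_def mult.commute[of _ "g \<bullet> e"])
qed

text \<open>Convexity bounds the difference quotients towards \<open>y\<close> by the full
  increment; the bound survives the limit at 0 from the right.\<close>

lemma has_egrad_tangent:
  assumes u: "u \<in> Conv_sc" and g: "has_egrad u x g"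
  shows "ereal (real_of_ereal (u x) + g \<bullet> (y - x)) \<le> u y"
proof (cases "y \<in> edom u")
  case True
  let ?f = "\<lambda>y. real_of_ereal (u y)"
  have x: "x \<in> edom u" using g by (rule has_egrad_in_edom)
  have "((\<lambda>t. ?f (x + t *\<^sub>R (y - x))) has_field_derivative (g \<bullet> (y - x))) (at 0)"
    by (rule has_egrad_directional[OF g])
  then have "((\<lambda>t. (?f (x + t *\<^sub>R (y - x)) - ?f x) / t) \<longlongrightarrow> g \<bullet> (y - x)) (at_right 0)"
    unfolding DERIV_def filterlim_at_split by simp
  moreover have "\<forall>\<^sub>F t in at_right 0. (?f (x + t *\<^sub>R (y - x)) - ?f x) / t \<le> ?f y - ?f x"
    using eventually_at_right_less[of "0::real"] eventually_at_right_real[of 0 "1::real", OF zero_less_one]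
  proof eventually_elim
    case (elim t)
    then have "?f (x + t *\<^sub>R (y - x)) - ?f x \<le> t * (?f (x + (y - x)) - ?f x)"
      using x True by (intro convex_on_increment_le[OF convex_on_edom[OF u]]) auto
    then show ?case using elim by (simp add: field_simps)
  qed
  ultimately have "g \<bullet> (y - x) \<le> ?f y - ?f x"
    by (intro tendsto_upperbound) auto
  then have "ereal (?f x + g \<bullet> (y - x)) \<le> ereal (?f y)" by simp
  then show ?thesis using Conv_sc_real[OF u True] by simp
qed (simp add: edom_iff)

text \<open>Subtracting the affine minorant leaves a function with a minimum at \<open>x\<close>,
  whose derivative vanishes. Gradients are identified through this lemma throughout, also as
  limits.\<close>

lemma has_egrad_unique_subgradient:
  assumes u: "u \<in> Conv_sc" and g: "has_egrad u x g"
    and sub: "\<And>y. ereal (real_of_ereal (u x) + g' \<bullet> (y - x)) \<le> u y"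
  shows "g' = g"
proof -
  let ?f = "\<lambda>y. real_of_ereal (u y)"
  define \<phi> where "\<phi> y = ?f y - g' \<bullet> (y - x)" for y
  have d: "(\<phi> has_derivative (\<lambda>h. g \<bullet> h - g' \<bullet> h)) (at x)"
    unfolding \<phi>_def using g
    by (auto simp: has_egrad_def intro!: derivative_eq_intros)
  have ge: "\<phi> x \<le> \<phi> y" if "y \<in> interior (edom u)" for y
  proof -
    have "y \<in> edom u" using that interior_subset by auto
    then have "u y = ereal (?f y)" by (rule Conv_sc_real[OF u])
    with sub[of y] have "?f x + g' \<bullet> (y - x) \<le> ?f y"
      by (metis ereal_less_eq(3))
    then show ?thesis by (simp add: \<phi>_def)
  qed
  have x: "x \<in> interior (edom u)" using g by (simp add: has_egrad_def)
  have "(\<lambda>h. g \<bullet> h - g' \<bullet> h) = (\<lambda>h. 0)"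
    by (rule differential_zero_maxmin[OF x open_interior d]) (use ge in blast)
  then have "g \<bullet> (g - g') - g' \<bullet> (g - g') = 0"
    by (rule fun_cong)
  then have "(g - g') \<bullet> (g - g') = 0"
    by (simp only: inner_diff_left)
  then show ?thesis by simp
qed

lemma has_egrad_egrad:
  assumes "u \<in> Conv_sc" "has_egrad u x g"
  shows "egrad u x = g"
proof -
  have "\<exists>g. ((\<lambda>y. real_of_ereal (u y)) has_derivative (\<lambda>h. g \<bullet> h)) (at x)"
    using assms(2) unfolding has_egrad_def by blast
  then have "((\<lambda>y. real_of_ereal (u y)) has_derivative (\<lambda>h. egrad u x \<bullet> h)) (at x)"
    unfolding egrad_def by (rule someI_ex)
  then have "has_egrad u x (egrad u x)"
    using assms(2) by (simp add: has_egrad_def)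
  then show ?thesis
    using has_egrad_tangent[OF assms(1)] has_egrad_unique_subgradient[OF assms] by blast
qed

text \<open>A tangent of the smaller function is a subgradient of the larger one at the touching
  point. This is the source of the valuation property of moments.\<close>

lemma has_egrad_le_touching:
  assumes u: "u \<in> Conv_sc" and w: "w \<in> Conv_sc" and le: "\<And>y. w y \<le> u y" and eq: "w x = u x"
    and g: "has_egrad u x g" "has_egrad w x h"
  shows "g = h"
  using has_egrad_unique_subgradient[OF u g(1), of h] has_egrad_tangent[OF w g(2)] le eq
  by (metis order_trans)

text \<open>The frontier of a convex set is negligible, which leaves the open interior of the
  domain.\<close>

lemma AE_has_egrad:
  fixes u :: "('n::finite) efun"
  assumes u: "u \<in> Conv_sc"
  shows "AE x in lborel. x \<in> edom u \<longrightarrow> has_egrad u x (egrad u x)"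
proof -
  have "AE x in lborel. x \<in> interior (edom u) \<longrightarrow>
      (\<exists>g. ((\<lambda>y. real_of_ereal (u y)) has_derivative (\<lambda>h. g \<bullet> h)) (at x))"
    by (intro convex_on_AE_differentiable convex_on_subset[OF convex_on_edom[OF u]])
      (auto simp: interior_subset convex_interior convex_edom[OF u])
  moreover have "AE x in lborel. x \<notin> frontier (edom u)"
    using AE_not_in[of "frontier (edom u)" lebesgue] negligible_convex_frontier[OF convex_edom[OF u]]
    by (simp add: AE_completion_iff negligible_iff_null_sets)
  ultimately show ?thesis
  proof eventually_elim
    case (elim x)
    show ?case
    proof
      assume x: "x \<in> edom u"
      then have "x \<in> interior (edom u)"
        using elim(2) closure_subset by (auto simp: frontier_def)
      with elim(1) obtain g where "has_egrad u x g"
        by (auto simp: has_egrad_def)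
      then show "has_egrad u x (egrad u x)"
        using has_egrad_egrad[OF u] by auto
    qed
  qed
qed

section \<open>Moments of densities depending on the gradient\<close>

subsection \<open>Invariance of Lebesgue measure under orthogonal maps\<close>

text \<open>Uniqueness of Haar measure: the double integral of the product of the indicators of A at
  x + y and of B at y is evaluated in two ways.\<close>

lemma translation_invariant_measure_unique:
  fixes M :: "'a::euclidean_space measure"
  assumes "sigma_finite_measure M" and sets[measurable_cong]: "sets M = sets borel"
    and inv: "\<And>v. distr M borel ((+) v) = M"
    and [measurable]: "A \<in> sets borel" "B \<in> sets borel"
  shows "emeasure lborel A * emeasure M B = emeasure M A * emeasure lborel B"
proof -
  interpret M: sigma_finite_measure M by fact
  interpret P: pair_sigma_finite M lborel ..
  have reflL: "(\<integral>\<^sup>+x. indicator B (v - x) \<partial>lborel) = emeasure lborel B" for v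
  proof -
    have "lborel = distr lborel borel (\<lambda>x. v - x)"
      using lborel_affine[of "-1" v] by (simp add: density_1)
    then have "emeasure lborel B = (\<integral>\<^sup>+x. indicator B x \<partial>(distr lborel borel (\<lambda>x. v - x)))"
      by simp
    also have "\<dots> = (\<integral>\<^sup>+x. indicator B (v - x) \<partial>lborel)"
      by (rule nn_integral_distr) auto
    finally show ?thesis by simp
  qed
  have shiftM: "(\<integral>\<^sup>+y. f y \<partial>M) = (\<integral>\<^sup>+y. f (v + y) \<partial>M)" if [measurable]: "f \<in> borel_measurable borel"
    for f :: "'a \<Rightarrow> ennreal" and v
  proof -
    have "(\<integral>\<^sup>+y. f y \<partial>M) = (\<integral>\<^sup>+y. f y \<partial>(distr M borel ((+) v)))"
      by (simp add: inv)
    also have "\<dots> = (\<integral>\<^sup>+y. f (v + y) \<partial>M)"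
      by (rule nn_integral_distr) auto
    finally show ?thesis .
  qed
  have "emeasure lborel A * emeasure M B = (\<integral>\<^sup>+y. indicator B y * emeasure lborel A \<partial>M)"
    by (simp add: nn_integral_multc mult.commute sets)
  also have "\<dots> = (\<integral>\<^sup>+y. \<integral>\<^sup>+x. indicator B y * indicator A (x + y) \<partial>lborel \<partial>M)"
    by (simp add: nn_integral_cmult nn_integral_indicator_shift)
  also have "\<dots> = (\<integral>\<^sup>+x. \<integral>\<^sup>+y. indicator B y * indicator A (x + y) \<partial>M \<partial>lborel)"
    by (rule P.Fubini'[symmetric]) measurable
  also have "\<dots> = (\<integral>\<^sup>+x. \<integral>\<^sup>+y. indicator B (y - x) * indicator A y \<partial>M \<partial>lborel)"
  proof (rule nn_integral_cong)
    fix x :: 'a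
    show "(\<integral>\<^sup>+y. indicator B y * indicator A (x + y) \<partial>M) = (\<integral>\<^sup>+y. indicator B (y - x) * indicator A y \<partial>M)"
      using shiftM[of "\<lambda>y. indicator B (y - x) * indicator A y" x] by simp
  qed
  also have "\<dots> = (\<integral>\<^sup>+y. \<integral>\<^sup>+x. indicator B (y - x) * indicator A y \<partial>lborel \<partial>M)"
    by (rule P.Fubini') measurable
  also have "\<dots> = (\<integral>\<^sup>+y. emeasure lborel B * indicator A y \<partial>M)"
    by (simp add: nn_integral_multc reflL)
  also have "\<dots> = emeasure M A * emeasure lborel B"
    by (subst nn_integral_cmult_indicator) (simp_all add: sets mult.commute)
  finally show ?thesis .
qed

text \<open>The image measure is translation invariant since \<open>f\<close> is linear and onto,
  hence a multiple of Lebesgue measure. Centred balls are preserved, which fixes the factor.\<close>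

lemma lborel_distr_orthogonal:
  fixes f :: "'a::euclidean_space \<Rightarrow> 'a"
  assumes f: "orthogonal_transformation f"
  shows "distr lborel borel f = lborel"
proof -
  define M where "M = distr lborel borel f"
  have lin: "linear f" using f by (rule orthogonal_transformation_linear)
  then have cont: "continuous_on UNIV f" by (simp add: linear_continuous_on linear_conv_bounded_linear)
  have [measurable]: "f \<in> borel \<rightarrow>\<^sub>M borel" using cont by (rule borel_measurable_continuous_onI)
  have sets[measurable_cong]: "sets M = sets borel" by (simp add: M_def)
  have ball: "emeasure M (ball 0 r) = emeasure lborel (ball (0::'a) r)" for r
  proof -
    have "f -` ball 0 r = ball 0 r"
      using orthogonal_transformation_norm[OF f] by auto
    then show ?thesis by (simp add: M_def emeasure_distr)
  qed
  have fin: "emeasure lborel (ball (0::'a) r) \<noteq> \<infinity>" for r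
    using emeasure_bounded_finite[OF bounded_ball, of "0::'a" r] by simp
  have sf: "sigma_finite_measure M"
  proof
    show "\<exists>A. countable A \<and> A \<subseteq> sets M \<and> \<Union>A = space M \<and> (\<forall>a\<in>A. emeasure M a \<noteq> \<infinity>)"
    proof (intro exI conjI)
      show "(\<Union>n::nat. {ball (0::'a) (real n)}) \<subseteq> sets M" by (auto simp: sets)
      show "\<Union> (\<Union>n::nat. {ball (0::'a) (real n)}) = space M"
        using reals_Archimedean2 by (auto simp: M_def)
    qed (use ball fin in auto)
  qed
  have inv: "distr M borel ((+) v) = M" for v
  proof -
    obtain w where w: "f w = v"
      using orthogonal_transformation_surj[OF f] by (metis surjD)
    have "distr M borel ((+) v) = distr lborel borel (\<lambda>x. v + f x)"
      by (simp add: M_def distr_distr o_def)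
    also have "(\<lambda>x. v + f x) = f \<circ> ((+) w)"
      using lin w by (auto simp: linear_add)
    also have "distr lborel borel (f \<circ> ((+) w)) = distr (distr lborel borel ((+) w)) borel f"
      by (simp add: distr_distr)
    also have "\<dots> = M" by (simp add: lborel_distr_plus M_def)
    finally show ?thesis .
  qed
  have "emeasure M A = emeasure lborel A" if A: "A \<in> sets borel" for A
  proof -
    let ?B = "ball (0::'a) 1"
    have "emeasure lborel A * emeasure lborel ?B = emeasure M A * emeasure lborel ?B"
      using translation_invariant_measure_unique[OF sf sets inv A, of ?B] by (simp add: ball)
    moreover have "emeasure lborel ?B \<noteq> 0"
      using open_not_negligible[of ?B] by (auto simp: negligible_iff_null_sets null_sets_def)
    ultimately show ?thesis
      using fin[of 1] ennreal_mult_cancel_left[of "emeasure lborel ?B"] by (simp add: mult.commute)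
  qed
  then have "M = lborel"
    by (intro measure_eqI) (auto simp: sets)
  then show ?thesis by (simp add: M_def)
qed

lemma lborel_similarity:
  fixes f :: "'a::euclidean_space \<Rightarrow> 'a"
  assumes f: "orthogonal_transformation f" and t: "t > 0"
  shows "lborel = density (distr lborel borel (\<lambda>x. b + t *\<^sub>R f x)) (\<lambda>_. ennreal (t ^ DIM('a)))"
proof -
  have [measurable]: "f \<in> borel \<rightarrow>\<^sub>M borel"
    using orthogonal_transformation_linear[OF f]
    by (intro borel_measurable_continuous_onI) (simp add: linear_continuous_on linear_conv_bounded_linear)
  have "lborel = density (distr lborel borel (\<lambda>x. b + t *\<^sub>R x)) (\<lambda>_. ennreal (t ^ DIM('a)))"
    using lborel_affine[of t b] t by simp
  also have "distr lborel borel (\<lambda>x. b + t *\<^sub>R x) = distr (distr lborel borel f) borel (\<lambda>x. b + t *\<^sub>R x)"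
    by (simp add: lborel_distr_orthogonal[OF f])
  also have "\<dots> = distr lborel borel (\<lambda>x. b + t *\<^sub>R f x)"
    by (simp add: distr_distr o_def)
  finally show ?thesis .
qed

subsection \<open>A Borel version of the gradient\<close>

text \<open>\<open>egrad\<close> is defined by choice and its measurability is unclear where no
  gradient exists. Limits of difference quotients along the coordinate axes are Borel measurable and
  give the same vector wherever there is a gradient.\<close>

definition bgrad :: "('n::finite) efun \<Rightarrow> real^'n \<Rightarrow> real^'n" where
  "bgrad u x = (\<Sum>i\<in>UNIV. lim (\<lambda>m. real (Suc m) *
     (real_of_ereal (u (x + (1 / real (Suc m)) *\<^sub>R axis i 1)) - real_of_ereal (u x))) *\<^sub>R axis i 1)"

lemma borel_measurable_bgrad:
  assumes "u \<in> Conv_sc"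
  shows "bgrad u \<in> borel_measurable borel"
proof -
  have [measurable]: "u \<in> borel_measurable borel"
    by (rule borel_measurable_Conv_sc[OF assms])
  show ?thesis
    unfolding bgrad_def by measurable
qed

lemma has_egrad_bgrad:
  assumes g: "has_egrad u x g"
  shows "bgrad u x = g"
proof -
  let ?f = "\<lambda>y. real_of_ereal (u y)"
  have lim: "(\<lambda>m. real (Suc m) * (?f (x + (1 / real (Suc m)) *\<^sub>R e) - ?f x)) \<longlonglongrightarrow> g \<bullet> e" for e
  proof -
    have "((\<lambda>t. ?f (x + t *\<^sub>R e)) has_field_derivative (g \<bullet> e)) (at 0)"
      by (rule has_egrad_directional[OF g])
    then have "((\<lambda>t. (?f (x + t *\<^sub>R e) - ?f x) / t) \<longlongrightarrow> g \<bullet> e) (at 0)"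
      unfolding DERIV_def by simp
    moreover have "filterlim (\<lambda>m. 1 / real (Suc m)) (at 0) sequentially"
      unfolding filterlim_at using LIMSEQ_inverse_real_of_nat by (auto simp: inverse_eq_divide)
    ultimately have "(\<lambda>m. (?f (x + (1 / real (Suc m)) *\<^sub>R e) - ?f x) / (1 / real (Suc m))) \<longlonglongrightarrow> g \<bullet> e"
      by (rule filterlim_compose)
    then show ?thesis by (simp add: mult.commute del: of_nat_Suc)
  qed
  have "bgrad u x = (\<Sum>i\<in>UNIV. (g \<bullet> axis i 1) *\<^sub>R axis i 1)"
    unfolding bgrad_def using lim[THEN limI] by (intro sum.cong) auto
  also have "\<dots> = g"
    using basis_expansion[of g] by (simp add: inner_axis scalar_mult_eq_scaleR)
  finally show ?thesis .
qed

lemma AE_has_bgrad: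
  assumes "u \<in> Conv_sc"
  shows "AE x in lborel. x \<in> edom u \<longrightarrow> has_egrad u x (bgrad u x)"
  using AE_has_egrad[OF assms] by eventually_elim (auto simp: has_egrad_bgrad)

lemma edom_in_borel: "u \<in> Conv_sc \<Longrightarrow> edom u \<in> sets borel"
  unfolding edom_def using borel_measurable_Conv_sc by measurable

definition gdens :: "(real^'n \<Rightarrow> real) \<Rightarrow> ('n::finite) efun \<Rightarrow> real^'n \<Rightarrow> real" where
  "gdens \<zeta> u x = indicator (edom u) x * \<zeta> (bgrad u x)"

text \<open>This is the function associated with \<open>zeta_moment\<close> by translation
  covariance.\<close>

definition zeta_vol :: "(real^'n \<Rightarrow> real) \<Rightarrow> ('n::finite) efun \<Rightarrow> real" where
  "zeta_vol \<zeta> u = (\<integral>x. gdens \<zeta> u x \<partial>lborel)"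

lemma borel_measurable_gdens:
  assumes "u \<in> Conv_sc" "\<zeta> \<in> borel_measurable borel"
  shows "gdens \<zeta> u \<in> borel_measurable borel"
proof -
  note [measurable] = edom_in_borel[OF assms(1)] borel_measurable_bgrad[OF assms(1)] assms(2)
  show ?thesis unfolding gdens_def by measurable
qed

text \<open>Both integrands agree almost everywhere, which allows the passage from
  \<open>egrad\<close> and Lebesgue sets to \<open>bgrad\<close> and Borel sets.\<close>

lemma zeta_moment_eq:
  assumes u: "u \<in> Conv_sc" and \<zeta>: "\<zeta> \<in> borel_measurable borel"
  shows "zeta_moment \<zeta> u = (\<integral>x. gdens \<zeta> u x *\<^sub>R x \<partial>lborel)"
proof -
  note [measurable] = borel_measurable_gdens[OF assms]
  let ?F = "\<lambda>x. indicator (edom u) x *\<^sub>R \<zeta> (egrad u x) *\<^sub>R x"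
  have ae: "AE x in lebesgue. gdens \<zeta> u x *\<^sub>R x = ?F x"
    unfolding AE_completion_iff using AE_has_egrad[OF u]
    by eventually_elim (auto simp: gdens_def has_egrad_bgrad indicator_def)
  have m: "(\<lambda>x. gdens \<zeta> u x *\<^sub>R x) \<in> borel_measurable lborel" by measurable
  have m': "(\<lambda>x. gdens \<zeta> u x *\<^sub>R x) \<in> borel_measurable lebesgue"
    by (rule measurable_completion[OF m])
  have "zeta_moment \<zeta> u = (\<integral>x. ?F x \<partial>lebesgue)"
    by (simp add: zeta_moment_def set_lebesgue_integral_def)
  also have "\<dots> = (\<integral>x. gdens \<zeta> u x *\<^sub>R x \<partial>lebesgue)"
    using ae borel_measurable_AE[OF m' ae] m' by (intro integral_cong_AE) auto
  also have "\<dots> = (\<integral>x. gdens \<zeta> u x *\<^sub>R x \<partial>lborel)"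
    by (rule integral_completion[OF m])
  finally show ?thesis .
qed

lemma Cc_RnE:
  fixes \<zeta> :: "real^'n \<Rightarrow> real"
  assumes "\<zeta> \<in> Cc_Rn"
  obtains R B where "continuous_on UNIV \<zeta>" "\<zeta> \<in> borel_measurable borel" "R > 0"
    "\<And>y. \<zeta> y \<noteq> 0 \<Longrightarrow> norm y \<le> R" "B > 0" "\<And>y. \<bar>\<zeta> y\<bar> \<le> B"
proof -
  let ?S = "closure {x. \<zeta> x \<noteq> 0}"
  have c: "continuous_on UNIV \<zeta>" "compact ?S"
    using assms by (auto simp: Cc_Rn_def)
  obtain R where R: "R > 0" "\<And>y. y \<in> ?S \<Longrightarrow> norm y \<le> R"
    using compact_imp_bounded[OF c(2)] by (auto simp: bounded_pos)
  have "compact (\<zeta> ` ?S)"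
    using c by (intro compact_continuous_image continuous_on_subset[OF c(1)]) auto
  then have "bounded (\<zeta> ` ?S)" by (rule compact_imp_bounded)
  then obtain B where "B > 0" "\<forall>v\<in>\<zeta> ` ?S. norm v \<le> B"
    unfolding bounded_pos by blast
  then have B: "B > 0" "\<And>y. y \<in> ?S \<Longrightarrow> \<bar>\<zeta> y\<bar> \<le> B"
    by auto
  have S: "\<zeta> y \<noteq> 0 \<Longrightarrow> y \<in> ?S" for y
    using closure_subset[of "{x. \<zeta> x \<noteq> 0}"] by auto
  have "\<bar>\<zeta> y\<bar> \<le> B" for y
    using B S by (cases "\<zeta> y = 0") auto
  then show ?thesis
    using c(1) R S B(1) by (intro that[of R B] borel_measurable_continuous_onI) auto
qed

lemma Cc_RnI:
  fixes \<zeta> :: "real^'n \<Rightarrow> real"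
  assumes "continuous_on UNIV \<zeta>" "\<And>y. \<zeta> y \<noteq> 0 \<Longrightarrow> norm y \<le> R"
  shows "\<zeta> \<in> Cc_Rn"
proof -
  have "bounded {x. \<zeta> x \<noteq> 0}"
    using assms(2) by (intro boundedI[of _ R]) auto
  then show ?thesis
    using assms(1) by (simp add: Cc_Rn_def compact_eq_bounded_closed bounded_closure)
qed

subsection \<open>Supports and gradients along epi-convergent sequences\<close>

lemma epi_conv_const:
  assumes "u \<in> Conv_sc"
  shows "epi_conv (\<lambda>_. u) u"
proof (rule epi_convI)
  fix X x c assume "X \<longlonglongrightarrow> x" "ereal c < u x"
  then show "\<forall>\<^sub>F k in sequentially. ereal c < u (X k)"
    using Conv_sc_lsc[OF assms] unfolding filterlim_iff by blast
qed (auto intro!: exI[of _ "\<lambda>_. _"])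

text \<open>On a sphere of radius \<open>r\<close> about \<open>Y k\<close> the function exceeds its
  value at the centre by more than \<open>R * r\<close>. Convexity extends this growth to all points
  beyond the sphere, where a tangent of slope at most \<open>R\<close> would pass above the graph at
  the centre.\<close>

lemma epi_conv_gradient_support:
  fixes U :: "nat \<Rightarrow> ('n::finite) efun"
  assumes U: "\<And>k. U k \<in> Conv_sc" and u: "u \<in> Conv_sc" and epi: "epi_conv U u" and R: "R \<ge> 0"
  obtains \<rho> where "\<forall>\<^sub>F k in sequentially. \<forall>x g. has_egrad (U k) x g \<longrightarrow> norm g \<le> R \<longrightarrow> norm x \<le> \<rho>"
proof -
  obtain y0 where y0: "y0 \<in> edom u" using Conv_sc_proper[OF u] by (auto simp: edom_iff)
  define v0 where "v0 = real_of_ereal (u y0)"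
  have v0: "u y0 = ereal v0" using Conv_sc_real[OF u y0] by (simp add: v0_def)
  obtain Y where Y: "Y \<longlonglongrightarrow> y0" "(\<lambda>k. U k (Y k)) \<longlonglongrightarrow> u y0"
    using epi_conv_recovery[OF epi] by blast
  obtain R0 where R0: "\<And>x. R0 \<le> norm x \<Longrightarrow> ereal ((R + 2) * norm x) \<le> u x"
    using Conv_sc_supercoercive[OF u] by blast
  \<comment> \<open>The second entry puts the sphere where \<open>u\<close> grows with slope
    \<open>R + 2\<close>; the third makes \<open>(R + 2) * (r - norm y0)\<close> exceed the value
    \<open>c\<close> defined below.\<close>
  define r where "r = Max {1, R0 + norm y0, v0 + 2 + (R + 2) * norm y0}"
  have r: "r \<ge> 1" "r \<ge> R0 + norm y0" "r \<ge> v0 + 2 + (R + 2) * norm y0"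
    by (auto simp: r_def)
  define c where "c = v0 + (R + 1) * r + 1"
  have sphere: "ereal c < u x" if "norm (x - y0) = r" for x
  proof -
    have n: "r - norm y0 \<le> norm x"
      using norm_triangle_ineq4[of x y0] that by simp
    have "c < (R + 2) * (r - norm y0)"
      using r(3) by (simp add: c_def algebra_simps)
    also have "\<dots> \<le> (R + 2) * norm x"
      using n R by (intro mult_left_mono) auto
    finally have "ereal c < ereal ((R + 2) * norm x)" by simp
    also have "\<dots> \<le> u x"
      using n r(2) by (intro R0) auto
    finally show ?thesis .
  qed
  \<comment> \<open>The estimate about \<open>y0\<close> for \<open>u\<close> passes to spheres
    about \<open>Y k\<close> for \<open>U k\<close>: otherwise compactness yields a limit point on
    the sphere about \<open>y0\<close> that violates it.\<close>
  have ev: "\<forall>\<^sub>F k in sequentially. \<forall>x. norm (x - Y k) = r \<longrightarrow> ereal c < U k x"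
  proof (rule ccontr)
    assume neg: "\<not> ?thesis"
    obtain s where s: "strict_mono (s :: nat \<Rightarrow> nat)"
      "\<forall>j. \<exists>x. norm (x - Y (s j)) = r \<and> U (s j) x \<le> ereal c"
      using not_eventually_sequentiallyD[OF neg] by (auto simp: not_less)
    then obtain X where X: "\<And>j. norm (X j - Y (s j)) = r" "\<And>j. U (s j) (X j) \<le> ereal c"
      by metis
    have "compact (sphere (0::real^'n) r)" by simp
    then obtain d q where d: "strict_mono (q :: nat \<Rightarrow> nat)" "((\<lambda>j. X j - Y (s j)) \<circ> q) \<longlonglongrightarrow> d"
      unfolding compact_def using X(1) by (metis (no_types, lifting) mem_sphere_0)
    have sq: "strict_mono (s \<circ> q)" using s(1) d(1) by (rule strict_mono_o)
    have "(\<lambda>j. Y ((s \<circ> q) j)) \<longlonglongrightarrow> y0"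
      using LIMSEQ_subseq_LIMSEQ[OF Y(1) sq] by (simp add: o_def)
    then have lim: "(\<lambda>j. X (q j)) \<longlonglongrightarrow> d + y0"
      using tendsto_add[OF d(2)] by (fastforce simp: o_def)
    have "norm d = r"
      using tendsto_norm[OF d(2)] X(1) by (simp add: o_def LIMSEQ_const_iff)
    then have "ereal c < u (d + y0)" by (intro sphere) simp
    from epi_conv_eventually_gt[OF epi_conv_subseq[OF epi sq] lim this]
    have "\<forall>\<^sub>F j in sequentially. ereal c < U (s (q j)) (X (q j))"
      by (simp add: o_def)
    then have "\<forall>\<^sub>F j::nat in sequentially. False"
      by (rule eventually_mono) (use X(2) in \<open>auto simp: not_less[symmetric]\<close>)
    then show False by simp
  qed
  have "\<forall>\<^sub>F k in sequentially. U k (Y k) < ereal (v0 + 1)"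
    by (rule order_tendstoD(2)[OF Y(2)]) (simp add: v0)
  moreover have "\<forall>\<^sub>F k in sequentially. dist (Y k) y0 < 1"
    using Y(1) by (rule tendstoD) simp
  ultimately have "\<forall>\<^sub>F k in sequentially. \<forall>x g. has_egrad (U k) x g \<longrightarrow> norm g \<le> R \<longrightarrow> norm x \<le> r + norm y0 + 1"
    using ev
  proof eventually_elim
    case (elim k)
    have Yk: "Y k \<in> edom (U k)" using elim(1) by (auto simp: edom_iff)
    define a where "a = real_of_ereal (U k (Y k))"
    have a: "U k (Y k) = ereal a" "a < v0 + 1"
      using Conv_sc_real[OF U Yk] elim(1) unfolding a_def by (simp, metis less_ereal.simps(1))
    show ?case
    proof (intro allI impI)
      fix x g assume g: "has_egrad (U k) x g" "norm g \<le> R"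
      define b where "b = real_of_ereal (U k x)"
      have b: "U k x = ereal b"
        using Conv_sc_real[OF U has_egrad_in_edom[OF g(1)]] by (simp add: b_def)
      have "norm (x - Y k) \<le> r"
      proof (rule ccontr)
        assume "\<not> norm (x - Y k) \<le> r"
        then have far: "norm (x - Y k) > r" by simp
        then have n0: "norm (x - Y k) > 0" using r by linarith
        define l where "l = r / norm (x - Y k)"
        have l: "0 \<le> l" "l \<le> 1" "l * norm (x - Y k) = r"
          using far r n0 by (auto simp: l_def)
        have "ereal (b + g \<bullet> (Y k - x)) \<le> ereal a"
          using has_egrad_tangent[OF U g(1), of "Y k"] a by (simp add: b_def)
        then have "b \<le> a + g \<bullet> (x - Y k)"
          by (simp add: inner_diff_right)
        also have "g \<bullet> (x - Y k) \<le> R * norm (x - Y k)"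
          using norm_cauchy_schwarz[of g "x - Y k"] g(2) by (meson mult_right_mono norm_ge_zero order_trans)
        finally have ba: "l * (b - a) \<le> l * (R * norm (x - Y k))"
          using l by (intro mult_left_mono) auto
        define p where "p = (1 - l) *\<^sub>R Y k + l *\<^sub>R x"
        have "norm (p - Y k) = r"
        proof -
          have "p - Y k = l *\<^sub>R (x - Y k)" by (simp add: p_def algebra_simps)
          then show ?thesis using l by simp
        qed
        with elim(3) have "ereal c < U k p" by blast
        also have "\<dots> \<le> ereal ((1 - l) * a + l * b)"
          unfolding p_def using l a b by (intro Conv_sc_convex[OF U]) auto
        finally have "c < a + l * (b - a)" by (simp add: algebra_simps)
        also have "\<dots> \<le> a + R * r" using ba l by (simp add: algebra_simps)
        finally show False using a r by (simp add: c_def algebra_simps)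
      qed
      then show "norm x \<le> r + norm y0 + 1"
        using elim(2) norm_triangle_sub[of x "Y k"] norm_triangle_sub[of "Y k" y0]
        by (simp add: dist_norm)
    qed
  qed
  then show ?thesis by (rule that)
qed

lemma gradient_support_bounded:
  assumes u: "u \<in> Conv_sc" and R: "R \<ge> 0"
  obtains \<rho> where "\<And>x g. has_egrad u x g \<Longrightarrow> norm g \<le> R \<Longrightarrow> norm x \<le> \<rho>"
proof -
  obtain \<rho> where "\<forall>\<^sub>F k::nat in sequentially. \<forall>x g. has_egrad u x g \<longrightarrow> norm g \<le> R \<longrightarrow> norm x \<le> \<rho>"
    using epi_conv_gradient_support[OF u u epi_conv_const[OF u] R] by blast
  then show ?thesis
    by (intro that[of \<rho>]) auto
qed


lemma eventually_all_sequences: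
  fixes P :: "nat \<Rightarrow> bool"
  assumes "\<And>s::nat \<Rightarrow> nat. strict_mono s \<Longrightarrow> (\<And>j. \<not> P (s j)) \<Longrightarrow> False"
  shows "\<forall>\<^sub>F k in sequentially. P k"
  using not_eventually_sequentiallyD assms by blast

lemma LIMSEQ_unique_cluster_point:
  fixes X :: "nat \<Rightarrow> 'a::metric_space"
  assumes K: "compact K" "\<And>k. X k \<in> K"
    and cl: "\<And>s y. strict_mono (s :: nat \<Rightarrow> nat) \<Longrightarrow> (\<lambda>j. X (s j)) \<longlonglongrightarrow> y \<Longrightarrow> y = x"
  shows "X \<longlonglongrightarrow> x"
proof (rule tendstoI)
  fix e :: real assume e: "e > 0"
  show "\<forall>\<^sub>F k in sequentially. dist (X k) x < e"
  proof (rule eventually_all_sequences)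
    fix s :: "nat \<Rightarrow> nat" assume s: "strict_mono s" and far: "\<And>j. \<not> dist (X (s j)) x < e"
    obtain y q where q: "strict_mono (q :: nat \<Rightarrow> nat)" "((\<lambda>j. X (s j)) \<circ> q) \<longlonglongrightarrow> y"
      using K unfolding compact_def by metis
    have "y = x"
      using cl[of "s \<circ> q" y] strict_mono_o[OF s q(1)] q(2) by (simp add: o_def)
    with q(2) have "\<forall>\<^sub>F j in sequentially. dist (X (s (q j))) x < e"
      using tendstoD[OF q(2) e] by (simp add: o_def)
    with far show False by simp
  qed
qed

text \<open>A gradient g of a function of the sequence at x is encoded by the unit vector
  (1, g) / norm (1, g), and a hyperplane separating x from the domain by a unit vector (0, w).
  Both satisfy the same inequality, so compactness of the unit sphere treats vertical and
  non-vertical supporting hyperplanes at the same time.\<close>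

lemma epi_conv_gradients:
  fixes U :: "nat \<Rightarrow> ('n::finite) efun"
  assumes U: "\<And>k. U k \<in> Conv_sc" and u: "u \<in> Conv_sc" and epi: "epi_conv U u"
    and g: "has_egrad u x g" and G: "\<And>k. x \<in> edom (U k) \<Longrightarrow> has_egrad (U k) x (G k)"
  shows "(\<forall>\<^sub>F k in sequentially. x \<in> edom (U k)) \<and> G \<longlonglongrightarrow> g"
proof -
  have "\<exists>w::real^'n. norm w = 1 \<and> (\<forall>y\<in>edom (U k). w \<bullet> (y - x) \<le> 0)" if "x \<notin> edom (U k)" for k
  proof -
    have "convex ((\<lambda>y. y - x) ` edom (U k))"
      using convex_translation_subtract[OF convex_edom[OF U]] by simp
    moreover have "0 \<notin> (\<lambda>y. y - x) ` edom (U k)" using that by auto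
    ultimately have "\<exists>a. a \<noteq> 0 \<and> (\<forall>y\<in>(\<lambda>y. y - x) ` edom (U k). 0 \<le> a \<bullet> y)"
      by (rule separating_hyperplane_set_0)
    then obtain a where a: "a \<noteq> 0" "\<And>y. y \<in> edom (U k) \<Longrightarrow> 0 \<le> a \<bullet> (y - x)"
      by auto
    then show ?thesis
      by (intro exI[of _ "- (a /\<^sub>R norm a)"]) (auto simp: zero_le_mult_iff)
  qed
  then obtain W where W: "\<And>k. x \<notin> edom (U k) \<Longrightarrow> norm (W k :: real^'n) = 1"
    "\<And>k y. x \<notin> edom (U k) \<Longrightarrow> y \<in> edom (U k) \<Longrightarrow> W k \<bullet> (y - x) \<le> 0"
    by metis
  define P where "P k = (if x \<in> edom (U k) then (1::real, G k) /\<^sub>R norm (1::real, G k) else (0, W k))" for k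
  have Pn: "norm (P k) = 1" for k
  proof -
    have "(1::real, G k) \<noteq> 0" by (simp add: zero_prod_def)
    then have "norm ((1::real, G k) /\<^sub>R norm (1::real, G k)) = 1"
      by (metis sgn_div_norm norm_sgn)
    then show ?thesis using W(1)[of k] by (auto simp: P_def norm_Pair)
  qed
  have P0: "fst (P k) \<ge> 0" for k by (simp add: P_def)
  \<comment> \<open>A real \<open>c\<close> below \<open>U k x\<close> replaces that value, which
    may be infinite; at the fixed point \<open>x\<close> only lower bounds are known to pass to the
    limit.\<close>
  have ineq: "snd (P k) \<bullet> (y - x) \<le> fst (P k) * (real_of_ereal (U k y) - c)"
    if "y \<in> edom (U k)" "ereal c < U k x" for k y c
  proof (cases "x \<in> edom (U k)")
    case True
    let ?n = "norm (1::real, G k)"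
    have "ereal (real_of_ereal (U k x) + G k \<bullet> (y - x)) \<le> U k y"
      by (rule has_egrad_tangent[OF U G[OF True]])
    then have "ereal (real_of_ereal (U k x) + G k \<bullet> (y - x)) \<le> ereal (real_of_ereal (U k y))"
      using Conv_sc_real[OF U that(1)] by simp
    moreover have "ereal c < ereal (real_of_ereal (U k x))"
      using Conv_sc_real[OF U True] that(2) by simp
    ultimately have "G k \<bullet> (y - x) \<le> real_of_ereal (U k y) - c" by simp
    then have "inverse ?n * (G k \<bullet> (y - x)) \<le> inverse ?n * (real_of_ereal (U k y) - c)"
      by (intro mult_left_mono) auto
    then show ?thesis using True by (simp add: P_def)
  next
    case False
    then show ?thesis using W(2)[OF False that(1)] by (simp add: P_def)
  qed
  define L where "L = (1::real, g) /\<^sub>R norm (1::real, g)"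
  have xd: "x \<in> edom u" using has_egrad_in_edom[OF g] .
  have lim: "P \<longlonglongrightarrow> L"
  proof (rule LIMSEQ_unique_cluster_point[of "sphere 0 1"])
    show "compact (sphere (0::real \<times> (real^'n)) 1)" by simp
    show "\<And>k. P k \<in> sphere 0 1" using Pn by simp
    fix s :: "nat \<Rightarrow> nat" and p assume s: "strict_mono s" and p: "(\<lambda>j. P (s j)) \<longlonglongrightarrow> p"
    note epis = epi_conv_subseq[OF epi s]
    define a w where "a = fst p" and "w = snd p"
    have p1: "norm p = 1"
      using tendsto_norm[OF p] Pn by (simp add: LIMSEQ_const_iff)
    have a0: "a \<ge> 0"
      using tendsto_lowerbound[OF tendsto_fst[OF p]] P0 by (auto simp: a_def)
    have main: "w \<bullet> (y - x) \<le> a * (real_of_ereal (u y) - c)" if y: "y \<in> edom u" and c: "ereal c < u x" for y c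
    proof -
      obtain Y where Y: "Y \<longlonglongrightarrow> y" "(\<lambda>j. U (s j) (Y j)) \<longlonglongrightarrow> u y"
        using epi_conv_recovery[OF epis] by blast
      have "\<forall>\<^sub>F j in sequentially. U (s j) (Y j) < \<infinity>"
        using y by (intro order_tendstoD(2)[OF Y(2)]) (simp add: edom_iff)
      moreover have "\<forall>\<^sub>F j in sequentially. ereal c < U (s j) x"
        by (rule epi_conv_eventually_gt[OF epis tendsto_const c])
      ultimately have ev: "\<forall>\<^sub>F j in sequentially.
          snd (P (s j)) \<bullet> (Y j - x) \<le> fst (P (s j)) * (real_of_ereal (U (s j) (Y j)) - c)"
        by eventually_elim (auto intro!: ineq simp: edom_iff)
      have "(\<lambda>j. real_of_ereal (U (s j) (Y j))) \<longlonglongrightarrow> real_of_ereal (u y)"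
        using Y(2) Conv_sc_real[OF u y] lim_real_of_ereal by metis
      then show ?thesis
        unfolding a_def w_def
        by (intro tendsto_le[OF _ _ _ ev])
          (auto intro!: tendsto_intros tendsto_fst[OF p] tendsto_snd[OF p] Y(1))
    qed
    have main': "w \<bullet> (y - x) \<le> a * (real_of_ereal (u y) - real_of_ereal (u x))" if y: "y \<in> edom u" for y
    proof (rule field_le_epsilon)
      fix e :: real assume e: "e > 0"
      \<comment> \<open>The denominator \<open>a + 1\<close> allows for \<open>a = 0\<close>, which
        is excluded only afterwards.\<close>
      define c where "c = real_of_ereal (u x) - e / (a + 1)"
      have "c < real_of_ereal (u x)" using e a0 by (simp add: c_def)
      then have "ereal c < u x" using Conv_sc_real[OF u xd] by (metis less_ereal.simps(1))
      from main[OF y this] have "w \<bullet> (y - x) \<le> a * (real_of_ereal (u y) - real_of_ereal (u x)) + a * (e / (a + 1))"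
        by (simp add: c_def algebra_simps)
      also have "a * (e / (a + 1)) \<le> e" using a0 e by (simp add: field_simps)
      finally show "w \<bullet> (y - x) \<le> a * (real_of_ereal (u y) - real_of_ereal (u x)) + e" by simp
    qed
    \<comment> \<open>A vertical limit hyperplane would support the domain at \<open>x\<close>,
      which is an interior point.\<close>
    have "a \<noteq> 0"
    proof
      assume "a = 0"
      then have wn: "norm w = 1" using p1 by (cases p) (simp add: a_def w_def norm_Pair)
      obtain d where d: "d > 0" "ball x d \<subseteq> edom u"
        using g by (auto simp: has_egrad_def mem_interior)
      have "x + (d / 2) *\<^sub>R w \<in> edom u"
        using d wn by (intro subsetD[OF d(2)]) (simp add: dist_norm)
      from main'[OF this] show False
        using d wn \<open>a = 0\<close> by (simp add: dot_square_norm)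
    qed
    with a0 have a: "a > 0" by simp
    have "w /\<^sub>R a = g"
    proof (rule has_egrad_unique_subgradient[OF u g])
      fix y
      show "ereal (real_of_ereal (u x) + (w /\<^sub>R a) \<bullet> (y - x)) \<le> u y"
      proof (cases "y \<in> edom u")
        case True
        from main'[OF True] a
        have "real_of_ereal (u x) + (w /\<^sub>R a) \<bullet> (y - x) \<le> real_of_ereal (u y)"
          by (simp add: field_simps)
        then show ?thesis using Conv_sc_real[OF u True] by (metis ereal_less_eq(3))
      qed (simp add: edom_iff)
    qed
    then have "w = a *\<^sub>R g" using a by auto
    then have "p = a *\<^sub>R (1, g)" by (simp add: a_def w_def prod_eq_iff)
    moreover from this p1 a have "a * norm (1::real, g) = 1"
      by (metis abs_of_pos norm_scaleR)
    then have "a = inverse (norm (1::real, g))" by (metis inverse_unique mult.commute)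
    ultimately show "p = L" by (simp add: L_def)
  qed
  have L: "fst L > 0" "snd L /\<^sub>R fst L = g"
  proof -
    have "(1::real, g) \<noteq> 0" by (simp add: zero_prod_def)
    then have "norm (1::real, g) > 0" by simp
    then show "fst L > 0" "snd L /\<^sub>R fst L = g" by (simp_all add: L_def)
  qed
  have "\<forall>\<^sub>F k in sequentially. fst (P k) > 0"
    by (rule order_tendstoD(1)[OF tendsto_fst[OF lim] L(1)])
  then have ev: "\<forall>\<^sub>F k in sequentially. x \<in> edom (U k)"
    by (rule eventually_mono) (auto simp: P_def split: if_splits)
  have "(\<lambda>k. snd (P k) /\<^sub>R fst (P k)) \<longlonglongrightarrow> snd L /\<^sub>R fst L"
    using L(1) by (intro tendsto_intros tendsto_fst[OF lim] tendsto_snd[OF lim]) auto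
  moreover have "\<forall>\<^sub>F k in sequentially. snd (P k) /\<^sub>R fst (P k) = G k"
    using ev
  proof (rule eventually_mono)
    fix k assume "x \<in> edom (U k)"
    moreover have "(1::real, G k) \<noteq> 0" by (simp add: zero_prod_def)
    ultimately show "snd (P k) /\<^sub>R fst (P k) = G k" by (simp add: P_def)
  qed
  ultimately have "G \<longlonglongrightarrow> g"
    unfolding L(2) using tendsto_cong by force
  with ev show ?thesis by blast
qed

text \<open>Inside the domain of \<open>u\<close> the gradients converge. Outside,
  \<open>U k x\<close> tends to infinity while the values at \<open>Y k\<close> stay bounded, so a
  tangent at \<open>x\<close> with slope at most \<open>R\<close> would pass above the graph at
  \<open>Y k\<close>; the gradient has left the support of \<open>\<zeta>\<close>.\<close>

lemma epi_conv_gdens: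
  fixes U :: "nat \<Rightarrow> ('n::finite) efun"
  assumes U: "\<And>k. U k \<in> Conv_sc" and u: "u \<in> Conv_sc" and epi: "epi_conv U u"
    and \<zeta>: "\<zeta> \<in> Cc_Rn"
    and x: "x \<in> edom u \<Longrightarrow> has_egrad u x (bgrad u x)"
    and xk: "\<And>k. x \<in> edom (U k) \<Longrightarrow> has_egrad (U k) x (bgrad (U k) x)"
  shows "(\<lambda>k. gdens \<zeta> (U k) x) \<longlonglongrightarrow> gdens \<zeta> u x"
proof -
  obtain R where \<zeta>': "continuous_on UNIV \<zeta>" "\<And>y. \<zeta> y \<noteq> 0 \<Longrightarrow> norm y \<le> R" "R > 0"
    using Cc_RnE[OF \<zeta>] by metis
  show ?thesis
  proof (cases "x \<in> edom u")
    case True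
    have *: "\<forall>\<^sub>F k in sequentially. x \<in> edom (U k)" "(\<lambda>k. bgrad (U k) x) \<longlonglongrightarrow> bgrad u x"
      using epi_conv_gradients[OF U u epi x[OF True] xk] by auto
    have "(\<lambda>k. \<zeta> (bgrad (U k) x)) \<longlonglongrightarrow> \<zeta> (bgrad u x)"
      using \<zeta>'(1) *(2) by (auto intro: continuous_on_tendsto_compose)
    moreover have "\<forall>\<^sub>F k in sequentially. \<zeta> (bgrad (U k) x) = gdens \<zeta> (U k) x"
      using *(1) by (rule eventually_mono) (simp add: gdens_def)
    ultimately show ?thesis
      using True by (simp add: gdens_def[of _ u] tendsto_cong)
  next
    case False
    then have inf: "u x = \<infinity>" by (auto simp: edom_iff)
    obtain y0 where y0: "y0 \<in> edom u" using Conv_sc_proper[OF u] by (auto simp: edom_iff)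
    define v0 where "v0 = real_of_ereal (u y0)"
    have v0: "u y0 = ereal v0" using Conv_sc_real[OF u y0] by (simp add: v0_def)
    obtain Y where Y: "Y \<longlonglongrightarrow> y0" "(\<lambda>k. U k (Y k)) \<longlonglongrightarrow> u y0"
      using epi_conv_recovery[OF epi] by blast
    define c where "c = v0 + 1 + R * (norm (x - y0) + 1)"
    have "\<forall>\<^sub>F k in sequentially. U k (Y k) < ereal (v0 + 1)"
      by (rule order_tendstoD(2)[OF Y(2)]) (simp add: v0)
    moreover have "\<forall>\<^sub>F k in sequentially. dist (Y k) y0 < 1"
      using Y(1) by (rule tendstoD) simp
    moreover have "\<forall>\<^sub>F k in sequentially. ereal c < U k x"
      by (rule epi_conv_eventually_gt[OF epi tendsto_const]) (simp add: inf)
    ultimately have "\<forall>\<^sub>F k in sequentially. gdens \<zeta> (U k) x = 0"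
    proof eventually_elim
      case (elim k)
      show ?case
      proof (rule ccontr)
        assume "gdens \<zeta> (U k) x \<noteq> 0"
        then have xk': "x \<in> edom (U k)" and n: "norm (bgrad (U k) x) \<le> R"
          using \<zeta>'(2,3) by (auto simp: gdens_def indicator_def split: if_splits)
        have Yk: "Y k \<in> edom (U k)" using elim(1) by (auto simp: edom_iff)
        have "ereal (real_of_ereal (U k x) + bgrad (U k) x \<bullet> (Y k - x)) < ereal (v0 + 1)"
          using has_egrad_tangent[OF U xk[OF xk']] elim(1) by (rule le_less_trans)
        moreover have "c < real_of_ereal (U k x)"
          using elim(3) Conv_sc_real[OF U xk'] by (metis less_ereal.simps(1))
        moreover have "\<bar>bgrad (U k) x \<bullet> (Y k - x)\<bar> \<le> R * (norm (x - y0) + 1)"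
        proof -
          have "\<bar>bgrad (U k) x \<bullet> (Y k - x)\<bar> \<le> norm (bgrad (U k) x) * norm (Y k - x)"
            by (rule Cauchy_Schwarz_ineq2)
          also have "\<dots> \<le> R * (norm (x - y0) + 1)"
            using n elim(2) \<zeta>'(3) norm_triangle_ineq4[of "Y k - y0" "x - y0"] by (intro mult_mono) (auto simp: dist_norm)
          finally show ?thesis .
        qed
        ultimately show False by (simp add: c_def)
      qed
    qed
    then show ?thesis
      using False by (simp add: gdens_def[of _ u] tendsto_eventually)
  qed
qed


section \<open>Integrability, continuity and symmetries of moments\<close>

lemma gdens_bound:
  assumes "\<And>y. \<bar>\<zeta> y\<bar> \<le> B" "B > 0"
  shows "\<bar>gdens \<zeta> u x\<bar> \<le> B"
  using assms by (simp add: gdens_def indicator_def less_imp_le)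

lemma gdens_integrable:
  fixes u :: "('n::finite) efun"
  assumes u: "u \<in> Conv_sc" and \<zeta>: "\<zeta> \<in> Cc_Rn"
  shows "integrable lborel (gdens \<zeta> u)" "integrable lborel (\<lambda>x. gdens \<zeta> u x *\<^sub>R x)"
proof -
  obtain R B where \<zeta>': "\<zeta> \<in> borel_measurable borel" "R > 0" "\<And>y. \<zeta> y \<noteq> 0 \<Longrightarrow> norm y \<le> R"
    "B > 0" "\<And>y. \<bar>\<zeta> y\<bar> \<le> B"
    using Cc_RnE[OF \<zeta>] by metis
  obtain \<rho> where \<rho>: "\<And>x g. has_egrad u x g \<Longrightarrow> norm g \<le> R \<Longrightarrow> norm x \<le> \<rho>"
    using gradient_support_bounded[OF u] \<zeta>'(2) by (metis less_imp_le)
  note [measurable] = borel_measurable_gdens[OF u \<zeta>'(1)]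
  have supp: "AE x in lborel. x \<notin> cball 0 \<rho> \<longrightarrow> gdens \<zeta> u x = 0"
    using AE_has_bgrad[OF u]
  proof eventually_elim
    case (elim x)
    then show ?case
      using \<rho>[of x "bgrad u x"] \<zeta>'(3)[of "bgrad u x"] by (auto simp: gdens_def indicator_def)
  qed
  have fin: "emeasure lborel (cball (0::real^'n) \<rho>) < \<infinity>"
    by (rule emeasure_bounded_finite) simp
  have bound: "\<bar>gdens \<zeta> u x\<bar> \<le> B" for x
    by (rule gdens_bound) (use \<zeta>' in auto)
  show "integrable lborel (gdens \<zeta> u)"
    by (rule integrableI_bounded_set[of "cball 0 \<rho>" _ _ B])
      (use supp fin bound in auto)
  show "integrable lborel (\<lambda>x. gdens \<zeta> u x *\<^sub>R x)"
  proof (rule integrableI_bounded_set[of "cball 0 \<rho>" _ _ "B * \<rho>"])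
    have "norm (gdens \<zeta> u x *\<^sub>R x) \<le> B * \<rho>" if "x \<in> cball 0 \<rho>" for x
      using that bound[of x] \<zeta>'(4) by (auto intro!: mult_mono)
    then show "AE x in lborel. x \<in> cball 0 \<rho> \<longrightarrow> norm (gdens \<zeta> u x *\<^sub>R x) \<le> B * \<rho>" by simp
  qed (use supp fin in auto)
qed

lemma zeta_moment_continuous:
  fixes \<zeta> :: "real^'n \<Rightarrow> real"
  assumes \<zeta>: "\<zeta> \<in> Cc_Rn"
  shows "z_continuous (zeta_moment \<zeta>)"
  unfolding z_continuous_def
proof (intro allI impI)
  fix U :: "nat \<Rightarrow> 'n efun" and u
  assume asm: "(\<forall>k. U k \<in> Conv_sc) \<and> u \<in> Conv_sc \<and> epi_conv U u"
  then have U: "\<And>k. U k \<in> Conv_sc" and u: "u \<in> Conv_sc" and epi: "epi_conv U u" by auto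
  obtain R B where \<zeta>': "\<zeta> \<in> borel_measurable borel" "R > 0" "\<And>y. \<zeta> y \<noteq> 0 \<Longrightarrow> norm y \<le> R"
    "B > 0" "\<And>y. \<bar>\<zeta> y\<bar> \<le> B"
    using Cc_RnE[OF \<zeta>] by metis
  have "R \<ge> 0" using \<zeta>'(2) by simp
  then obtain \<rho> where "\<forall>\<^sub>F k in sequentially. \<forall>x g. has_egrad (U k) x g \<longrightarrow> norm g \<le> R \<longrightarrow> norm x \<le> \<rho>"
    by (rule epi_conv_gradient_support[OF U u epi])
  then obtain K where K: "\<And>k x g. k \<ge> K \<Longrightarrow> has_egrad (U k) x g \<Longrightarrow> norm g \<le> R \<Longrightarrow> norm x \<le> \<rho>"
    unfolding eventually_sequentially by blast
  note [measurable] = borel_measurable_gdens[OF U \<zeta>'(1)] borel_measurable_gdens[OF u \<zeta>'(1)]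
  have ae: "AE x in lborel. \<forall>k. x \<in> edom (U k) \<longrightarrow> has_egrad (U k) x (bgrad (U k) x)"
    using AE_has_bgrad[OF U] by (subst AE_all_countable) auto
  \<comment> \<open>The common ball that dominates the integrands is available only from the index
    \<open>K\<close> on.\<close>
  have "(\<lambda>k. \<integral>x. gdens \<zeta> (U (k + K)) x *\<^sub>R x \<partial>lborel) \<longlonglongrightarrow> (\<integral>x. gdens \<zeta> u x *\<^sub>R x \<partial>lborel)"
  proof (rule integral_dominated_convergence)
    show "AE x in lborel. (\<lambda>k. gdens \<zeta> (U (k + K)) x *\<^sub>R x) \<longlonglongrightarrow> gdens \<zeta> u x *\<^sub>R x"
      using ae AE_has_bgrad[OF u]
    proof eventually_elim
      case (elim x)
      then have "(\<lambda>k. gdens \<zeta> (U k) x) \<longlonglongrightarrow> gdens \<zeta> u x"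
        by (intro epi_conv_gdens[OF U u epi \<zeta>]) auto
      then have "(\<lambda>k. gdens \<zeta> (U (k + K)) x) \<longlonglongrightarrow> gdens \<zeta> u x"
        by (rule LIMSEQ_ignore_initial_segment)
      then show ?case by (intro tendsto_intros)
    qed
    show "AE x in lborel. norm (gdens \<zeta> (U (k + K)) x *\<^sub>R x) \<le> indicator (cball 0 \<rho>) x * (B * \<rho>)" for k
      using ae
    proof eventually_elim
      case (elim x)
      show ?case
      proof (cases "gdens \<zeta> (U (k + K)) x = 0")
        case True
        then show ?thesis
          using \<zeta>'(4) norm_ge_zero[of x] by (auto simp: indicator_def simp del: norm_ge_zero intro!: mult_nonneg_nonneg)
      next
        case False
        then have "x \<in> edom (U (k + K))" "norm (bgrad (U (k + K)) x) \<le> R"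
          using \<zeta>'(3) by (auto simp: gdens_def indicator_def split: if_splits)
        then have "norm x \<le> \<rho>" using K[of "k + K" x] elim by auto
        then show ?thesis
          using gdens_bound[of \<zeta> B "U (k + K)" x] \<zeta>'(4,5) by (auto intro!: mult_mono)
      qed
    qed
    show "integrable lborel (\<lambda>x::real^'n. indicator (cball 0 \<rho>) x * (B * \<rho>))"
      using emeasure_bounded_finite[of "cball (0::real^'n) \<rho>"]
      by (intro integrable_mult_left integrable_real_indicator) auto
  qed measurable
  then have "(\<lambda>k. zeta_moment \<zeta> (U (k + K))) \<longlonglongrightarrow> zeta_moment \<zeta> u"
    by (simp add: zeta_moment_eq U u \<zeta>'(1))
  then show "(\<lambda>k. zeta_moment \<zeta> (U k)) \<longlonglongrightarrow> zeta_moment \<zeta> u"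
    by (rule LIMSEQ_offset)
qed

lemma gdens_touching:
  assumes "u \<in> Conv_sc" "w \<in> Conv_sc" "\<And>y. w y \<le> u y" "w x = u x"
    and "x \<in> edom u \<Longrightarrow> has_egrad u x (bgrad u x)" "x \<in> edom w \<Longrightarrow> has_egrad w x (bgrad w x)"
  shows "gdens \<zeta> w x = gdens \<zeta> u x"
proof (cases "x \<in> edom u")
  case True
  then have "x \<in> edom w" using assms(4) by (simp add: edom_iff)
  then show ?thesis
    using True has_egrad_le_touching[OF assms(1-4) assms(5)[OF True] assms(6)] by (simp add: gdens_def)
next
  case False
  then show ?thesis using assms(4) by (simp add: gdens_def edom_iff)
qed

text \<open>Where \<open>u x \<le> w x\<close>, the minimum touches \<open>u\<close> from below and
  the maximum touches \<open>w\<close> from above, so the gradients match almost everywhere; the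
  other case is symmetric.\<close>

lemma zeta_moment_valuation:
  fixes \<zeta> :: "real^'n \<Rightarrow> real"
  assumes \<zeta>: "\<zeta> \<in> Cc_Rn"
  shows "z_valuation (zeta_moment \<zeta>)"
  unfolding z_valuation_def
proof (intro ballI impI)
  fix u w :: "'n efun"
  let ?M = "\<lambda>x. max (u x) (w x)" and ?m = "\<lambda>x. min (u x) (w x)"
  assume u: "u \<in> Conv_sc" and w: "w \<in> Conv_sc" and Mm: "?M \<in> Conv_sc \<and> ?m \<in> Conv_sc"
  then have M: "?M \<in> Conv_sc" and m: "?m \<in> Conv_sc" by auto
  have \<zeta>m: "\<zeta> \<in> borel_measurable borel" using Cc_RnE[OF \<zeta>] by metis
  note [measurable] = borel_measurable_gdens[OF _ \<zeta>m] u w M m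
  have "AE x in lborel. gdens \<zeta> ?M x *\<^sub>R x + gdens \<zeta> ?m x *\<^sub>R x = gdens \<zeta> u x *\<^sub>R x + gdens \<zeta> w x *\<^sub>R x"
    using AE_has_bgrad[OF u] AE_has_bgrad[OF w] AE_has_bgrad[OF M] AE_has_bgrad[OF m]
  proof eventually_elim
    case (elim x)
    show ?case
    proof (cases "u x \<le> w x")
      case True
      then have "gdens \<zeta> ?m x = gdens \<zeta> u x" "gdens \<zeta> w x = gdens \<zeta> ?M x"
        using elim gdens_touching[OF u m, of x \<zeta>] gdens_touching[OF M w, of x \<zeta>]
        by (simp_all add: min_absorb1 max_absorb2)
      then show ?thesis by simp
    next
      case False
      then have "gdens \<zeta> ?m x = gdens \<zeta> w x" "gdens \<zeta> u x = gdens \<zeta> ?M x"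
        using elim gdens_touching[OF w m, of x \<zeta>] gdens_touching[OF M u, of x \<zeta>]
        by (simp_all add: min_absorb2 max_absorb1)
      then show ?thesis by simp
    qed
  qed
  then have "(\<integral>x. gdens \<zeta> ?M x *\<^sub>R x + gdens \<zeta> ?m x *\<^sub>R x \<partial>lborel) = (\<integral>x. gdens \<zeta> u x *\<^sub>R x + gdens \<zeta> w x *\<^sub>R x \<partial>lborel)"
    using gdens_integrable(2)[OF _ \<zeta>] u w M m
    by (intro integral_cong_AE) (auto intro!: borel_measurable_integrable Bochner_Integration.integrable_add)
  then show "zeta_moment \<zeta> ?M + zeta_moment \<zeta> ?m = zeta_moment \<zeta> u + zeta_moment \<zeta> w"
    using gdens_integrable(2)[OF _ \<zeta>] u w M m by (simp add: zeta_moment_eq \<zeta>m)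
qed

text \<open>The factor \<open>t\<close> on the values cancels the one on the arguments, so slopes
  are merely transformed by \<open>f\<close>.\<close>

lemma has_egrad_similarity:
  fixes u w :: "('n::finite) efun"
  assumes u: "u \<in> Conv_sc" and f: "orthogonal_transformation f" and t: "t > 0"
    and eq: "\<And>x. w (b + t *\<^sub>R f x) = ereal t * u x + ereal c"
    and g: "has_egrad u x g"
  shows "has_egrad w (b + t *\<^sub>R f x) (f g)"
proof -
  define T where "T x = b + t *\<^sub>R f x" for x
  define S where "S y = inv f ((y - b) /\<^sub>R t)" for y
  have bij: "bij f" by (rule orthogonal_transformation_bij[OF f])
  have finv: "f (inv f v) = v" for v
    using bij by (simp add: bij_is_surj surj_f_inv_f)
  have TS: "T (S y) = y" and ST: "S (T x) = x" for x y
    using t bij by (simp_all add: T_def S_def finv bij_is_inj inv_f_f)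
  have lin: "linear f" "linear (inv f)"
    using orthogonal_transformation_linear[OF f]
      orthogonal_transformation_linear[OF orthogonal_transformation_inv[OF f]] by auto
  have dist: "norm (S y - x) = norm (y - T x) / t" for x y
  proof -
    have "y - T x = t *\<^sub>R f (S y - x)"
      using TS[of y] linear_diff[OF lin(1), of "S y" x] unfolding T_def by (metis add_diff_cancel_left scaleR_diff_right)
    then show ?thesis
      using t orthogonal_transformation_norm[OF f] by simp
  qed
  have edom: "y \<in> edom w" if "S y \<in> edom u" for y
    using eq[of "S y"] TS[of y] that t by (cases "u (S y)") (auto simp: edom_iff T_def)
  have val: "real_of_ereal (w y) = t * real_of_ereal (u (S y)) + c" if "S y \<in> edom u" for y
    using eq[of "S y"] TS[of y] that t Conv_sc_not_MInf[OF u, of "S y"]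
    by (cases "u (S y)") (auto simp: edom_iff T_def)
  obtain e where e: "e > 0" "ball x e \<subseteq> edom u"
    using g by (auto simp: has_egrad_def mem_interior)
  have near: "S y \<in> edom u" if "y \<in> ball (T x) (t * e)" for y
  proof -
    have "norm (S y - x) < e"
      unfolding dist using that t by (simp add: dist_norm norm_minus_commute pos_divide_less_eq mult.commute)
    then show ?thesis
      by (intro subsetD[OF e(2)]) (simp add: dist_norm norm_minus_commute)
  qed
  have int: "T x \<in> interior (edom w)"
    unfolding mem_interior using near edom e t by (intro exI[of _ "t * e"]) auto
  have Sd: "(S has_derivative (\<lambda>h. inv f (h /\<^sub>R t))) (at (T x))"
    unfolding S_def
    by (rule bounded_linear.has_derivative[OF lin(2)[unfolded linear_conv_bounded_linear]])
      (auto intro!: derivative_eq_intros)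
  have "((\<lambda>y. real_of_ereal (u y)) has_derivative (\<lambda>h. g \<bullet> h)) (at (S (T x)))"
    using g by (simp add: has_egrad_def ST)
  from has_derivative_compose[OF Sd this]
  have "((\<lambda>y. t * real_of_ereal (u (S y)) + c) has_derivative (\<lambda>h. t * (g \<bullet> inv f (h /\<^sub>R t)))) (at (T x))"
    by (auto intro!: derivative_eq_intros)
  also have "(\<lambda>h. t * (g \<bullet> inv f (h /\<^sub>R t))) = (\<lambda>h. f g \<bullet> h)"
  proof
    fix h
    have "t * (g \<bullet> inv f (h /\<^sub>R t)) = g \<bullet> inv f h"
      using t by (simp add: linear_scale[OF lin(2)])
    also have "\<dots> = f g \<bullet> f (inv f h)"
      using f by (simp add: orthogonal_transformation_def)
    finally show "t * (g \<bullet> inv f (h /\<^sub>R t)) = f g \<bullet> h" by (simp add: finv)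
  qed
  finally have "((\<lambda>y. real_of_ereal (w y)) has_derivative (\<lambda>h. f g \<bullet> h)) (at (T x))"
    by (rule has_derivative_transform_within_open[OF _ open_ball[of "T x" "t * e"]]) (use e t near val in auto)
  then show ?thesis
    using int by (simp add: has_egrad_def T_def)
qed

text \<open>One change of variables whose instances are translations, vertical shifts,
  epi-multiplication and orthogonal maps. The Jacobian gives \<open>t\<close> to the power
  \<open>n\<close>, the moment vector the additional \<open>t\<close>.\<close>

lemma zeta_moment_similarity:
  fixes u w :: "('n::finite) efun" and \<zeta> :: "real^'n \<Rightarrow> real"
  assumes u: "u \<in> Conv_sc" and w: "w \<in> Conv_sc" and \<zeta>: "\<zeta> \<in> Cc_Rn"
    and f: "orthogonal_transformation f" and t: "t > 0"
    and eq: "\<And>x. w (b + t *\<^sub>R f x) = ereal t * u x + ereal c"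
  shows "zeta_moment \<zeta> w = t ^ CARD('n) *\<^sub>R
    (zeta_vol (\<lambda>y. \<zeta> (f y)) u *\<^sub>R b + t *\<^sub>R f (zeta_moment (\<lambda>y. \<zeta> (f y)) u))"
proof -
  let ?T = "\<lambda>x. b + t *\<^sub>R f x" and ?\<zeta> = "\<lambda>y. \<zeta> (f y)"
  have lin: "linear f" using f by (rule orthogonal_transformation_linear)
  then have bl: "bounded_linear f" by (simp add: linear_conv_bounded_linear)
  have cf: "continuous_on UNIV f" using bl by (rule linear_continuous_on)
  obtain R where \<zeta>': "continuous_on UNIV \<zeta>" "\<zeta> \<in> borel_measurable borel" "\<And>y. \<zeta> y \<noteq> 0 \<Longrightarrow> norm y \<le> R"
    using Cc_RnE[OF \<zeta>] by metis
  have \<zeta>f: "?\<zeta> \<in> Cc_Rn"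
  proof (rule Cc_RnI)
    show "continuous_on UNIV ?\<zeta>"
      using \<zeta>'(1) cf by (rule continuous_on_compose2) auto
    show "norm y \<le> R" if "\<zeta> (f y) \<noteq> 0" for y
      using \<zeta>'(3)[OF that] orthogonal_transformation_norm[OF f] by simp
  qed
  then have \<zeta>fm: "?\<zeta> \<in> borel_measurable borel" using Cc_RnE by metis
  note [measurable] = borel_measurable_gdens[OF w \<zeta>'(2)] borel_measurable_gdens[OF u \<zeta>fm]
  have [measurable]: "f \<in> borel \<rightarrow>\<^sub>M borel" using cf by (rule borel_measurable_continuous_onI)
  let ?F = "\<lambda>x. gdens \<zeta> w x *\<^sub>R x"
  have ae: "AE x in lborel. gdens \<zeta> w (?T x) = gdens ?\<zeta> u x"
    using AE_has_bgrad[OF u]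
  proof eventually_elim
    case (elim x)
    have "?T x \<in> edom w \<longleftrightarrow> x \<in> edom u"
      using eq[of x] t Conv_sc_not_MInf[OF u, of x] by (cases "u x") (auto simp: edom_iff)
    moreover have "bgrad w (?T x) = f (bgrad u x)" if "x \<in> edom u"
      using elim that by (intro has_egrad_bgrad has_egrad_similarity[OF u f t eq]) auto
    ultimately show ?case by (auto simp: gdens_def indicator_def)
  qed
  have "zeta_moment \<zeta> w = integral\<^sup>L lborel ?F"
    by (rule zeta_moment_eq[OF w \<zeta>'(2)])
  also have "\<dots> = integral\<^sup>L (density (distr lborel borel ?T) (\<lambda>_. ennreal (t ^ CARD('n)))) ?F"
    using lborel_similarity[OF f t, of b] by simp
  also have "\<dots> = (\<integral>x. t ^ CARD('n) *\<^sub>R ?F x \<partial>distr lborel borel ?T)"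
    using t by (intro integral_density) auto
  also have "\<dots> = (\<integral>x. t ^ CARD('n) *\<^sub>R ?F (?T x) \<partial>lborel)"
    by (intro integral_distr) auto
  also have "\<dots> = (\<integral>x. t ^ CARD('n) *\<^sub>R (gdens ?\<zeta> u x *\<^sub>R b + t *\<^sub>R f (gdens ?\<zeta> u x *\<^sub>R x)) \<partial>lborel)"
  proof (rule integral_cong_AE)
    show "AE x in lborel. t ^ CARD('n) *\<^sub>R ?F (?T x) = t ^ CARD('n) *\<^sub>R (gdens ?\<zeta> u x *\<^sub>R b + t *\<^sub>R f (gdens ?\<zeta> u x *\<^sub>R x))"
      using ae
    proof eventually_elim
      case (elim x)
      show ?case
        unfolding elim by (simp add: scaleR_add_right linear_scale[OF lin] mult_ac)
    qed
  qed measurable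
  also have "\<dots> = t ^ CARD('n) *\<^sub>R (zeta_vol ?\<zeta> u *\<^sub>R b + t *\<^sub>R f (zeta_moment ?\<zeta> u))"
    using gdens_integrable[OF u \<zeta>f] integral_bounded_linear[OF bl gdens_integrable(2)[OF u \<zeta>f]]
      integrable_bounded_linear[OF bl gdens_integrable(2)[OF u \<zeta>f]]
    by (simp add: zeta_vol_def zeta_moment_eq[OF u \<zeta>fm])
  finally show ?thesis .
qed


subsection \<open>Covariant valuations\<close>

text \<open>The associated function \<open>z0\<close> is a parameter so that it can be studied in
  its own right. The factor \<open>t powr (n + 1)\<close> is written as a product of ordinary
  powers.\<close>

locale covariant_valuation =
  fixes z :: "('n::finite) efun \<Rightarrow> real^'n" and z0 :: "'n efun \<Rightarrow> real"
  assumes continuous: "\<And>U u. (\<And>k. U k \<in> Conv_sc) \<Longrightarrow> u \<in> Conv_sc \<Longrightarrow> epi_conv U u \<Longrightarrow> (\<lambda>k. z (U k)) \<longlonglongrightarrow> z u"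
    and translate: "\<And>u x. u \<in> Conv_sc \<Longrightarrow> z (\<lambda>y. u (y - x)) = z u + z0 u *\<^sub>R x"
    and add_const: "\<And>u c. u \<in> Conv_sc \<Longrightarrow> z (\<lambda>x. u x + ereal c) = z u"
    and valuation: "\<And>u w. u \<in> Conv_sc \<Longrightarrow> w \<in> Conv_sc \<Longrightarrow> (\<lambda>x. max (u x) (w x)) \<in> Conv_sc \<Longrightarrow>
      (\<lambda>x. min (u x) (w x)) \<in> Conv_sc \<Longrightarrow> z (\<lambda>x. max (u x) (w x)) + z (\<lambda>x. min (u x) (w x)) = z u + z w"
    and homogeneous: "\<And>u t. u \<in> Conv_sc \<Longrightarrow> t > 0 \<Longrightarrow> z (epi_mult t u) = (t ^ CARD('n) * t) *\<^sub>R z u"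

lemma covariant_valuation_iff:
  fixes z :: "('n::finite) efun \<Rightarrow> real^'n"
  shows "(\<exists>z0. covariant_valuation z z0) \<longleftrightarrow>
    z_continuous z \<and> z_trans_covariant z \<and> z_vert_invariant z \<and> z_valuation z
      \<and> z_epi_homogeneous (real CARD('n) + 1) z"
proof -
  have hom: "z_epi_homogeneous (real CARD('n) + 1) z \<longleftrightarrow>
    (\<forall>u\<in>Conv_sc. \<forall>t>0. z (epi_mult t u) = (t ^ CARD('n) * t) *\<^sub>R z u)"
    unfolding z_epi_homogeneous_def by (simp add: powr_add powr_realpow)
  show ?thesis
  proof
    assume "\<exists>z0. covariant_valuation z z0"
    then obtain z0 where "covariant_valuation z z0" ..
    then interpret covariant_valuation z z0 .
    have "z_continuous z" unfolding z_continuous_def using continuous by blast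
    moreover have "z_trans_covariant z" unfolding z_trans_covariant_def using translate by blast
    moreover have "z_vert_invariant z" unfolding z_vert_invariant_def using add_const by blast
    moreover have "z_valuation z" unfolding z_valuation_def using valuation by blast
    moreover have "z_epi_homogeneous (real CARD('n) + 1) z" unfolding hom using homogeneous by blast
    ultimately show "z_continuous z \<and> z_trans_covariant z \<and> z_vert_invariant z \<and> z_valuation z
      \<and> z_epi_homogeneous (real CARD('n) + 1) z" by blast
  next
    assume asm: "z_continuous z \<and> z_trans_covariant z \<and> z_vert_invariant z \<and> z_valuation z
      \<and> z_epi_homogeneous (real CARD('n) + 1) z"
    then obtain z0 where z0: "\<forall>u\<in>Conv_sc. \<forall>x. z (\<lambda>y. u (y - x)) = z u + z0 u *\<^sub>R x"
      unfolding z_trans_covariant_def by blast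
    have "covariant_valuation z z0"
      using asm z0
      by unfold_locales (unfold hom z_continuous_def z_vert_invariant_def z_valuation_def, blast+)
    then show "\<exists>z0. covariant_valuation z z0" by blast
  qed
qed

lemma covariant_valuation_zeta_moment:
  fixes \<zeta> :: "real^'n \<Rightarrow> real"
  assumes \<zeta>: "\<zeta> \<in> Cc_Rn"
  shows "covariant_valuation (zeta_moment \<zeta>) (zeta_vol \<zeta>)"
proof
  show "(\<lambda>k. zeta_moment \<zeta> (U k)) \<longlonglongrightarrow> zeta_moment \<zeta> u"
    if "\<And>k. U k \<in> Conv_sc" "u \<in> Conv_sc" "epi_conv U u" for U u
    using zeta_moment_continuous[OF \<zeta>] that unfolding z_continuous_def by blast
  show "zeta_moment \<zeta> (\<lambda>x. max (u x) (w x)) + zeta_moment \<zeta> (\<lambda>x. min (u x) (w x)) = zeta_moment \<zeta> u + zeta_moment \<zeta> w"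
    if "u \<in> Conv_sc" "w \<in> Conv_sc" "(\<lambda>x. max (u x) (w x)) \<in> Conv_sc" "(\<lambda>x. min (u x) (w x)) \<in> Conv_sc" for u w
    using zeta_moment_valuation[OF \<zeta>] that unfolding z_valuation_def by blast
  note sim = zeta_moment_similarity[OF _ _ \<zeta> orthogonal_transformation_id]
  fix u :: "'n efun" assume u: "u \<in> Conv_sc"
  show "zeta_moment \<zeta> (\<lambda>y. u (y - x)) = zeta_moment \<zeta> u + zeta_vol \<zeta> u *\<^sub>R x" for x
    using sim[OF u Conv_sc_translate[OF u], of 1 x x 0] by (simp add: one_ereal_def[symmetric] zero_ereal_def[symmetric])
  show "zeta_moment \<zeta> (\<lambda>x. u x + ereal c) = zeta_moment \<zeta> u" for c
    using sim[OF u Conv_sc_add_const[OF u], of 1 0 c c] by (simp add: one_ereal_def[symmetric])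
  show "zeta_moment \<zeta> (epi_mult t u) = (t ^ CARD('n) * t) *\<^sub>R zeta_moment \<zeta> u" if t: "t > 0" for t
    using sim[OF u Conv_sc_epi_mult[OF u t] t, of 0 0] t by (simp add: epi_mult_def zero_ereal_def[symmetric])
qed

lemma covariant_valuation_cong:
  fixes z :: "('n::finite) efun \<Rightarrow> real^'n"
  assumes "covariant_valuation z' z0" and eq: "\<And>u. u \<in> Conv_sc \<Longrightarrow> z u = z' u"
  shows "covariant_valuation z z0"
proof -
  interpret covariant_valuation z' z0 by fact
  show ?thesis
  proof
    fix u :: "'n efun" assume u: "u \<in> Conv_sc"
    show "(\<lambda>k. z (U k)) \<longlonglongrightarrow> z u" if "\<And>k. U k \<in> Conv_sc" "epi_conv U u" for U
      using continuous[OF that(1) u that(2)] by (simp add: eq u that(1))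
    show "z (\<lambda>y. u (y - x)) = z u + z0 u *\<^sub>R x" for x
      using translate[OF u] by (simp add: eq u Conv_sc_translate)
    show "z (\<lambda>x. u x + ereal c) = z u" for c
      using add_const[OF u] by (simp add: eq u Conv_sc_add_const)
    show "z (epi_mult t u) = (t ^ CARD('n) * t) *\<^sub>R z u" if "t > 0" for t
      using homogeneous[OF u that] that by (simp add: eq u Conv_sc_epi_mult)
    show "z (\<lambda>x. max (u x) (w x)) + z (\<lambda>x. min (u x) (w x)) = z u + z w"
      if "w \<in> Conv_sc" "(\<lambda>x. max (u x) (w x)) \<in> Conv_sc" "(\<lambda>x. min (u x) (w x)) \<in> Conv_sc" for w
      using valuation[OF u that] that by (simp add: eq u)
  qed
qed

lemma covariant_valuation_diff:
  fixes z z' :: "('n::finite) efun \<Rightarrow> real^'n"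
  assumes "covariant_valuation z z0" "covariant_valuation z' z0'"
  shows "covariant_valuation (\<lambda>u. z u - z' u) (\<lambda>u. z0 u - z0' u)"
proof -
  interpret A: covariant_valuation z z0 by fact
  interpret B: covariant_valuation z' z0' by fact
  show ?thesis
  proof
    fix u :: "'n efun" assume u: "u \<in> Conv_sc"
    show "(\<lambda>k. z (U k) - z' (U k)) \<longlonglongrightarrow> z u - z' u" if "\<And>k. U k \<in> Conv_sc" "epi_conv U u" for U
      using A.continuous[OF that(1) u that(2)] B.continuous[OF that(1) u that(2)] by (rule tendsto_diff)
    show "z (\<lambda>x. max (u x) (w x)) - z' (\<lambda>x. max (u x) (w x)) + (z (\<lambda>x. min (u x) (w x)) - z' (\<lambda>x. min (u x) (w x)))
        = z u - z' u + (z w - z' w)"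
      if "w \<in> Conv_sc" "(\<lambda>x. max (u x) (w x)) \<in> Conv_sc" "(\<lambda>x. min (u x) (w x)) \<in> Conv_sc" for w
      using A.valuation[OF u that] B.valuation[OF u that] by (simp add: algebra_simps)
  qed (simp_all add: A.translate B.translate A.add_const B.add_const A.homogeneous B.homogeneous algebra_simps)
qed

section \<open>Valuations on Lipschitz functions restricted to boxes\<close>

text \<open>Boxes are given by their lower corner and the vector of side lengths; cutting a box
  changes one side, and setting it to 0 gives the face of the cut.\<close>

definition upd :: "real^'n \<Rightarrow> 'n \<Rightarrow> real \<Rightarrow> real^('n::finite)" where
  "upd l i p = (\<chi> j. if j = i then p else l $ j)"

lemma upd_nth [simp]: "upd l i p $ j = (if j = i then p else l $ j)"
  by (simp add: upd_def)

lemma upd_same [simp]: "upd l i (l $ i) = l"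
  by (simp add: vec_eq_iff)

lemma cbox_split_upd:
  fixes a l :: "real^'n"
  assumes "0 \<le> p" "0 \<le> q"
  shows "cbox a (a + upd l i p) \<union> cbox (a + p *\<^sub>R axis i 1) (a + p *\<^sub>R axis i 1 + upd l i q) = cbox a (a + upd l i (p + q))"
    and "cbox a (a + upd l i p) \<inter> cbox (a + p *\<^sub>R axis i 1) (a + p *\<^sub>R axis i 1 + upd l i q)
      = cbox (a + p *\<^sub>R axis i 1) (a + p *\<^sub>R axis i 1 + upd l i 0)"
proof -
  have m: "x \<in> cbox b (b + upd l i r) \<longleftrightarrow> (b $ i \<le> x $ i \<and> x $ i \<le> b $ i + r) \<and>
      (\<forall>j. j \<noteq> i \<longrightarrow> b $ j \<le> x $ j \<and> x $ j \<le> b $ j + l $ j)" for x b r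
    by (auto simp: mem_box_cart)
  show "cbox a (a + upd l i p) \<union> cbox (a + p *\<^sub>R axis i 1) (a + p *\<^sub>R axis i 1 + upd l i q) = cbox a (a + upd l i (p + q))"
    using assms by (intro set_eqI) (auto simp: m axis_def)
  show "cbox a (a + upd l i p) \<inter> cbox (a + p *\<^sub>R axis i 1) (a + p *\<^sub>R axis i 1 + upd l i q)
      = cbox (a + p *\<^sub>R axis i 1) (a + p *\<^sub>R axis i 1 + upd l i 0)"
    using assms by (intro set_eqI) (auto simp: m axis_def)
qed

lemma cbox_length_nonempty:
  fixes a l :: "real^'n"
  shows "(\<And>i. 0 \<le> l $ i) \<Longrightarrow> cbox a (a + l) \<noteq> {}"
  by (simp add: interval_ne_empty_cart)

text \<open>The property is inherited only through a cut by a single hyperplane, so the sides are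
  halved one after the other; \<open>h T\<close> has the sides in \<open>T\<close> already
  halved.\<close>

lemma halving:
  fixes Q :: "real^'n \<Rightarrow> real^'n \<Rightarrow> bool"
  assumes step: "\<And>a l i. (\<And>j. 0 \<le> l $ j) \<Longrightarrow> Q a l \<Longrightarrow>
      Q a (upd l i (l $ i / 2)) \<or> Q (a + (l $ i / 2) *\<^sub>R axis i 1) (upd l i (l $ i / 2))"
    and l: "\<And>j. 0 \<le> l $ j" and Q: "Q a l"
  shows "\<exists>a'. Q a' ((1/2) *\<^sub>R l) \<and> cbox a' (a' + (1/2) *\<^sub>R l) \<subseteq> cbox a (a + l)"
proof -
  define h where "h T = (\<chi> j. if j \<in> T then l $ j / 2 else l $ j)" for T
  have "\<exists>a'. Q a' (h T) \<and> cbox a' (a' + h T) \<subseteq> cbox a (a + l)" for T :: "'n set"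
  proof (induction T rule: finite_induct[OF finite])
    case 1
    have "h {} = l" by (simp add: h_def vec_eq_iff)
    then show ?case using Q by auto
  next
    case (2 i T)
    then obtain a' where a': "Q a' (h T)" "cbox a' (a' + h T) \<subseteq> cbox a (a + l)" by blast
    have hi: "h T $ i = l $ i" "h (insert i T) = upd (h T) i (l $ i / 2)" "upd (h T) i (l $ i) = h T"
      using 2 by (auto simp: h_def vec_eq_iff)
    have un: "cbox a' (a' + h (insert i T)) \<union> cbox (a' + (l $ i / 2) *\<^sub>R axis i 1) (a' + (l $ i / 2) *\<^sub>R axis i 1 + h (insert i T))
        = cbox a' (a' + h T)"
      using cbox_split_upd(1)[of "l $ i / 2" "l $ i / 2" a' "h T" i] l[of i] by (simp add: hi)
    have "Q a' (h (insert i T)) \<or> Q (a' + (l $ i / 2) *\<^sub>R axis i 1) (h (insert i T))"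
      using step[OF _ a'(1), of i] l by (simp add: hi) (simp add: h_def)
    then show ?case
      using un a'(2) by blast
  qed
  moreover have "h UNIV = (1/2) *\<^sub>R l"
    by (simp add: h_def vec_eq_iff)
  ultimately show ?thesis by metis
qed

lemma halving_sequence:
  fixes Q :: "real^'n \<Rightarrow> real^'n \<Rightarrow> bool"
  assumes step: "\<And>a l i. (\<And>j. 0 \<le> l $ j) \<Longrightarrow> Q a l \<Longrightarrow>
      Q a (upd l i (l $ i / 2)) \<or> Q (a + (l $ i / 2) *\<^sub>R axis i 1) (upd l i (l $ i / 2))"
    and l: "\<And>j. 0 \<le> l $ j" and Q: "Q a l"
  obtains A where "\<And>m. Q (A m) ((1/2)^m *\<^sub>R l)"
    "\<And>m k. m \<le> k \<Longrightarrow> cbox (A k) (A k + (1/2)^k *\<^sub>R l) \<subseteq> cbox (A m) (A m + (1/2)^m *\<^sub>R l)"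
    "A 0 = a"
proof -
  let ?K = "\<lambda>m a. cbox a (a + (1/2)^m *\<^sub>R l)"
  have "\<exists>A. \<forall>m. (Q (A m) ((1/2)^m *\<^sub>R l) \<and> (m = 0 \<longrightarrow> A m = a)) \<and> ?K (Suc m) (A (Suc m)) \<subseteq> ?K m (A m)"
  proof (rule dependent_nat_choice)
    show "\<exists>x. Q x ((1/2)^0 *\<^sub>R l) \<and> (0 = 0 \<longrightarrow> x = a)" using Q by auto
    fix x m assume "Q x ((1/2)^m *\<^sub>R l) \<and> (m = 0 \<longrightarrow> x = a)"
    then have "\<exists>a'. Q a' ((1/2) *\<^sub>R (1/2)^m *\<^sub>R l) \<and> cbox a' (a' + (1/2) *\<^sub>R (1/2)^m *\<^sub>R l) \<subseteq> ?K m x"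
      using l by (intro halving[OF step]) auto
    then show "\<exists>y. (Q y ((1/2)^(Suc m) *\<^sub>R l) \<and> (Suc m = 0 \<longrightarrow> y = a)) \<and> ?K (Suc m) y \<subseteq> ?K m x"
      by simp
  qed
  then obtain A where A: "\<And>m. Q (A m) ((1/2)^m *\<^sub>R l)" "A 0 = a" "\<And>m. ?K (Suc m) (A (Suc m)) \<subseteq> ?K m (A m)"
    by metis
  have "?K k (A k) \<subseteq> ?K m (A m)" if "m \<le> k" for m k
    using that A(3) lift_Suc_antimono_le[of "\<lambda>m. ?K m (A m)"] by blast
  with A show ?thesis by (intro that[of A]) auto
qed

subsection \<open>Uniform bounds\<close>

text \<open>The constant \<open>L\<close> is kept explicit because blow-ups preserve it; bounds for
  a fixed \<open>L\<close> are then uniform over all scales.\<close>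

definition convex_lipschitz :: "real \<Rightarrow> ('a::real_normed_vector \<Rightarrow> real) \<Rightarrow> bool" where
  "convex_lipschitz L f \<longleftrightarrow> convex_on UNIV f \<and> 0 \<le> L \<and> (\<forall>x y. \<bar>f x - f y\<bar> \<le> L * norm (x - y))"

lemma convex_lipschitz_inner: "convex_lipschitz (norm y) (\<lambda>x. y \<bullet> x)"
proof -
  have "convex_on UNIV (\<lambda>x. y \<bullet> x)"
    by (rule convex_onI) (auto simp: inner_add_right)
  moreover have "\<bar>y \<bullet> x - y \<bullet> x'\<bar> \<le> norm y * norm (x - x')" for x x'
    using Cauchy_Schwarz_ineq2[of y "x - x'"] by (simp add: inner_diff_right)
  ultimately show ?thesis by (simp add: convex_lipschitz_def)
qed

lemma convex_on_affine_image:
  fixes f :: "'a::real_vector \<Rightarrow> real"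
  assumes "convex_on UNIV f" "0 \<le> r"
  shows "convex_on UNIV (\<lambda>x. r * (f (a + s *\<^sub>R x) - c))"
proof (rule convex_onI)
  fix t :: real and x y assume t: "0 < t" "t < 1"
  have "a + s *\<^sub>R ((1 - t) *\<^sub>R x + t *\<^sub>R y) = (1 - t) *\<^sub>R (a + s *\<^sub>R x) + t *\<^sub>R (a + s *\<^sub>R y)"
    by (simp add: algebra_simps)
  then have "f (a + s *\<^sub>R ((1 - t) *\<^sub>R x + t *\<^sub>R y)) \<le> (1 - t) * f (a + s *\<^sub>R x) + t * f (a + s *\<^sub>R y)"
    using convex_onD[OF assms(1), of t "a + s *\<^sub>R x" "a + s *\<^sub>R y"] t by simp
  then have "r * (f (a + s *\<^sub>R ((1 - t) *\<^sub>R x + t *\<^sub>R y)) - c) \<le> r * ((1 - t) * f (a + s *\<^sub>R x) + t * f (a + s *\<^sub>R y) - c)"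
    using assms(2) by (intro mult_left_mono) auto
  then show "r * (f (a + s *\<^sub>R ((1 - t) *\<^sub>R x + t *\<^sub>R y)) - c) \<le> (1 - t) * (r * (f (a + s *\<^sub>R x) - c)) + t * (r * (f (a + s *\<^sub>R y) - c))"
    by (simp add: algebra_simps)
qed simp

lemma convex_lipschitz_blowup:
  assumes "convex_lipschitz L f" "s > 0"
  shows "convex_lipschitz L (\<lambda>x. (1 / s) * (f (a + s *\<^sub>R x) - c))"
proof -
  have "\<bar>(1 / s) * (f (a + s *\<^sub>R x) - c) - (1 / s) * (f (a + s *\<^sub>R y) - c)\<bar> \<le> L * norm (x - y)" for x y
  proof -
    have "\<bar>f (a + s *\<^sub>R x) - f (a + s *\<^sub>R y)\<bar> \<le> L * norm ((a + s *\<^sub>R x) - (a + s *\<^sub>R y))"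
      using assms(1) unfolding convex_lipschitz_def by blast
    also have "(a + s *\<^sub>R x) - (a + s *\<^sub>R y) = s *\<^sub>R (x - y)" by (simp add: algebra_simps)
    finally have le: "\<bar>f (a + s *\<^sub>R x) - f (a + s *\<^sub>R y)\<bar> \<le> s * (L * norm (x - y))"
      using assms(2) by (simp add: mult_ac)
    have "\<bar>(1 / s) * (f (a + s *\<^sub>R x) - c) - (1 / s) * (f (a + s *\<^sub>R y) - c)\<bar> = \<bar>f (a + s *\<^sub>R x) - f (a + s *\<^sub>R y)\<bar> / s"
      using assms(2) by (simp add: diff_divide_distrib[symmetric])
    with le show ?thesis using assms(2) by (simp add: pos_divide_le_eq mult.commute)
  qed
  then show ?thesis
    using assms convex_on_affine_image[of f "1 / s" a s c] by (auto simp: convex_lipschitz_def)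
qed

lemma rest_box_in_Conv_sc:
  fixes a l :: "real^'n"
  shows "convex_lipschitz L f \<Longrightarrow> (\<And>i. 0 \<le> l $ i) \<Longrightarrow> rest (cbox a (a + l)) f \<in> Conv_sc"
  by (intro rest_cbox_in_Conv_sc cbox_length_nonempty) (auto simp: convex_lipschitz_def)

lemma continuous_functional_bounded:
  fixes \<Phi> :: "('n::finite) efun \<Rightarrow> 'b::real_normed_vector"
  assumes cont: "\<And>U u. (\<And>k. U k \<in> Conv_sc) \<Longrightarrow> u \<in> Conv_sc \<Longrightarrow> epi_conv U u \<Longrightarrow> (\<lambda>k. \<Phi> (U k)) \<longlonglongrightarrow> \<Phi> u"
  obtains M where "\<And>f l. convex_lipschitz L f \<Longrightarrow> f 0 = 0 \<Longrightarrow> l \<in> cbox 0 1 \<Longrightarrow> norm (\<Phi> (rest (cbox 0 l) f)) \<le> M"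
proof (rule ccontr)
  assume "\<not> thesis"
  then have "\<forall>k::nat. \<exists>f l. convex_lipschitz L f \<and> f 0 = 0 \<and> l \<in> cbox 0 1 \<and> norm (\<Phi> (rest (cbox 0 l) f)) > real k"
    using that by (metis not_less)
  then obtain f l where fl: "\<And>k. convex_lipschitz L (f k)" "\<And>k. f k 0 = 0" "\<And>k. l k \<in> cbox 0 (1::real^'n)"
    "\<And>k::nat. norm (\<Phi> (rest (cbox 0 (l k)) (f k))) > real k"
    by metis
  let ?S = "cbox 0 (1::real^'n)"
  have L: "0 \<le> L" and lip: "\<And>k x y. \<bar>f k x - f k y\<bar> \<le> L * norm (x - y)"
    using fl(1) by (auto simp: convex_lipschitz_def)
  obtain B where B: "\<And>x. x \<in> ?S \<Longrightarrow> norm x \<le> B"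
    using bounded_cbox[of 0 "1::real^'n"] by (auto simp: bounded_iff)
  obtain g r where g: "continuous_on ?S g" "strict_mono (r :: nat \<Rightarrow> nat)"
    "\<And>e. 0 < e \<Longrightarrow> \<exists>N. \<forall>n x. n \<ge> N \<and> x \<in> ?S \<longrightarrow> norm (f (r n) x - g x) < e"
  proof (rule Arzela_Ascoli[of ?S f "L * B"])
    show "norm (f n x) \<le> L * B" if "x \<in> ?S" for n x
      using lip[of n x 0] fl(2)[of n] mult_left_mono[OF B[OF that] L] by simp
    fix x :: "real^'n" and e :: real assume e: "0 < e"
    show "\<exists>d>0. \<forall>n y. y \<in> ?S \<and> norm (x - y) < d \<longrightarrow> norm (f n x - f n y) < e"
    proof (intro exI conjI allI impI)
      show "e / (L + 1) > 0" using e L by simp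
      fix n y assume "y \<in> ?S \<and> norm (x - y) < e / (L + 1)"
      then have "L * norm (x - y) \<le> L * (e / (L + 1))"
        using L by (intro mult_left_mono) auto
      also have "\<dots> < e" using L e by (simp add: field_simps)
      finally show "norm (f n x - f n y) < e" using lip[of n x y] by simp
    qed
  qed auto
  obtain l' q where q: "l' \<in> ?S" "strict_mono (q :: nat \<Rightarrow> nat)" "((\<lambda>k. l (r k)) \<circ> q) \<longlonglongrightarrow> l'"
    using compact_cbox[of 0 "1::real^'n", unfolded compact_def] fl(3) by metis
  define s where "s k = r (q k)" for k
  have s: "strict_mono s" using strict_mono_o[OF g(2) q(2)] by (simp add: s_def[abs_def] o_def)
  have unif: "\<exists>N. \<forall>n x. n \<ge> N \<and> x \<in> ?S \<longrightarrow> norm (f (s n) x - g x) < e" if "e > 0" for e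
    using g(3)[OF that] seq_suble[OF q(2)] unfolding s_def by (meson order_trans)
  have pw: "(\<lambda>k. f (s k) x) \<longlonglongrightarrow> g x" if "x \<in> ?S" for x
    unfolding LIMSEQ_iff using unif that by meson
  have cg: "convex_on ?S g"
  proof (rule convex_onI)
    fix t :: real and x y assume t: "0 < t" "t < 1" and xy: "x \<in> ?S" "y \<in> ?S"
    have z: "(1 - t) *\<^sub>R x + t *\<^sub>R y \<in> ?S"
      using convex_box(1)[of 0 "1::real^'n"] xy t by (auto simp: convex_alt)
    show "g ((1 - t) *\<^sub>R x + t *\<^sub>R y) \<le> (1 - t) * g x + t * g y"
    proof (rule tendsto_le[OF _ _ pw[OF z]])
      show "(\<lambda>k. (1 - t) * f (s k) x + t * f (s k) y) \<longlonglongrightarrow> (1 - t) * g x + t * g y"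
        by (intro tendsto_intros pw xy)
      show "\<forall>\<^sub>F k in sequentially. f (s k) ((1 - t) *\<^sub>R x + t *\<^sub>R y) \<le> (1 - t) * f (s k) x + t * f (s k) y"
        using fl(1) t by (intro always_eventually allI convex_onD) (auto simp: convex_lipschitz_def)
    qed simp
  qed (rule convex_box)
  have sub: "cbox 0 m \<subseteq> ?S" if "m \<in> ?S" for m :: "real^'n"
    using that by (auto simp: mem_box_cart) (meson order_trans)
  have ne: "cbox 0 m \<noteq> {}" if "m \<in> ?S" for m :: "real^'n"
    using that by (auto simp: mem_box_cart interval_ne_empty_cart)
  have epi: "epi_conv (\<lambda>k. rest (cbox 0 (l (s k))) (f (s k))) (rest (cbox 0 l') g)"
  proof (rule epi_conv_rest_cbox)
    show "(\<lambda>k. l (s k)) \<longlonglongrightarrow> l'" using q(3) by (simp add: s_def o_def)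
    fix X x assume X: "X \<longlonglongrightarrow> x" "\<And>k. X k \<in> cbox 0 (l (s k))" "x \<in> cbox 0 l'"
    have XS: "X k \<in> ?S" for k using X(2)[of k] sub[OF fl(3)] by blast
    have xS: "x \<in> ?S" using X(3) sub[OF q(1)] by blast
    have "(\<lambda>k. f (s k) (X k) - g (X k)) \<longlonglongrightarrow> 0"
      using unif XS by (simp add: LIMSEQ_iff) meson
    moreover have "(\<lambda>k. g (X k)) \<longlonglongrightarrow> g x"
      using continuous_on_tendsto_compose[OF g(1) X(1) xS] XS by simp
    ultimately have "(\<lambda>k. (f (s k) (X k) - g (X k)) + g (X k)) \<longlonglongrightarrow> 0 + g x"
      by (rule tendsto_add)
    then show "(\<lambda>k. f (s k) (X k)) \<longlonglongrightarrow> g x" by simp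
  qed (use ne[OF fl(3)] in auto)
  have "(\<lambda>k. \<Phi> (rest (cbox 0 (l (s k))) (f (s k)))) \<longlonglongrightarrow> \<Phi> (rest (cbox 0 l') g)"
  proof (rule cont[OF _ _ epi])
    show "rest (cbox 0 (l (s k))) (f (s k)) \<in> Conv_sc" for k
      using fl(1) ne[OF fl(3)] by (intro rest_cbox_in_Conv_sc) (auto simp: convex_lipschitz_def)
    show "rest (cbox 0 l') g \<in> Conv_sc"
      using ne[OF q(1)] sub[OF q(1)] cg g(1)
      by (intro rest_in_Conv_sc) (auto intro: convex_on_subset continuous_on_subset)
  qed
  then have "Bseq (\<lambda>k. \<Phi> (rest (cbox 0 (l (s k))) (f (s k))))"
    using convergentI convergent_imp_Bseq by blast
  then obtain C where C: "\<And>k. norm (\<Phi> (rest (cbox 0 (l (s k))) (f (s k)))) \<le> C"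
    by (auto simp: Bseq_def)
  obtain k :: nat where "C < real k" using reals_Archimedean2 by blast
  also have "real k \<le> real (s k)" using seq_suble[OF s] by simp
  also have "\<dots> < norm (\<Phi> (rest (cbox 0 (l (s k))) (f (s k))))" by (rule fl(4))
  finally show False using C[of k] by simp
qed

section \<open>The associated function and the scaling of boxes\<close>

context covariant_valuation
begin

text \<open>A single translation recovers \<open>z0\<close> from \<open>z\<close>; hence
  \<open>z0\<close> is unique on \<open>Conv_sc\<close> and inherits continuity.\<close>

lemma z0_eq_inner:
  assumes "u \<in> Conv_sc"
  shows "z0 u = (z (\<lambda>y. u (y - axis i 1)) - z u) \<bullet> axis i 1"
  using translate[OF assms, of "axis i 1"] by (simp add: inner_axis_axis)

lemma z0_eqI: "u \<in> Conv_sc \<Longrightarrow> (\<And>x. z (\<lambda>y. u (y - x)) = z u + r *\<^sub>R x) \<Longrightarrow> z0 u = r"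
  using z0_eq_inner[of u undefined] by (simp add: inner_axis_axis)

lemma z0_translate:
  assumes u: "u \<in> Conv_sc"
  shows "z0 (\<lambda>y. u (y - v)) = z0 u"
proof (rule z0_eqI[OF Conv_sc_translate[OF u]])
  fix x
  have "z (\<lambda>y. u (y - x - v)) = z (\<lambda>y. u (y - (v + x)))" by (simp add: algebra_simps)
  also have "\<dots> = z u + z0 u *\<^sub>R v + z0 u *\<^sub>R x"
    by (simp add: translate[OF u] scaleR_add_right)
  also have "\<dots> = z (\<lambda>y. u (y - v)) + z0 u *\<^sub>R x" by (simp add: translate[OF u])
  finally show "z (\<lambda>y. u (y - x - v)) = z (\<lambda>y. u (y - v)) + z0 u *\<^sub>R x" .
qed

lemma z0_add_const:
  assumes u: "u \<in> Conv_sc"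
  shows "z0 (\<lambda>y. u y + ereal c) = z0 u"
  by (rule z0_eqI[OF Conv_sc_add_const[OF u]])
    (simp add: add_const[OF u] add_const[OF Conv_sc_translate[OF u]] translate[OF u])

text \<open>Translating by \<open>x\<close> after scaling is translating by \<open>x / t\<close>
  before it, which costs one factor \<open>t\<close> against the degree of \<open>z\<close>.\<close>

lemma z0_homogeneous:
  assumes u: "u \<in> Conv_sc" and t: "t > 0"
  shows "z0 (epi_mult t u) = t ^ CARD('n) * z0 u"
proof (rule z0_eqI[OF Conv_sc_epi_mult[OF u t]])
  fix x
  have "(\<lambda>y. epi_mult t u (y - x)) = epi_mult t (\<lambda>y. u (y - x /\<^sub>R t))"
    by (simp add: epi_mult_def scaleR_diff_right)
  then show "z (\<lambda>y. epi_mult t u (y - x)) = z (epi_mult t u) + (t ^ CARD('n) * z0 u) *\<^sub>R x"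
    using t by (simp add: homogeneous[OF u] homogeneous[OF Conv_sc_translate[OF u]] translate[OF u] scaleR_add_right)
qed

lemma z0_continuous:
  assumes U: "\<And>k. U k \<in> Conv_sc" and u: "u \<in> Conv_sc" and epi: "epi_conv U u"
  shows "(\<lambda>k. z0 (U k)) \<longlonglongrightarrow> z0 u"
proof -
  fix i :: 'n
  have "epi_conv (\<lambda>k y. U k (y - axis i 1)) (\<lambda>y. u (y - axis i 1))"
  proof (rule epi_convI)
    fix X x c assume X: "X \<longlonglongrightarrow> x" and c: "ereal c < u (x - axis i 1)"
    have "(\<lambda>k. X k - axis i 1) \<longlonglongrightarrow> x - axis i 1"
      by (intro tendsto_diff tendsto_const X)
    then show "\<forall>\<^sub>F k in sequentially. ereal c < U k (X k - axis i 1)"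
      by (rule epi_conv_eventually_gt[OF epi _ c])
  next
    fix x
    obtain X where X: "X \<longlonglongrightarrow> x - axis i 1" "(\<lambda>k. U k (X k)) \<longlonglongrightarrow> u (x - axis i 1)"
      using epi_conv_recovery[OF epi] by blast
    have "(\<lambda>k. X k + axis i 1) \<longlonglongrightarrow> x - axis i 1 + axis i 1"
      by (intro tendsto_add tendsto_const X)
    with X(2) show "\<exists>X. X \<longlonglongrightarrow> x \<and> (\<lambda>k. U k (X k - axis i 1)) \<longlonglongrightarrow> u (x - axis i 1)"
      by (intro exI[of _ "\<lambda>k. X k + axis i 1"]) simp
  qed
  then have "(\<lambda>k. z (\<lambda>y. U k (y - axis i 1))) \<longlonglongrightarrow> z (\<lambda>y. u (y - axis i 1))"
    by (intro continuous Conv_sc_translate U u)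
  then have "(\<lambda>k. (z (\<lambda>y. U k (y - axis i 1)) - z (U k)) \<bullet> axis i 1) \<longlonglongrightarrow> (z (\<lambda>y. u (y - axis i 1)) - z u) \<bullet> axis i 1"
    by (intro tendsto_intros continuous[OF U u epi])
  then show ?thesis
    using z0_eq_inner[of _ i] U u by simp
qed

text \<open>Up to the constant \<open>f a\<close>, the restricted function is the blow-up
  \<open>v\<close>, epi-multiplied by \<open>s\<close> and translated to \<open>a\<close>.\<close>

lemma z_box:
  fixes a :: "real^'n"
  assumes f: "convex_lipschitz L f" and l: "\<And>i. 0 \<le> l $ i" and s: "s > 0"
  defines "v \<equiv> rest (cbox 0 (0 + l)) (\<lambda>x. (1 / s) * (f (a + s *\<^sub>R x) - f a))"
  shows "z (rest (cbox a (a + s *\<^sub>R l)) f) = (s ^ CARD('n) * s) *\<^sub>R z v + (s ^ CARD('n) * z0 v) *\<^sub>R a"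
    and "z0 (rest (cbox a (a + s *\<^sub>R l)) f) = s ^ CARD('n) * z0 v"
proof -
  have v: "v \<in> Conv_sc"
    unfolding v_def using l by (intro rest_box_in_Conv_sc[OF convex_lipschitz_blowup[OF f s]])
  have mem: "(y - a) /\<^sub>R s \<in> cbox 0 l \<longleftrightarrow> y \<in> cbox a (a + s *\<^sub>R l)" for y
    using s by (auto simp: mem_box_cart field_simps)
  have eq: "rest (cbox a (a + s *\<^sub>R l)) f = (\<lambda>y. epi_mult s v (y - a) + ereal (f a))"
    using s by (intro ext) (auto simp: rest_def v_def epi_mult_def mem)
  have e: "epi_mult s v \<in> Conv_sc" by (rule Conv_sc_epi_mult[OF v s])
  show "z (rest (cbox a (a + s *\<^sub>R l)) f) = (s ^ CARD('n) * s) *\<^sub>R z v + (s ^ CARD('n) * z0 v) *\<^sub>R a"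
    unfolding eq by (simp add: add_const[OF Conv_sc_translate[OF e]] translate[OF e] homogeneous[OF v s] z0_homogeneous[OF v s])
  show "z0 (rest (cbox a (a + s *\<^sub>R l)) f) = s ^ CARD('n) * z0 v"
    unfolding eq by (simp add: z0_add_const[OF Conv_sc_translate[OF e]] z0_translate[OF e] z0_homogeneous[OF v s])
qed

lemma z_box_bound:
  obtains M where "M > 0" "\<And>f a l s. convex_lipschitz L f \<Longrightarrow> l \<in> cbox 0 1 \<Longrightarrow> s > 0 \<Longrightarrow>
    norm (z (rest (cbox a (a + s *\<^sub>R l)) f)) \<le> s ^ CARD('n) * (s * M + M * norm a)"
proof -
  obtain M1 where M1: "\<And>f l. convex_lipschitz L f \<Longrightarrow> f 0 = 0 \<Longrightarrow> l \<in> cbox 0 1 \<Longrightarrow> norm (z (rest (cbox 0 l) f)) \<le> M1"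
    using continuous_functional_bounded[of z L] continuous by metis
  obtain M2 where M2: "\<And>f l. convex_lipschitz L f \<Longrightarrow> f 0 = 0 \<Longrightarrow> l \<in> cbox 0 1 \<Longrightarrow> norm (z0 (rest (cbox 0 l) f)) \<le> M2"
    using continuous_functional_bounded[of z0 L] z0_continuous by metis
  define M where "M = Max {1, M1, M2}"
  have M: "M \<ge> 1" "M \<ge> M1" "M \<ge> M2" by (auto simp: M_def)
  show ?thesis
  proof (rule that[of M])
    show "M > 0" using M by simp
    fix f :: "real^'n \<Rightarrow> real" and a l :: "real^'n" and s :: real
    assume f: "convex_lipschitz L f" and l: "l \<in> cbox 0 1" and s: "s > 0"
    let ?v = "rest (cbox 0 (0 + l)) (\<lambda>x. (1 / s) * (f (a + s *\<^sub>R x) - f a))"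
    have l0: "\<And>i. 0 \<le> l $ i" using l by (simp add: mem_box_cart)
    have b: "norm (z ?v) \<le> M" "\<bar>z0 ?v\<bar> \<le> M"
      using M1[OF convex_lipschitz_blowup[OF f s, of a "f a"] _ l] M2[OF convex_lipschitz_blowup[OF f s, of a "f a"] _ l] M
      by auto
    have "norm (z (rest (cbox a (a + s *\<^sub>R l)) f)) \<le> norm ((s ^ CARD('n) * s) *\<^sub>R z ?v) + norm ((s ^ CARD('n) * z0 ?v) *\<^sub>R a)"
      unfolding z_box(1)[OF f l0 s] by (rule norm_triangle_ineq)
    also have "\<dots> = s ^ CARD('n) * (s * norm (z ?v) + \<bar>z0 ?v\<bar> * norm a)"
      using s by (simp add: abs_mult algebra_simps)
    also have "\<dots> \<le> s ^ CARD('n) * (s * M + M * norm a)"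
      using s b by (intro mult_left_mono add_mono mult_right_mono) auto
    finally show "norm (z (rest (cbox a (a + s *\<^sub>R l)) f)) \<le> s ^ CARD('n) * (s * M + M * norm a)" .
  qed
qed

text \<open>All pieces restrict the same \<open>f\<close>, so the maximum is its restriction to the
  common face and the minimum its restriction to the union, again a box. For \<open>z0\<close> the
  identity is applied to all translates and coefficients are compared.\<close>

lemma
  fixes a :: "real^'n" and i :: 'n
  assumes f: "convex_lipschitz L f" and l: "\<And>j. 0 \<le> l $ j" and pq: "0 \<le> p" "0 \<le> q"
  defines "b \<equiv> a + p *\<^sub>R axis i 1"
  shows z_split: "z (rest (cbox a (a + upd l i (p + q))) f) =
      z (rest (cbox a (a + upd l i p)) f) + z (rest (cbox b (b + upd l i q)) f) - z (rest (cbox b (b + upd l i 0)) f)"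
    and z0_split: "z0 (rest (cbox a (a + upd l i (p + q))) f) =
      z0 (rest (cbox a (a + upd l i p)) f) + z0 (rest (cbox b (b + upd l i q)) f) - z0 (rest (cbox b (b + upd l i 0)) f)"
proof -
  let ?u = "rest (cbox a (a + upd l i p)) f" and ?w = "rest (cbox b (b + upd l i q)) f"
    and ?M = "rest (cbox b (b + upd l i 0)) f" and ?m = "rest (cbox a (a + upd l i (p + q))) f"
  have mem: "?u \<in> Conv_sc" "?w \<in> Conv_sc" "?M \<in> Conv_sc" "?m \<in> Conv_sc"
    using l pq by (auto intro!: rest_box_in_Conv_sc[OF f])
  have M: "(\<lambda>x. max (?u x) (?w x)) = ?M"
    using cbox_split_upd(2)[OF pq, of a l i] by (auto simp: rest_def fun_eq_iff b_def set_eq_iff)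
  have m: "(\<lambda>x. min (?u x) (?w x)) = ?m"
    using cbox_split_upd(1)[OF pq, of a l i] by (auto simp: rest_def fun_eq_iff b_def set_eq_iff)
  have val: "z ?M + z ?m = z ?u + z ?w"
    using valuation[OF mem(1,2)] mem(3,4) by (simp add: M m)
  then show "z ?m = z ?u + z ?w - z ?M" by (simp add: algebra_simps)
  have "z (\<lambda>y. ?M (y - x)) + z (\<lambda>y. ?m (y - x)) = z (\<lambda>y. ?u (y - x)) + z (\<lambda>y. ?w (y - x))" for x
    using valuation[OF mem(1,2)[THEN Conv_sc_translate[of _ x]]] mem(3,4)[THEN Conv_sc_translate[of _ x]]
    by (simp add: M[THEN fun_cong] m[THEN fun_cong])
  then have "(z ?M + z0 ?M *\<^sub>R x) + (z ?m + z0 ?m *\<^sub>R x) = (z ?u + z0 ?u *\<^sub>R x) + (z ?w + z0 ?w *\<^sub>R x)" for x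
    by (simp only: translate[OF mem(1)] translate[OF mem(2)] translate[OF mem(3)] translate[OF mem(4)])
  then have eqx: "(z ?M + z ?m) + (z0 ?M + z0 ?m) *\<^sub>R x = (z ?u + z ?w) + (z0 ?u + z0 ?w) *\<^sub>R x" for x
    by (simp only: scaleR_add_left add_ac)
  have "(z0 ?M + z0 ?m) *\<^sub>R x = (z0 ?u + z0 ?w) *\<^sub>R x" for x :: "real^'n"
    using eqx[of x] unfolding val by (simp only: add_left_cancel)
  then have "z0 ?M + z0 ?m = z0 ?u + z0 ?w"
    by (metis axis_eq_0_iff[where 'b='n and 'a=real] scaleR_cancel_right zero_neq_one)
  then show "z0 ?m = z0 ?u + z0 ?w - z0 ?M" by simp
qed


subsection \<open>Simplicity\<close>

text \<open>A box with side lengths l and support S of l is halved m times in all directions. If z does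
  not vanish on it, one of the resulting boxes carries at least the fraction 2 to the power - m |S|
  of the value, whereas homogeneity bounds the value by a multiple of 2 to the power - m n.\<close>

lemma z_degenerate_box:
  assumes f: "convex_lipschitz L f" and l: "\<And>j. 0 \<le> l $ j" and i0: "l $ i0 = 0"
  shows "z (rest (cbox a (a + l)) f) = 0"
  using l i0
proof (induction "card {j. l $ j \<noteq> 0}" arbitrary: l a rule: less_induct)
  case less
  let ?l = l
  define S where "S = {j. l $ j \<noteq> 0}"
  define d where "d = card S"
  have "i0 \<notin> S" using less.prems by (simp add: S_def)
  then have "S \<subset> UNIV" by auto
  then have d: "d < CARD('n)" unfolding d_def by (intro psubset_card_mono) auto
  let ?F = "\<lambda>a l. z (rest (cbox a (a + l)) f)"
  define pr where "pr l = (\<Prod>j\<in>S. l $ j)" for l :: "real^'n"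
  have pr0: "pr l > 0"
    unfolding pr_def using less.prems(1) by (intro prod_pos) (auto simp: S_def less_le)
  show ?case
  proof (rule ccontr)
    assume nz: "?F a l \<noteq> 0"
    \<comment> \<open>\<open>pr\<close> is the volume of the box within its affine hull,
      \<open>\<kappa>\<close> the initial modulus per unit of this volume; \<open>Q\<close> says
      that a box carries at least that much.\<close>
    define \<kappa> where "\<kappa> = norm (?F a l) / pr l"
    have \<kappa>: "\<kappa> > 0" using nz pr0 by (simp add: \<kappa>_def)
    define Q where "Q a l \<longleftrightarrow> {j. l $ j \<noteq> 0} = S \<and> \<kappa> * pr l \<le> norm (?F a l)" for a l
    have step: "Q a (upd l i (l $ i / 2)) \<or> Q (a + (l $ i / 2) *\<^sub>R axis i 1) (upd l i (l $ i / 2))"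
      if l: "\<And>j. 0 \<le> l $ j" and Q: "Q a l" for a l i
    proof (cases "i \<in> S")
      case False
      then have "l $ i = 0" using Q by (auto simp: Q_def)
      then have "upd l i (l $ i / 2) = l" by (simp add: vec_eq_iff)
      then show ?thesis using Q by simp
    next
      case True
      have supp: "{j. l $ j \<noteq> 0} = S" using Q by (simp add: Q_def)
      have supp': "{j. upd l i (l $ i / 2) $ j \<noteq> 0} = S"
        using supp by auto
      have supp0: "{j. upd l i 0 $ j \<noteq> 0} = S - {i}" using supp by auto
      \<comment> \<open>The face of the cut has one nonzero side less, so the induction hypothesis
        removes its contribution.\<close>
      have "?F b (upd l i 0) = 0" for b
      proof (rule less.hyps)
        have "card (S - {i}) < card S" using True by (intro psubset_card_mono) auto
        then show "card {j. upd l i 0 $ j \<noteq> 0} < card {j. ?l $ j \<noteq> 0}"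
          unfolding supp0 S_def .
      qed (use l \<open>i0 \<notin> S\<close> supp in auto)
      then have split: "?F a l = ?F a (upd l i (l $ i / 2)) + ?F (a + (l $ i / 2) *\<^sub>R axis i 1) (upd l i (l $ i / 2))"
        using z_split[OF f l, of "l $ i / 2" "l $ i / 2" a i] l[of i] by simp
      have half: "pr (upd l i (l $ i / 2)) = pr l / 2"
      proof -
        have "pr (upd l i (l $ i / 2)) = (l $ i / 2) * (\<Prod>j\<in>S - {i}. upd l i (l $ i / 2) $ j)"
          unfolding pr_def using True by (subst prod.remove[of S i]) auto
        also have "(\<Prod>j\<in>S - {i}. upd l i (l $ i / 2) $ j) = (\<Prod>j\<in>S - {i}. l $ j)"
          by (intro prod.cong) auto
        also have "(l $ i / 2) * (\<Prod>j\<in>S - {i}. l $ j) = pr l / 2"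
          unfolding pr_def using True by (subst prod.remove[of S i]) auto
        finally show ?thesis .
      qed
      have "\<kappa> * pr l = 2 * (\<kappa> * pr (upd l i (l $ i / 2)))" unfolding half by simp
      moreover have "norm (?F a l) \<le> norm (?F a (upd l i (l $ i / 2))) + norm (?F (a + (l $ i / 2) *\<^sub>R axis i 1) (upd l i (l $ i / 2)))"
        unfolding split by (rule norm_triangle_ineq)
      moreover have "\<kappa> * pr l \<le> norm (?F a l)" using Q by (simp add: Q_def)
      ultimately show ?thesis
        unfolding Q_def supp' simp_thms by linarith
    qed
    have Q0: "Q a l" using pr0 by (simp add: Q_def S_def \<kappa>_def)
    obtain A where A: "\<And>m. Q (A m) ((1/2)^m *\<^sub>R l)"
      "\<And>m k. m \<le> k \<Longrightarrow> cbox (A k) (A k + (1/2)^k *\<^sub>R l) \<subseteq> cbox (A m) (A m + (1/2)^m *\<^sub>R l)" "A 0 = a"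
      using halving_sequence[of Q l a, OF step less.prems(1) Q0] by metis
    obtain B where B: "\<And>x. x \<in> cbox a (a + l) \<Longrightarrow> norm x \<le> B"
      using bounded_cbox[of a "a + l"] by (auto simp: bounded_iff)
    have "A m \<in> cbox a (a + l)" for m
    proof -
      have "A m \<in> cbox (A m) (A m + (1/2)^m *\<^sub>R l)"
        using less.prems(1) by (simp add: mem_box_cart)
      then show ?thesis using A(2)[of 0 m] A(3) by auto
    qed
    then have AB: "norm (A m) \<le> B" for m using B by blast
    have B0: "0 \<le> B" using AB[of 0] norm_ge_zero order_trans by blast
    \<comment> \<open>Normalises the side vector into the unit cube, as the uniform bound requires;
      the summand 1 covers \<open>l = 0\<close>.\<close>
    define \<sigma> where "\<sigma> = norm l + 1"
    have \<sigma>: "\<sigma> > 0" by (simp add: \<sigma>_def add_nonneg_pos)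
    have "l $ j \<le> \<sigma>" for j
      using component_le_norm_cart[of l j] by (simp add: \<sigma>_def)
    then have l1: "l /\<^sub>R \<sigma> \<in> cbox 0 1"
      using less.prems(1) \<sigma> by (simp add: mem_box_cart field_simps)
    obtain M where M: "M > 0" "\<And>f a l s. convex_lipschitz L f \<Longrightarrow> l \<in> cbox 0 1 \<Longrightarrow> s > 0 \<Longrightarrow>
      norm (z (rest (cbox a (a + s *\<^sub>R l)) f)) \<le> s ^ CARD('n) * (s * M + M * norm a)"
      using z_box_bound by metis
    define C where "C = \<sigma> ^ CARD('n) * (\<sigma> * M + M * B)"
    have bound: "\<kappa> * pr l \<le> C * (1/2)^m" for m
    proof -
      define s where "s = (1/2)^m * \<sigma>"
      have s: "s > 0" "s \<le> \<sigma>" using \<sigma> by (auto simp: s_def power_le_one)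
      have "\<kappa> * pr ((1/2)^m *\<^sub>R l) \<le> norm (?F (A m) ((1/2)^m *\<^sub>R l))"
        using A(1)[of m] by (simp add: Q_def)
      also have "(1/2)^m *\<^sub>R l = s *\<^sub>R (l /\<^sub>R \<sigma>)" using \<sigma> by (simp add: s_def)
      also have "norm (?F (A m) (s *\<^sub>R (l /\<^sub>R \<sigma>))) \<le> s ^ CARD('n) * (s * M + M * norm (A m))"
        by (rule M(2)[OF f l1 s(1)])
      also have "\<dots> \<le> s ^ CARD('n) * (\<sigma> * M + M * B)"
        using s M(1) AB[of m] by (intro mult_left_mono add_mono mult_right_mono) auto
      also have "\<dots> = (1/2)^(m * CARD('n)) * C"
        by (simp add: s_def C_def power_mult_distrib power_mult)
      finally have 1: "\<kappa> * pr (s *\<^sub>R (l /\<^sub>R \<sigma>)) \<le> (1/2)^(m * CARD('n)) * C" .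
      have "pr (s *\<^sub>R (l /\<^sub>R \<sigma>)) = (1/2)^(m * d) * pr l"
      proof -
        have "s *\<^sub>R (l /\<^sub>R \<sigma>) = (1/2)^m *\<^sub>R l" using \<sigma> by (simp add: s_def)
        then show ?thesis by (simp only:) (simp add: pr_def prod.distrib d_def power_mult)
      qed
      with 1 have "(1/2)^(m * d) * (\<kappa> * pr l) \<le> (1/2)^(m * CARD('n)) * C"
        by (simp add: mult_ac)
      \<comment> \<open>Since \<open>d < n\<close>, at least one factor \<open>(1/2)^m\<close> is
        left after cancelling, and it tends to 0.\<close>
      also have "m * CARD('n) = m * d + m * (CARD('n) - d)"
        using d by (simp add: distrib_left[symmetric])
      also have "(1/2)^\<dots> * C = (1/2)^(m * d) * ((1/2)^(m * (CARD('n) - d)) * C)"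
        by (simp add: power_add)
      finally have "\<kappa> * pr l \<le> (1/2)^(m * (CARD('n) - d)) * C"
        by (simp only: mult_le_cancel_left_pos zero_less_power zero_less_divide_1_iff zero_less_numeral)
      also have "\<dots> \<le> (1/2)^m * C"
        using d \<sigma> M(1) B0 by (intro mult_right_mono power_decreasing) (auto simp: C_def)
      finally show ?thesis by (simp add: mult.commute)
    qed
    have "(\<lambda>m. C * (1/2)^m) \<longlonglongrightarrow> C * 0"
      by (intro tendsto_intros LIMSEQ_realpow_zero) auto
    then have "\<kappa> * pr l \<le> C * 0"
      by (rule tendsto_lowerbound) (use bound in auto)
    moreover have "\<kappa> * pr l > 0" using \<kappa> pr0 by simp
    ultimately show False by simp
  qed
qed

text \<open>Translates of a degenerate box are degenerate, so \<open>z\<close> vanishes on all of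
  them and the coefficient of the translation vector is 0.\<close>

lemma z0_degenerate_box:
  assumes f: "convex_lipschitz L f" and l: "\<And>j. 0 \<le> l $ j" and i0: "l $ i0 = 0"
  shows "z0 (rest (cbox a (a + l)) f) = 0"
proof (rule z0_eqI[OF rest_box_in_Conv_sc[OF f l]])
  fix x
  have f': "convex_lipschitz L (\<lambda>y. f (y - x))"
    using convex_lipschitz_blowup[OF f zero_less_one, of "- x" 0] by simp
  have "(\<lambda>y. rest (cbox a (a + l)) f (y - x)) = rest (cbox (a + x) (a + x + l)) (\<lambda>y. f (y - x))"
    by (auto simp: rest_def fun_eq_iff mem_box_cart algebra_simps)
  then show "z (\<lambda>y. rest (cbox a (a + l)) f (y - x)) = z (rest (cbox a (a + l)) f) + 0 *\<^sub>R x"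
    using z_degenerate_box[OF f l i0] z_degenerate_box[OF f' l i0] by simp
qed

subsection \<open>The density\<close>

definition grad_density :: "real^'n \<Rightarrow> real" where
  "grad_density y = z0 (rest (cbox 0 1) (\<lambda>x. y \<bullet> x))"

lemma continuous_grad_density: "continuous_on UNIV grad_density"
proof -
  have "(\<lambda>k. grad_density (y k)) \<longlonglongrightarrow> grad_density y'" if y: "y \<longlonglongrightarrow> y'" for y y'
    unfolding grad_density_def
  proof (rule z0_continuous)
    show "rest (cbox 0 1) ((\<bullet>) (y k)) \<in> Conv_sc" for k
      using rest_box_in_Conv_sc[OF convex_lipschitz_inner, of 1 0] by simp
    show "rest (cbox 0 1) ((\<bullet>) y') \<in> Conv_sc"
      using rest_box_in_Conv_sc[OF convex_lipschitz_inner, of 1 0] by simp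
    show "epi_conv (\<lambda>k. rest (cbox 0 1) ((\<bullet>) (y k))) (rest (cbox 0 1) ((\<bullet>) y'))"
      using y by (intro epi_conv_rest_cbox tendsto_intros) (auto simp: interval_ne_empty_cart)
  qed
  then show ?thesis
    by (simp add: continuous_on_sequentially o_def)
qed

lemma z0_linear_translate:
  assumes "\<And>j. 0 \<le> l $ j"
  shows "z0 (rest (cbox a (a + l)) (\<lambda>x. y \<bullet> x)) = z0 (rest (cbox 0 l) (\<lambda>x. y \<bullet> x))"
proof -
  have v: "rest (cbox 0 (0 + l)) (\<lambda>x. y \<bullet> x) \<in> Conv_sc"
    by (rule rest_box_in_Conv_sc[OF convex_lipschitz_inner assms])
  have "rest (cbox a (a + l)) (\<lambda>x. y \<bullet> x) = (\<lambda>x. rest (cbox 0 (0 + l)) (\<lambda>x. y \<bullet> x) (x - a) + ereal (y \<bullet> a))"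
    by (auto simp: rest_def fun_eq_iff mem_box_cart algebra_simps inner_diff_right)
  then show ?thesis
    by (simp add: z0_add_const[OF Conv_sc_translate[OF v]] z0_translate[OF v, simplified] del: add_0)
      (simp add: z0_add_const[OF Conv_sc_translate[OF v, simplified]] z0_translate[OF v, simplified])
qed

text \<open>The box consists of \<open>m\<close> cubes of side \<open>p\<close> in a row. The faces
  between them are degenerate, and \<open>z0\<close> of a linear function does not depend on the
  position of the cube.\<close>

lemma z0_linear_stack:
  assumes p: "p > 0"
  shows "z0 (rest (cbox a (a + upd (p *\<^sub>R 1) i (real m * p))) (\<lambda>x. y \<bullet> x)) = real m * (p ^ CARD('n) * grad_density y)"
proof -
  let ?l = "\<lambda>m. upd (p *\<^sub>R 1 :: real^'n) i (real m * p)"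
  let ?h = "\<lambda>l. z0 (rest (cbox 0 l) (\<lambda>x. y \<bullet> x))"
  have l0: "\<And>m j. 0 \<le> ?l m $ j" using p by simp
  have one: "?h (p *\<^sub>R 1) = p ^ CARD('n) * grad_density y"
    using z_box(2)[OF convex_lipschitz_inner[of y] _ p, of 1 0] p by (simp add: grad_density_def)
  have "?h (?l m) = real m * (p ^ CARD('n) * grad_density y)"
  proof (induction m)
    case 0
    then show ?case
      using z0_degenerate_box[OF convex_lipschitz_inner[of y] l0[of 0], of i 0] by simp
  next
    case (Suc m)
    let ?b = "0 + (real m * p) *\<^sub>R axis i 1"
    have upd1: "upd (p *\<^sub>R 1) i p = p *\<^sub>R (1 :: real^'n)" by (simp add: vec_eq_iff)
    have "?h (?l (Suc m)) = z0 (rest (cbox 0 (0 + upd (p *\<^sub>R 1) i (real m * p + p))) (\<lambda>x. y \<bullet> x))"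
      by (simp add: algebra_simps)
    also have "\<dots> = ?h (?l m) + z0 (rest (cbox ?b (?b + upd (p *\<^sub>R 1) i p)) (\<lambda>x. y \<bullet> x))
        - z0 (rest (cbox ?b (?b + upd (p *\<^sub>R 1) i 0)) (\<lambda>x. y \<bullet> x))"
      using z0_split[OF convex_lipschitz_inner[of y], of "p *\<^sub>R 1" "real m * p" p 0 i] p by simp
    also have "z0 (rest (cbox ?b (?b + upd (p *\<^sub>R 1) i 0)) (\<lambda>x. y \<bullet> x)) = 0"
      using p by (intro z0_degenerate_box[OF convex_lipschitz_inner, of _ i]) auto
    also have "z0 (rest (cbox ?b (?b + upd (p *\<^sub>R 1) i p)) (\<lambda>x. y \<bullet> x)) = p ^ CARD('n) * grad_density y"
      unfolding upd1 using p one by (subst z0_linear_translate) auto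
    finally show ?case using Suc by (simp add: algebra_simps)
  qed
  then show ?thesis using z0_linear_translate[OF l0] by simp
qed

text \<open>If the support were unbounded, stacks of small cubes in a direction of steep slope would
  give functions with value of modulus at least 1 that epi-converge to the indicator of the origin.\<close>

lemma grad_density_bounded_support: "\<exists>R. \<forall>y. grad_density y \<noteq> 0 \<longrightarrow> norm y \<le> R"
proof (rule ccontr)
  assume "\<not> ?thesis"
  \<comment> \<open>The factor \<open>n\<close> guarantees a single coordinate of modulus above
    \<open>k\<close>, by comparison with the sum of the coordinates.\<close>
  then have "\<forall>k::nat. \<exists>y. grad_density y \<noteq> 0 \<and> norm y > real CARD('n) * real k"
    by (meson not_le)
  then obtain y where y: "\<And>k. grad_density (y k) \<noteq> 0" "\<And>k. norm (y k) > real CARD('n) * real k"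
    by metis
  have "\<exists>i. \<bar>y k $ i\<bar> > real k" for k
  proof (rule ccontr)
    assume "\<not> ?thesis"
    then have "(\<Sum>i\<in>UNIV. \<bar>y k $ i\<bar>) \<le> (\<Sum>i\<in>(UNIV::'n set). real k)"
      by (intro sum_mono) (simp add: not_less)
    then show False using norm_le_l1_cart[of "y k"] y(2)[of k] by simp
  qed
  then obtain i where i: "\<And>k. \<bar>y k $ i k\<bar> > real k" by metis
  define p where "p k = inverse (real (Suc k))" for k
  have p: "p k > 0" for k by (simp add: p_def)
  have plim: "p \<longlonglongrightarrow> 0" unfolding p_def[abs_def] by (rule LIMSEQ_inverse_real_of_nat)
  \<comment> \<open>However small the density at \<open>y k\<close> is, enough cubes bring the value
    up to modulus 1; the resulting length of the stack is not controlled.\<close>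
  have "\<exists>m::nat. real m * (p k ^ CARD('n) * \<bar>grad_density (y k)\<bar>) \<ge> 1" for k
    using reals_Archimedean3[of "p k ^ CARD('n) * \<bar>grad_density (y k)\<bar>"] y(1)[of k] p[of k]
    by (metis less_imp_le mult_pos_pos zero_less_abs_iff zero_less_power)
  then obtain m :: "nat \<Rightarrow> nat" where m: "\<And>k. real (m k) * (p k ^ CARD('n) * \<bar>grad_density (y k)\<bar>) \<ge> 1" by metis
  define l where "l k = upd (p k *\<^sub>R 1) (i k) (real (m k) * p k)" for k
  \<comment> \<open>The corner is placed so that every product \<open>y k $ j * x $ j\<close> is
    nonnegative on the box; then each single coordinate bounds the linear function from
    below.\<close>
  define c where "c k = (\<chi> j. if y k $ j \<ge> 0 then 0 else - (l k $ j))" for k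
  have l0: "0 \<le> l k $ j" for k j using p[of k] by (simp add: l_def)
  define U where "U k = rest (cbox (c k) (c k + l k)) (\<lambda>x. y k \<bullet> x)" for k
  define u where "u = rest (cbox 0 (0 + 0)) (\<lambda>x::real^'n. 0 \<bullet> x)"
  have U: "U k \<in> Conv_sc" for k
    unfolding U_def by (rule rest_box_in_Conv_sc[OF convex_lipschitz_inner l0])
  have u: "u \<in> Conv_sc"
    unfolding u_def by (rule rest_box_in_Conv_sc[OF convex_lipschitz_inner]) simp
  have pos: "0 \<le> y k $ j * x $ j" "\<bar>x $ j\<bar> \<le> l k $ j" if "x \<in> cbox (c k) (c k + l k)" for k x j
  proof -
    have "c k $ j \<le> x $ j \<and> x $ j \<le> c k $ j + l k $ j"
      using that by (simp add: mem_box_cart)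
    then show "0 \<le> y k $ j * x $ j" "\<bar>x $ j\<bar> \<le> l k $ j"
      by (auto simp: c_def zero_le_mult_iff split: if_splits)
  qed
  have ge: "y k $ j * x $ j \<le> y k \<bullet> x" if "x \<in> cbox (c k) (c k + l k)" for k x j
  proof -
    have "y k $ j * x $ j \<le> (\<Sum>i\<in>UNIV. y k $ i * x $ i)"
      by (rule member_le_sum) (use pos(1)[OF that] in auto)
    then show ?thesis by (simp add: inner_vec_def)
  qed
  have "epi_conv U u"
  proof (rule epi_convI)
    fix X x b assume X: "X \<longlonglongrightarrow> x" and b: "ereal b < u x"
    show "\<forall>\<^sub>F k in sequentially. ereal b < U k (X k)"
    proof (cases "x = 0")
      case True
      then have "b < 0" using b by (simp add: u_def rest_def)
      have "b < y k \<bullet> X k" if "X k \<in> cbox (c k) (c k + l k)" for k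
        using ge[OF that, of "i k"] pos(1)[OF that, of "i k"] \<open>b < 0\<close> by linarith
      then show ?thesis by (intro always_eventually) (auto simp: U_def rest_def)
    next
      case False
      then obtain j where j: "x $ j \<noteq> 0" by (auto simp: vec_eq_iff)
      define d where "d = \<bar>x $ j\<bar> / 2"
      have d: "d > 0" using j by (simp add: d_def)
      have "(\<lambda>k. \<bar>X k $ j\<bar>) \<longlonglongrightarrow> \<bar>x $ j\<bar>"
        by (intro tendsto_rabs tendsto_vec_nth X)
      then have "\<forall>\<^sub>F k in sequentially. d < \<bar>X k $ j\<bar>"
        using j by (intro order_tendstoD(1)) (auto simp: d_def)
      moreover have "\<forall>\<^sub>F k in sequentially. p k < d"
        using order_tendstoD(2)[OF plim d] .
      moreover have "\<forall>\<^sub>F k in sequentially. b < real k * d"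
        using d by real_asymp
      ultimately show ?thesis
      proof eventually_elim
        case (elim k)
        show ?case
        proof (cases "X k \<in> cbox (c k) (c k + l k)")
          case True
          \<comment> \<open>All sides except the stacking direction have length
            \<open>p k < d\<close>, so only the steep coordinate can stay away from 0.\<close>
          have "j = i k"
            using pos(2)[OF True, of j] elim(1,2) by (auto simp: l_def split: if_splits)
          have "b < real k * d" by fact
          also have "\<dots> \<le> \<bar>y k $ j\<bar> * \<bar>X k $ j\<bar>"
            using i[of k] elim(1) d \<open>j = i k\<close> by (intro mult_mono) auto
          also have "\<dots> = y k $ j * X k $ j"
            using pos(1)[OF True, of j] by (simp add: abs_mult[symmetric])
          also have "\<dots> \<le> y k \<bullet> X k" by (rule ge[OF True])
          finally show ?thesis using True by (simp add: U_def rest_def)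
        qed (simp add: U_def rest_def)
      qed
    qed
  next
    fix x assume "u x < \<infinity>"
    then have x: "x = 0" by (auto simp: u_def rest_def split: if_splits)
    have "0 \<in> cbox (c k) (c k + l k)" for k
      using l0[of k] by (auto simp: mem_box_cart c_def)
    then have "U k 0 = 0" for k by (simp add: U_def rest_def)
    then show "\<exists>X. X \<longlonglongrightarrow> x \<and> (\<lambda>k. U k (X k)) \<longlonglongrightarrow> u x"
      by (intro exI[of _ "\<lambda>_. 0"]) (simp add: x u_def rest_def zero_ereal_def)
  qed
  then have "(\<lambda>k. z0 (U k)) \<longlonglongrightarrow> z0 u" by (rule z0_continuous[OF U u])
  moreover have "z0 u = 0"
    unfolding u_def by (rule z0_degenerate_box[OF convex_lipschitz_inner]) auto
  ultimately have "(\<lambda>k. \<bar>z0 (U k)\<bar>) \<longlonglongrightarrow> 0" using tendsto_rabs_zero by simp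
  then have "\<forall>\<^sub>F k in sequentially. \<bar>z0 (U k)\<bar> < 1"
    by (rule order_tendstoD(2)) simp
  moreover have "\<bar>z0 (U k)\<bar> \<ge> 1" for k
    using m[of k] p[of k] unfolding U_def l_def z0_linear_stack[OF p] by (simp add: abs_mult)
  ultimately have "\<forall>\<^sub>F k::nat in sequentially. False"
    by (auto elim!: eventually_mono simp: not_le[symmetric])
  then show False by simp
qed

lemma grad_density_in_Cc_Rn: "grad_density \<in> Cc_Rn"
  using Cc_RnI[OF continuous_grad_density] grad_density_bounded_support by blast

end

section \<open>Representation\<close>

context covariant_valuation
begin

text \<open>Otherwise halving produces nested cubes on which the modulus of z exceeds a small multiple
  of the volume, plus a large multiple of the volume inside a small open set containing all points
  where f is not differentiable. At the limit point of the cubes, f must then be differentiable, and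
  blowing up the cubes gives functions converging to a linear one, where the density vanishes.\<close>

lemma z_cube_eq_0:
  assumes f: "convex_lipschitz L f" and dens: "\<And>y. grad_density y = 0" and s: "s > 0"
  shows "z (rest (cbox a (a + s *\<^sub>R 1)) f) = 0"
proof (rule ccontr)
  let ?F = "\<lambda>a l. z (rest (cbox a (a + l)) f)"
  let ?n = "CARD('n)"
  assume nz: "?F a (s *\<^sub>R 1) \<noteq> 0"
  have cvx: "convex_on UNIV f" using f by (simp add: convex_lipschitz_def)
  obtain M where M: "M > 0" "\<And>f a l s. convex_lipschitz L f \<Longrightarrow> l \<in> cbox 0 1 \<Longrightarrow> s > 0 \<Longrightarrow>
      norm (z (rest (cbox a (a + s *\<^sub>R l)) f)) \<le> s ^ ?n * (s * M + M * norm a)"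
    using z_box_bound by metis
  obtain B where B: "\<And>x. x \<in> cbox a (a + s *\<^sub>R 1) \<Longrightarrow> norm x \<le> B"
    using bounded_cbox[of a "a + s *\<^sub>R 1"] by (auto simp: bounded_iff)
  have "a \<in> cbox a (a + s *\<^sub>R 1)" using s by (simp add: mem_box_cart)
  then have B0: "0 \<le> B" using B norm_ge_zero order_trans by blast
  define M' where "M' = s * M + M * B"
  have M': "M' > 0" using s M(1) B0 by (auto simp: M'_def intro: add_pos_nonneg)
  define \<delta> where "\<delta> = norm (?F a (s *\<^sub>R 1))"
  \<comment> \<open>Then \<open>\<eta>\<close> times the volume of the cube plus \<open>M'\<close>
    times a measure below \<open>\<eta>\<close> stays below \<open>\<delta>\<close>, which starts
    the bisection.\<close>
  define \<eta> where "\<eta> = \<delta> / (s ^ ?n + M')"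
  have den: "s ^ ?n + M' > 0" using s M' by (simp add: add_pos_pos)
  have \<eta>: "\<eta> > 0" using nz den by (simp add: \<eta>_def \<delta>_def)
  define N where "N = {x. \<not> (\<exists>g. (f has_derivative (\<lambda>h. g \<bullet> h)) (at x))}"
  have "AE x in lebesgue. x \<notin> N"
    unfolding AE_completion_iff N_def using convex_on_AE_differentiable[OF cvx open_UNIV] by simp
  then have N: "N \<in> null_sets lebesgue"
    by (simp add: completion.AE_iff_null_sets)
  obtain U where U: "open U" "N \<subseteq> U" "U - N \<in> lmeasurable" "emeasure lebesgue (U - N) < ennreal \<eta>"
    using sets_lebesgue_outer_open[OF _ \<eta>] N by (metis null_setsD2)
  have Nm: "N \<in> lmeasurable" using N by (simp add: negligible_iff_null_sets[symmetric] negligible_imp_measurable)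
  have UN: "U = (U - N) \<union> N" using U(2) by auto
  have Um: "U \<in> lmeasurable" using fmeasurable.Un[OF U(3) Nm] UN by metis
  have mU: "measure lebesgue U < \<eta>"
  proof -
    have "measure lebesgue U = measure lebesgue (U - N)"
      using N U(3) by (simp add: measure_Diff_null_set Um fmeasurableD)
    also have "ennreal (measure lebesgue (U - N)) < ennreal \<eta>"
      using U(3,4) by (simp add: emeasure_eq_measure2)
    then have "measure lebesgue (U - N) < \<eta>" by (simp add: ennreal_less_iff)
    finally show ?thesis .
  qed
  \<comment> \<open>The weight \<open>M'\<close> on \<open>U\<close> is the constant of the crude
    bound for all subcubes, so no cube of the bisection contained in \<open>U\<close> can satisfy
    \<open>Q\<close>. Both terms are additive under cuts.\<close>
  define \<nu> where "\<nu> K = \<eta> * measure lebesgue K + M' * measure lebesgue (K \<inter> U)" for K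
  have meas_cube: "measure lebesgue (cbox b (b + \<sigma> *\<^sub>R (1::real^'n))) = \<sigma> ^ ?n" if "\<sigma> > 0" for b \<sigma>
    using that cbox_length_nonempty[of "\<sigma> *\<^sub>R 1" b] by (simp add: measure_completion content_cbox_cart)
  define Q where "Q a l \<longleftrightarrow> \<nu> (cbox a (a + l)) < norm (?F a l)" for a l
  have step: "Q a (upd l i (l $ i / 2)) \<or> Q (a + (l $ i / 2) *\<^sub>R axis i 1) (upd l i (l $ i / 2))"
    if l: "\<And>j. 0 \<le> l $ j" and Q: "Q a l" for a l i
  proof -
    let ?b = "a + (l $ i / 2) *\<^sub>R axis i 1" and ?l = "upd l i (l $ i / 2)"
    have "?F ?b (upd l i 0) = 0"
      by (rule z_degenerate_box[OF f, of _ i]) (use l in auto)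
    then have "?F a l = ?F a ?l + ?F ?b ?l"
      using z_split[OF f l, of "l $ i / 2" "l $ i / 2" a i] l[of i] by simp
    then have 1: "norm (?F a l) \<le> norm (?F a ?l) + norm (?F ?b ?l)"
      by (metis norm_triangle_ineq)
    have un: "cbox a (a + ?l) \<union> cbox ?b (?b + ?l) = cbox a (a + l)"
      and int: "cbox a (a + ?l) \<inter> cbox ?b (?b + ?l) = cbox ?b (?b + upd l i 0)"
      using cbox_split_upd[of "l $ i / 2" "l $ i / 2" a l i] l[of i] by simp_all
    have "box ?b (?b + upd l i 0) = {}"
      unfolding interval_eq_empty_cart by (rule exI[of _ i]) simp
    then have neg: "negligible (cbox ?b (?b + upd l i 0))"
      by (simp add: negligible_interval)
    have "measure lebesgue (cbox a (a + l)) = measure lebesgue (cbox a (a + ?l)) + measure lebesgue (cbox ?b (?b + ?l))"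
      unfolding un[symmetric]
      by (subst measure_Un3) (auto simp: int negligible_imp_measure0[OF neg] simp del: measure_completion)
    moreover have "measure lebesgue (cbox a (a + l) \<inter> U) = measure lebesgue (cbox a (a + ?l) \<inter> U) + measure lebesgue (cbox ?b (?b + ?l) \<inter> U)"
    proof -
      have "negligible ((cbox a (a + ?l) \<inter> U) \<inter> (cbox ?b (?b + ?l) \<inter> U))"
        by (rule negligible_subset[OF neg]) (use int in auto)
      moreover have "cbox a (a + l) \<inter> U = (cbox a (a + ?l) \<inter> U) \<union> (cbox ?b (?b + ?l) \<inter> U)"
        using un by auto
      ultimately show ?thesis
        using Um by (simp only: measure_Un3 fmeasurable.Int lmeasurable_cbox negligible_imp_measure0)
    qed
    ultimately have "\<nu> (cbox a (a + l)) = \<nu> (cbox a (a + ?l)) + \<nu> (cbox ?b (?b + ?l))"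
      by (simp add: \<nu>_def algebra_simps)
    with 1 Q show ?thesis unfolding Q_def by linarith
  qed
  have Q0: "Q a (s *\<^sub>R 1)"
  proof -
    have "measure lebesgue (cbox a (a + s *\<^sub>R 1) \<inter> U) \<le> measure lebesgue U"
      using Um by (intro measure_mono_fmeasurable) auto
    then have "\<nu> (cbox a (a + s *\<^sub>R 1)) \<le> \<eta> * s ^ ?n + M' * measure lebesgue U"
      using M' by (simp add: \<nu>_def meas_cube[OF s])
    also have "\<dots> < \<eta> * s ^ ?n + M' * \<eta>"
      using mU M' by simp
    also have "\<dots> = \<eta> * (s ^ ?n + M')" by (simp add: algebra_simps)
    also have "\<dots> = \<delta>" using den by (simp add: \<eta>_def)
    finally show ?thesis by (simp add: Q_def \<delta>_def)
  qed
  have nn: "0 \<le> (s *\<^sub>R (1::real^'n)) $ j" for j using s by simp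
  obtain A where A: "\<And>m. Q (A m) ((1/2)^m *\<^sub>R (s *\<^sub>R 1))"
    "\<And>m k. m \<le> k \<Longrightarrow> cbox (A k) (A k + (1/2)^k *\<^sub>R (s *\<^sub>R 1)) \<subseteq> cbox (A m) (A m + (1/2)^m *\<^sub>R (s *\<^sub>R 1))"
    "A 0 = a"
    using halving_sequence[OF step nn Q0] by metis
  define \<sigma> where "\<sigma> m = (1/2)^m * s" for m
  have \<sigma>: "\<sigma> m > 0" "\<sigma> m \<le> s" for m using s by (auto simp: \<sigma>_def power_le_one)
  have \<sigma>lim: "\<sigma> \<longlonglongrightarrow> 0"
    unfolding \<sigma>_def[abs_def] by (intro tendsto_mult_left_zero LIMSEQ_realpow_zero) auto
  define K where "K m = cbox (A m) (A m + \<sigma> m *\<^sub>R 1)" for m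
  have QK: "\<nu> (K m) < norm (?F (A m) (\<sigma> m *\<^sub>R 1))" for m
    using A(1)[of m] by (simp add: Q_def K_def \<sigma>_def)
  have Ksub: "K k \<subseteq> K m" if "m \<le> k" for m k
    using A(2)[OF that] by (simp add: K_def \<sigma>_def)
  have AK: "A m \<in> K m" for m using \<sigma>(1)[of m] by (simp add: K_def mem_box_cart)
  have Kcube: "K m \<subseteq> cbox a (a + s *\<^sub>R 1)" for m
    using Ksub[of 0 m] by (simp add: K_def \<sigma>_def A(3))
  have AB: "norm (A m) \<le> B" for m using AK Kcube B by blast
  have "\<Inter> (range K) \<noteq> {}"
  proof (rule compact_nest)
    show "compact (K n)" for n by (simp add: K_def)
    show "K n \<noteq> {}" for n using AK[of n] by blast
  qed (rule Ksub)
  then obtain x where x: "\<And>m. x \<in> K m" by auto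
  define c where "c = norm (1::real^'n)"
  have diam: "norm (y - x) \<le> \<sigma> m * c" if "y \<in> K m" for y m
  proof -
    have "\<bar>(y - x) $ j\<bar> \<le> \<bar>(\<sigma> m *\<^sub>R (1::real^'n)) $ j\<bar>" for j
      using that x[of m] \<sigma>(1)[of m] by (auto simp: K_def mem_box_cart abs_le_iff) (smt (verit))+
    then have "norm (y - x) \<le> norm (\<sigma> m *\<^sub>R (1::real^'n))"
      by (intro norm_le_componentwise_cart) (simp only: real_norm_def)
    then show ?thesis using \<sigma>(1)[of m] by (simp add: c_def)
  qed
  have c0: "c > 0" by (simp add: c_def)
  show False
  proof (cases "x \<in> N")
    case True
    obtain e where e: "e > 0" "ball x e \<subseteq> U"
      using U(1,2) True unfolding open_contains_ball by blast
    have "(\<lambda>m. \<sigma> m * c) \<longlonglongrightarrow> 0" using \<sigma>lim by (rule tendsto_mult_left_zero)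
    then have "\<forall>\<^sub>F m in sequentially. \<sigma> m * c < e" using e(1) by (rule order_tendstoD(2))
    then obtain m where m: "\<sigma> m * c < e" by (auto simp: eventually_sequentially)
    have "K m \<subseteq> ball x e"
      using diam[of _ m] m by (force simp: dist_norm norm_minus_commute)
    then have "K m \<inter> U = K m" using e(2) by auto
    then have "\<nu> (K m) = \<eta> * \<sigma> m ^ ?n + M' * \<sigma> m ^ ?n"
      using meas_cube[OF \<sigma>(1), of "A m" m] by (simp add: \<nu>_def K_def)
    moreover have "norm (?F (A m) (\<sigma> m *\<^sub>R 1)) \<le> \<sigma> m ^ ?n * M'"
    proof -
      have "norm (?F (A m) (\<sigma> m *\<^sub>R 1)) \<le> \<sigma> m ^ ?n * (\<sigma> m * M + M * norm (A m))"
        using \<sigma>(1) by (intro M(2)[OF f]) (auto simp: mem_box_cart)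
      also have "\<dots> \<le> \<sigma> m ^ ?n * M'"
        unfolding M'_def using \<sigma>[of m] M(1) AB[of m] by (intro mult_left_mono add_mono mult_right_mono) auto
      finally show ?thesis .
    qed
    moreover have "\<eta> * \<sigma> m ^ ?n > 0" using \<eta> \<sigma>(1)[of m] by simp
    ultimately show False using QK[of m] by (simp add: mult.commute)
  next
    case False
    then obtain g where g: "(f has_derivative (\<lambda>h. g \<bullet> h)) (at x)" by (auto simp: N_def)
    define v where "v m = rest (cbox 0 (0 + 1)) (\<lambda>t. (1 / \<sigma> m) * (f (A m + \<sigma> m *\<^sub>R t) - f (A m)))" for m
    define w where "w = rest (cbox 0 (0 + 1)) (\<lambda>t. g \<bullet> t)"
    have v: "v m \<in> Conv_sc" for m
      unfolding v_def by (rule rest_box_in_Conv_sc[OF convex_lipschitz_blowup[OF f \<sigma>(1)]]) simp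
    have w: "w \<in> Conv_sc"
      unfolding w_def by (rule rest_box_in_Conv_sc[OF convex_lipschitz_inner]) simp
    have "epi_conv v w"
      unfolding v_def[abs_def] w_def
    proof (rule epi_conv_rest_cbox)
      fix T t assume T: "T \<longlonglongrightarrow> t" "\<And>m::nat. T m \<in> cbox 0 (0 + (1::real^'n))"
      have inK: "A m + \<sigma> m *\<^sub>R T m \<in> K m" for m
        using T(2)[of m] \<sigma>(1)[of m] by (auto simp: K_def mem_box_cart mult_left_le)
      have "(\<lambda>m. (1 / \<sigma> m) * (f (A m + \<sigma> m *\<^sub>R T m) - f (A m)) - g \<bullet> T m) \<longlonglongrightarrow> 0"
      proof (rule tendstoI)
        fix e :: real assume e: "e > 0"
        \<comment> \<open>The limit point \<open>x\<close> need not be the corner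
          \<open>A m\<close>, so two first-order errors of at most
          \<open>e' * (\<sigma> m * c)\<close> occur; together they make
          \<open>\<sigma> m * (e / 2)\<close>.\<close>
        define e' where "e' = e / (4 * c)"
        have e': "e' > 0" using e c0 by (simp add: e'_def)
        obtain d where d: "d > 0" "\<And>y. norm (y - x) < d \<Longrightarrow> \<bar>f y - f x - g \<bullet> (y - x)\<bar> \<le> e' * norm (y - x)"
          using g e' unfolding has_derivative_at_alt by auto
        have "(\<lambda>m. \<sigma> m * c) \<longlonglongrightarrow> 0" using \<sigma>lim by (rule tendsto_mult_left_zero)
        then have "\<forall>\<^sub>F m in sequentially. \<sigma> m * c < d" using d(1) by (rule order_tendstoD(2))
        then show "\<forall>\<^sub>F m in sequentially. dist ((1 / \<sigma> m) * (f (A m + \<sigma> m *\<^sub>R T m) - f (A m)) - g \<bullet> T m) 0 < e"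
        proof eventually_elim
          case (elim m)
          have near: "\<bar>f y - f x - g \<bullet> (y - x)\<bar> \<le> e' * (\<sigma> m * c)" if "y \<in> K m" for y
          proof -
            have "\<bar>f y - f x - g \<bullet> (y - x)\<bar> \<le> e' * norm (y - x)"
              using diam[OF that] elim by (intro d(2)) simp
            also have "\<dots> \<le> e' * (\<sigma> m * c)" using diam[OF that] e' by (intro mult_left_mono) auto
            finally show ?thesis .
          qed
          have "\<bar>f (A m + \<sigma> m *\<^sub>R T m) - f (A m) - \<sigma> m * (g \<bullet> T m)\<bar> \<le> 2 * (e' * (\<sigma> m * c))"
            using near[OF inK[of m]] near[OF AK[of m]] by (simp add: inner_diff_right inner_add_right)
          also have "\<dots> = \<sigma> m * (e / 2)" using c0 by (simp add: e'_def)
          finally have "\<bar>f (A m + \<sigma> m *\<^sub>R T m) - f (A m) - \<sigma> m * (g \<bullet> T m)\<bar> / \<sigma> m \<le> e / 2"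
            using \<sigma>(1)[of m] by (simp add: pos_divide_le_eq mult.commute)
          moreover have "(1 / \<sigma> m) * (f (A m + \<sigma> m *\<^sub>R T m) - f (A m)) - g \<bullet> T m
              = (f (A m + \<sigma> m *\<^sub>R T m) - f (A m) - \<sigma> m * (g \<bullet> T m)) / \<sigma> m"
            using \<sigma>(1)[of m] by (simp add: diff_divide_distrib)
          ultimately have "\<bar>(1 / \<sigma> m) * (f (A m + \<sigma> m *\<^sub>R T m) - f (A m)) - g \<bullet> T m\<bar> \<le> e / 2"
            using \<sigma>(1)[of m] by (simp only: abs_divide abs_of_pos)
          also have "e / 2 < e" using e by simp
          finally show ?case by (simp only: dist_real_def diff_0_right)
        qed
      qed
      moreover have "(\<lambda>m. g \<bullet> T m) \<longlonglongrightarrow> g \<bullet> t" by (intro tendsto_intros T(1))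
      ultimately have "(\<lambda>m. ((1 / \<sigma> m) * (f (A m + \<sigma> m *\<^sub>R T m) - f (A m)) - g \<bullet> T m) + g \<bullet> T m) \<longlonglongrightarrow> 0 + g \<bullet> t"
        by (rule tendsto_add)
      then show "(\<lambda>m. (1 / \<sigma> m) * (f (A m + \<sigma> m *\<^sub>R T m) - f (A m))) \<longlonglongrightarrow> g \<bullet> t" by simp
    qed (auto simp: interval_ne_empty_cart)
    then have "(\<lambda>m. z (v m)) \<longlonglongrightarrow> z w" "(\<lambda>m. z0 (v m)) \<longlonglongrightarrow> z0 w"
      by (rule continuous[OF v w], rule z0_continuous[OF v w])
    \<comment> \<open>The \<open>z0\<close> term vanishes in the limit because the density does, the
      \<open>z\<close> term because of its additional factor \<open>\<sigma> m\<close>.\<close>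
    moreover have "z0 w = 0" using dens[of g] by (simp add: w_def grad_density_def)
    ultimately have "(\<lambda>m. \<sigma> m * norm (z (v m)) + \<bar>z0 (v m)\<bar> * B) \<longlonglongrightarrow> 0 * norm (z w) + \<bar>0\<bar> * B"
      by (intro tendsto_intros \<sigma>lim) auto
    then have "\<forall>\<^sub>F m in sequentially. \<sigma> m * norm (z (v m)) + \<bar>z0 (v m)\<bar> * B < \<eta>"
      by (rule order_tendstoD(2)) (use \<eta> in simp)
    then obtain m where m: "\<sigma> m * norm (z (v m)) + \<bar>z0 (v m)\<bar> * B < \<eta>" by (auto simp: eventually_sequentially)
    have "norm (?F (A m) (\<sigma> m *\<^sub>R 1)) = norm ((\<sigma> m ^ ?n * \<sigma> m) *\<^sub>R z (v m) + (\<sigma> m ^ ?n * z0 (v m)) *\<^sub>R A m)"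
      unfolding v_def by (subst z_box(1)[OF f _ \<sigma>(1)]) auto
    also have "\<dots> \<le> norm ((\<sigma> m ^ ?n * \<sigma> m) *\<^sub>R z (v m)) + norm ((\<sigma> m ^ ?n * z0 (v m)) *\<^sub>R A m)"
      by (rule norm_triangle_ineq)
    also have "\<dots> = \<sigma> m ^ ?n * (\<sigma> m * norm (z (v m)) + \<bar>z0 (v m)\<bar> * norm (A m))"
      using \<sigma>(1)[of m] by (simp add: abs_mult algebra_simps)
    also have "\<dots> \<le> \<sigma> m ^ ?n * (\<sigma> m * norm (z (v m)) + \<bar>z0 (v m)\<bar> * B)"
      using \<sigma>(1)[of m] AB[of m] by (intro mult_left_mono add_mono mult_left_mono) auto
    also have "\<dots> \<le> \<sigma> m ^ ?n * \<eta>"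
      using \<sigma>(1)[of m] m by (intro mult_left_mono) auto
    also have "\<dots> \<le> \<nu> (K m)"
      using meas_cube[OF \<sigma>(1), of "A m" m] M' by (simp add: \<nu>_def K_def mult.commute)
    finally show False using QK[of m] by simp
  qed
qed

lemma z_eq_0:
  assumes dens: "\<And>y. grad_density y = 0" and u: "u \<in> Conv_sc"
  shows "z u = 0"
proof -
  let ?U = "\<lambda>k. rest (cbox (- (\<chi> i. real k)) (\<chi> i. real k)) (lipschitz_reg u (real k))"
  have lip: "convex_lipschitz (real k) (lipschitz_reg u (real k))" for k
    using convex_on_lipschitz_reg[OF u] lipschitz_reg_lipschitz[OF u] by (simp add: convex_lipschitz_def)
  have U: "?U k \<in> Conv_sc" for k
    using lip[of k] by (intro rest_cbox_in_Conv_sc) (auto simp: convex_lipschitz_def interval_ne_empty_cart)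
  have lim: "(\<lambda>k. z (?U k)) \<longlonglongrightarrow> z u"
    by (rule continuous[OF U u epi_conv_lipschitz_reg[OF u]])
  \<comment> \<open>For \<open>k = 0\<close> the box is a single point, not a cube of positive
    side.\<close>
  have "z (?U k) = 0" if "k > 0" for k
  proof -
    have eq: "- (\<chi> i. real k) + (2 * real k) *\<^sub>R (1::real^'n) = (\<chi> i. real k)"
      by (simp add: vec_eq_iff)
    show ?thesis
      using z_cube_eq_0[OF lip dens, of "2 * real k" "- (\<chi> i. real k)" k] that unfolding eq by simp
  qed
  then have "\<forall>\<^sub>F k in sequentially. z (?U k) = 0"
    by (rule eventually_mono[OF eventually_gt_at_top[of 0]])
  from LIMSEQ_unique[OF lim tendsto_eventually[OF this]] show ?thesis .
qed

end

section \<open>Recovering the density from the moment\<close>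

lemma zeta_vol_linear:
  fixes \<zeta> :: "real^'n \<Rightarrow> real"
  assumes "\<zeta> \<in> Cc_Rn"
  shows "zeta_vol \<zeta> (rest (cbox 0 1) (\<lambda>x. y \<bullet> x)) = \<zeta> y"
proof -
  let ?u = "rest (cbox 0 1) (\<lambda>x. y \<bullet> x)"
  have u: "?u \<in> Conv_sc"
    using rest_box_in_Conv_sc[OF convex_lipschitz_inner, of 1 0] by simp
  have \<zeta>m: "\<zeta> \<in> borel_measurable borel" using Cc_RnE[OF assms] by metis
  note [measurable] = borel_measurable_gdens[OF u \<zeta>m]
  have "AE x in lborel. gdens \<zeta> ?u x = indicator (cbox 0 1) x * \<zeta> y"
    using AE_has_bgrad[OF u]
  proof eventually_elim
    case (elim x)
    show ?case
    proof (cases "x \<in> cbox 0 1")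
      case True
      then have "has_egrad ?u x (bgrad ?u x)" using elim by simp
      \<comment> \<open>The vector \<open>y\<close> is a subgradient at every point of the cube,
        hence the gradient wherever there is one.\<close>
      then have "y = bgrad ?u x"
        by (rule has_egrad_unique_subgradient[OF u]) (use True in \<open>auto simp: rest_def inner_diff_right\<close>)
      then show ?thesis using True by (simp add: gdens_def)
    qed (simp add: gdens_def)
  qed
  then have "zeta_vol \<zeta> ?u = (\<integral>x. indicator (cbox 0 (1::real^'n)) x * \<zeta> y \<partial>lborel)"
    unfolding zeta_vol_def by (intro integral_cong_AE) auto
  also have "\<dots> = measure lborel (cbox 0 (1::real^'n)) * \<zeta> y"
    by simp
  also have "measure lborel (cbox 0 (1::real^'n)) = 1"
    by (subst content_cbox_cart) (auto simp: interval_ne_empty_cart)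
  finally show ?thesis by simp
qed

lemma covariant_valuation_z0_cong:
  fixes z z' :: "('n::finite) efun \<Rightarrow> real^'n"
  assumes "covariant_valuation z z0" "covariant_valuation z' z0'"
    and "\<And>u. u \<in> Conv_sc \<Longrightarrow> z u = z' u" "u \<in> Conv_sc"
  shows "z0 u = z0' u"
proof -
  interpret A: covariant_valuation z z0 by fact
  interpret B: covariant_valuation z' z0' by fact
  show ?thesis
    using A.z0_eq_inner[OF assms(4), of undefined] B.z0_eq_inner[OF assms(4), of undefined] assms(3,4)
    by (simp add: Conv_sc_translate)
qed

text \<open>The moment determines its associated function, and the latter at linear functions on the
  unit cube is the density itself.\<close>

lemma zeta_moment_inj:
  fixes \<zeta> \<xi> :: "real^'n \<Rightarrow> real"
  assumes "\<zeta> \<in> Cc_Rn" "\<xi> \<in> Cc_Rn" and eq: "\<And>u. u \<in> Conv_sc \<Longrightarrow> zeta_moment \<zeta> u = zeta_moment \<xi> u"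
  shows "\<zeta> = \<xi>"
proof
  fix y :: "real^'n"
  have "rest (cbox 0 1) (\<lambda>x. y \<bullet> x) \<in> Conv_sc"
    using rest_box_in_Conv_sc[OF convex_lipschitz_inner, of 1 0] by simp
  then have "zeta_vol \<zeta> (rest (cbox 0 1) (\<lambda>x. y \<bullet> x)) = zeta_vol \<xi> (rest (cbox 0 1) (\<lambda>x. y \<bullet> x))"
    by (intro covariant_valuation_z0_cong[of "zeta_moment \<zeta>" _ "zeta_moment \<xi>"]
      covariant_valuation_zeta_moment assms) auto
  then show "\<zeta> y = \<xi> y" by (simp add: zeta_vol_linear assms)
qed

theorem covariant_valuation_representation:
  fixes z :: "('n::finite) efun \<Rightarrow> real^'n"
  shows "(\<exists>z0. covariant_valuation z z0) \<longleftrightarrow> (\<exists>\<zeta>\<in>Cc_Rn. \<forall>u\<in>Conv_sc. z u = zeta_moment \<zeta> u)"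
proof
  assume "\<exists>\<zeta>\<in>Cc_Rn. \<forall>u\<in>Conv_sc. z u = zeta_moment \<zeta> u"
  then show "\<exists>z0. covariant_valuation z z0"
    using covariant_valuation_cong[OF covariant_valuation_zeta_moment] by blast
next
  assume "\<exists>z0. covariant_valuation z z0"
  then obtain z0 where A: "covariant_valuation z z0" by blast
  interpret A: covariant_valuation z z0 by (rule A)
  let ?\<zeta> = "A.grad_density"
  have \<zeta>: "?\<zeta> \<in> Cc_Rn" by (rule A.grad_density_in_Cc_Rn)
  interpret D: covariant_valuation "\<lambda>u. z u - zeta_moment ?\<zeta> u" "\<lambda>u. z0 u - zeta_vol ?\<zeta> u"
    by (rule covariant_valuation_diff[OF A covariant_valuation_zeta_moment[OF \<zeta>]])
  \<comment> \<open>On the unit cube with slope \<open>y\<close> both associated functions take the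
    value of \<open>A.grad_density\<close> at \<open>y\<close>.\<close>
  have "D.grad_density y = 0" for y
    by (simp add: D.grad_density_def zeta_vol_linear[OF \<zeta>]) (simp add: A.grad_density_def)
  then have "z u = zeta_moment ?\<zeta> u" if "u \<in> Conv_sc" for u
    using D.z_eq_0[OF _ that] by simp
  with \<zeta> show "\<exists>\<zeta>\<in>Cc_Rn. \<forall>u\<in>Conv_sc. z u = zeta_moment \<zeta> u" by blast
qed

section \<open>Equivariance\<close>

lemma Conv_sc_orthogonal_transformation:
  fixes f :: "real^'n \<Rightarrow> real^'n"
  assumes "u \<in> Conv_sc" "orthogonal_transformation f"
  shows "(\<lambda>x. u (f x)) \<in> Conv_sc"
  using Conv_sc_affine[OF assms(1), of 1 1 f 0 0] assms(2)
  by (simp add: one_ereal_def[symmetric] zero_ereal_def[symmetric]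
    orthogonal_transformation_surj orthogonal_transformation_norm orthogonal_transformation_linear)

lemma Cc_Rn_orthogonal_transformation:
  fixes f :: "real^'n \<Rightarrow> real^'n"
  assumes \<zeta>: "\<zeta> \<in> Cc_Rn" and f: "orthogonal_transformation f"
  shows "(\<lambda>y. \<zeta> (f y)) \<in> Cc_Rn"
proof -
  obtain R where \<zeta>': "continuous_on UNIV \<zeta>" "\<And>y. \<zeta> y \<noteq> 0 \<Longrightarrow> norm y \<le> R"
    using Cc_RnE[OF \<zeta>] by metis
  have "continuous_on UNIV f"
    using orthogonal_transformation_linear[OF f] by (simp add: linear_continuous_on linear_conv_bounded_linear)
  then have "continuous_on UNIV (\<lambda>y. \<zeta> (f y))"
    by (rule continuous_on_compose2[OF \<zeta>'(1)]) auto
  then show ?thesis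
    using \<zeta>'(2) orthogonal_transformation_norm[OF f] by (metis Cc_RnI)
qed

text \<open>Moving the function by \<open>f\<close> amounts to composing the density with
  \<open>f\<close> and applying \<open>f\<close> to the moment. As the moment determines the
  density, equivariance becomes invariance of the density.\<close>

lemma zeta_moment_equivariant_iff:
  fixes z :: "('n::finite) efun \<Rightarrow> real^'n"
  assumes \<zeta>: "\<zeta> \<in> Cc_Rn" and z: "\<And>u. u \<in> Conv_sc \<Longrightarrow> z u = zeta_moment \<zeta> u"
    and f: "orthogonal_transformation f"
  shows "(\<forall>u\<in>Conv_sc. z (\<lambda>x. u (inv f x)) = f (z u)) \<longleftrightarrow> (\<forall>y. \<zeta> (f y) = \<zeta> y)"
proof -
  have bij: "bij f" by (rule orthogonal_transformation_bij[OF f])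
  have w: "(\<lambda>x. u (inv f x)) \<in> Conv_sc" if "u \<in> Conv_sc" for u :: "'n efun"
    by (rule Conv_sc_orthogonal_transformation[OF that orthogonal_transformation_inv[OF f]])
  have "z (\<lambda>x. u (inv f x)) = f (zeta_moment (\<lambda>y. \<zeta> (f y)) u)" if u: "u \<in> Conv_sc" for u
    using zeta_moment_similarity[OF u w[OF u] \<zeta> f zero_less_one, of 0 0] bij
    by (simp add: z[OF w[OF u]] bij_is_inj one_ereal_def[symmetric] zero_ereal_def[symmetric])
  then have "(\<forall>u\<in>Conv_sc. z (\<lambda>x. u (inv f x)) = f (z u)) \<longleftrightarrow> (\<forall>u\<in>Conv_sc. zeta_moment (\<lambda>y. \<zeta> (f y)) u = zeta_moment \<zeta> u)"
    using z by (auto simp: inj_eq[OF bij_is_inj[OF bij]])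
  also have "\<dots> \<longleftrightarrow> (\<lambda>y. \<zeta> (f y)) = \<zeta>"
    using zeta_moment_inj[OF Cc_Rn_orthogonal_transformation[OF \<zeta> f] \<zeta>] by auto
  finally show ?thesis by (simp add: fun_eq_iff)
qed

lemma m_alpha_eq: "m_alpha \<alpha> = zeta_moment (\<lambda>y. \<alpha> (norm y))"
  by (simp add: m_alpha_def zeta_moment_def fun_eq_iff)

lemma radial_in_Cc_Rn:
  assumes "\<alpha> \<in> Cc_halfline"
  shows "(\<lambda>y::real^'n. \<alpha> (norm y)) \<in> Cc_Rn"
proof -
  obtain R where \<alpha>: "continuous_on {0..} \<alpha>" "\<And>t. t \<ge> R \<Longrightarrow> \<alpha> t = 0"
    using assms by (auto simp: Cc_halfline_def)
  show ?thesis
  proof (rule Cc_RnI)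
    show "continuous_on UNIV (\<lambda>y::real^'n. \<alpha> (norm y))"
      by (rule continuous_on_compose2[OF \<alpha>(1)]) (auto intro: continuous_intros)
    show "norm y \<le> R" if "\<alpha> (norm y) \<noteq> 0" for y :: "real^'n"
      using \<alpha>(2)[of "norm y"] that by linarith
  qed
qed

lemma profile_in_Cc_halfline:
  fixes e :: "real^'n"
  assumes "\<zeta> \<in> Cc_Rn" "norm e = 1"
  shows "(\<lambda>t. \<zeta> (t *\<^sub>R e)) \<in> Cc_halfline"
proof -
  obtain R where \<zeta>: "continuous_on UNIV \<zeta>" "\<And>y. \<zeta> y \<noteq> 0 \<Longrightarrow> norm y \<le> R"
    using Cc_RnE[OF assms(1)] by metis
  have "\<zeta> (t *\<^sub>R e) = 0" if "t \<ge> \<bar>R\<bar> + 1" for t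
    using \<zeta>(2)[of "t *\<^sub>R e"] that assms(2) by (rule_tac ccontr) auto
  moreover have "continuous_on {0..} (\<lambda>t. \<zeta> (t *\<^sub>R e))"
    by (rule continuous_on_compose2[OF \<zeta>(1)]) (auto intro: continuous_intros)
  ultimately show ?thesis by (auto simp: Cc_halfline_def)
qed

text \<open>The group acting on the gradients enters only through its transitivity on spheres.\<close>

lemma equivariant_iff_radial:
  fixes z :: "('n::finite) efun \<Rightarrow> real^'n" and G :: "(real^'n \<Rightarrow> real^'n) set"
  assumes cov: "\<exists>z0. covariant_valuation z z0"
    and G: "\<And>f. f \<in> G \<Longrightarrow> orthogonal_transformation f"
    and trans: "\<And>x y. norm x = norm y \<Longrightarrow> \<exists>f\<in>G. f x = y"
  shows "(\<forall>f\<in>G. \<forall>u\<in>Conv_sc. z (\<lambda>x. u (inv f x)) = f (z u)) \<longleftrightarrow>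
    (\<exists>\<alpha>\<in>Cc_halfline. \<forall>u\<in>Conv_sc. z u = m_alpha \<alpha> u)"
proof
  assume eqv: "\<forall>f\<in>G. \<forall>u\<in>Conv_sc. z (\<lambda>x. u (inv f x)) = f (z u)"
  obtain \<zeta> where \<zeta>: "\<zeta> \<in> Cc_Rn" and z: "\<And>u. u \<in> Conv_sc \<Longrightarrow> z u = zeta_moment \<zeta> u"
    using cov covariant_valuation_representation by blast
  have inv: "\<zeta> (f y) = \<zeta> y" if "f \<in> G" for f y
    using zeta_moment_equivariant_iff[OF \<zeta> z G[OF that]] eqv that by blast
  define e :: "real^'n" where "e = axis undefined 1"
  have e: "norm e = 1" by (simp add: e_def)
  have "\<zeta> y = \<zeta> (norm y *\<^sub>R e)" for y
  proof -
    have "norm (norm y *\<^sub>R e) = norm y" using e by simp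
    then obtain f where "f \<in> G" "f (norm y *\<^sub>R e) = y" using trans by blast
    then show ?thesis using inv by metis
  qed
  then have "m_alpha (\<lambda>t. \<zeta> (t *\<^sub>R e)) = zeta_moment \<zeta>"
    unfolding m_alpha_eq by (metis (no_types))
  then show "\<exists>\<alpha>\<in>Cc_halfline. \<forall>u\<in>Conv_sc. z u = m_alpha \<alpha> u"
    using profile_in_Cc_halfline[OF \<zeta> e] z by metis
next
  assume "\<exists>\<alpha>\<in>Cc_halfline. \<forall>u\<in>Conv_sc. z u = m_alpha \<alpha> u"
  then obtain \<alpha> where \<alpha>: "\<alpha> \<in> Cc_halfline" "\<And>u. u \<in> Conv_sc \<Longrightarrow> z u = zeta_moment (\<lambda>y. \<alpha> (norm y)) u"
    by (auto simp: m_alpha_eq)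
  show "\<forall>f\<in>G. \<forall>u\<in>Conv_sc. z (\<lambda>x. u (inv f x)) = f (z u)"
  proof
    fix f assume f: "f \<in> G"
    show "\<forall>u\<in>Conv_sc. z (\<lambda>x. u (inv f x)) = f (z u)"
      using orthogonal_transformation_norm[OF G[OF f]]
      by (subst zeta_moment_equivariant_iff[OF radial_in_Cc_Rn[OF \<alpha>(1)] \<alpha>(2) G[OF f]]) auto
  qed
qed

section \<open>Rotations and reflections as sets of maps\<close>

lemma inv_matrix_vector_mult:
  fixes A :: "real^'n^'n"
  assumes "orthogonal_matrix A"
  shows "inv ((*v) A) = (*v) (matrix_inv A)"
proof -
  have "\<exists>B. A ** B = mat 1 \<and> B ** A = mat 1"
    using assms by (auto simp: orthogonal_matrix_def)
  then have "A ** matrix_inv A = mat 1 \<and> matrix_inv A ** A = mat 1"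
    unfolding matrix_inv_def by (rule someI_ex)
  then show ?thesis
    by (intro inv_equality) (simp_all add: matrix_vector_mul_assoc)
qed

lemma rot_equivariant_iff:
  fixes z :: "('n::finite) efun \<Rightarrow> real^'n"
  shows "z_rot_equivariant z \<longleftrightarrow>
    (\<forall>f\<in>{f. orthogonal_transformation f \<and> det (matrix f) = 1}. \<forall>u\<in>Conv_sc. z (\<lambda>x. u (inv f x)) = f (z u))"
proof -
  let ?P = "\<lambda>f. \<forall>u\<in>Conv_sc. z (\<lambda>x. u (inv f x)) = f (z u)"
  have "{f. orthogonal_transformation f \<and> det (matrix f) = 1} = (*v) ` {A::real^'n^'n. orthogonal_matrix A \<and> det A = 1}"
  proof (intro set_eqI iffI)
    fix f :: "real^'n \<Rightarrow> real^'n" assume "f \<in> {f. orthogonal_transformation f \<and> det (matrix f) = 1}"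
    then have "orthogonal_matrix (matrix f)" "det (matrix f) = 1" "f = (*v) (matrix f)"
      by (auto simp: orthogonal_transformation_matrix matrix_vector_mul)
    then show "f \<in> (*v) ` {A. orthogonal_matrix A \<and> det A = 1}" by blast
  qed (auto simp: orthogonal_transformation_matrix matrix_vector_mul_linear)
  then have "(\<forall>f\<in>{f. orthogonal_transformation f \<and> det (matrix f) = 1}. ?P f) \<longleftrightarrow>
      (\<forall>A\<in>{A::real^'n^'n. orthogonal_matrix A \<and> det A = 1}. ?P ((*v) A))"
    by simp
  also have "\<dots> \<longleftrightarrow> z_rot_equivariant z"
    unfolding z_rot_equivariant_def by (auto simp: inv_matrix_vector_mult)
  finally show ?thesis by simp
qed

text \<open>The identity adds only a trivial condition; with it the set of maps is transitive on the
  spheres of the line.\<close>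

lemma refl_equivariant_iff:
  fixes z :: "('n::finite) efun \<Rightarrow> real^'n"
  shows "z_refl_equivariant z \<longleftrightarrow> (\<forall>f\<in>{\<lambda>x. x, uminus}. \<forall>u\<in>Conv_sc. z (\<lambda>x. u (inv f x)) = f (z u))"
proof -
  have "inv (\<lambda>x::real^'n. x) = (\<lambda>x. x)" "inv (uminus :: real^'n \<Rightarrow> real^'n) = uminus"
    by (rule inv_equality; simp)+
  then show ?thesis by (simp add: z_refl_equivariant_def)
qed

lemma norm_eq_CARD_1:
  fixes x y :: "real^'n"
  assumes "CARD('n) = 1" "norm x = norm y"
  shows "y = x \<or> y = - x"
proof -
  obtain i where i: "(UNIV :: 'n set) = {i}"
    using assms(1) by (rule card_1_singletonE)
  then have all: "(\<forall>j. P j) \<longleftrightarrow> P i" for P :: "'n \<Rightarrow> bool"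
    by (metis UNIV_I singletonD)
  have "\<bar>x $ i\<bar> = \<bar>y $ i\<bar>"
    using assms(2) by (simp add: norm_vec_def L2_set_def i)
  then show ?thesis
    by (auto simp: vec_eq_iff all abs_eq_iff)
qed

theorem theorem5p8:
  fixes z :: "(real^'n \<Rightarrow> ereal) \<Rightarrow> real^'n"
  shows "(z_continuous z \<and> z_trans_covariant z \<and> z_vert_invariant z \<and> z_valuation z
            \<and> z_epi_homogeneous (real CARD('n) + 1) z
          \<longleftrightarrow> (\<exists>\<zeta>\<in>Cc_Rn. \<forall>u\<in>Conv_sc. z u = zeta_moment \<zeta> u))
    \<and> (CARD('n) \<ge> 2 \<longrightarrow>
          z_continuous z \<and> z_trans_covariant z \<and> z_vert_invariant z \<and> z_valuation z
            \<and> z_epi_homogeneous (real CARD('n) + 1) z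
          \<longrightarrow> (z_rot_equivariant z \<longleftrightarrow> (\<exists>\<alpha>\<in>Cc_halfline. \<forall>u\<in>Conv_sc. z u = m_alpha \<alpha> u)))
    \<and> (CARD('n) = 1 \<longrightarrow>
          z_continuous z \<and> z_trans_covariant z \<and> z_vert_invariant z \<and> z_valuation z
            \<and> z_epi_homogeneous (real CARD('n) + 1) z
          \<longrightarrow> (z_refl_equivariant z \<longleftrightarrow> (\<exists>\<alpha>\<in>Cc_halfline. \<forall>u\<in>Conv_sc. z u = m_alpha \<alpha> u)))"
proof (intro conjI impI)
  show "z_continuous z \<and> z_trans_covariant z \<and> z_vert_invariant z \<and> z_valuation z
            \<and> z_epi_homogeneous (real CARD('n) + 1) z
          \<longleftrightarrow> (\<exists>\<zeta>\<in>Cc_Rn. \<forall>u\<in>Conv_sc. z u = zeta_moment \<zeta> u)"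
    using covariant_valuation_representation[of z] unfolding covariant_valuation_iff .
next
  assume n: "2 \<le> CARD('n)"
    and "z_continuous z \<and> z_trans_covariant z \<and> z_vert_invariant z \<and> z_valuation z
            \<and> z_epi_homogeneous (real CARD('n) + 1) z"
  then have "\<exists>z0. covariant_valuation z z0" unfolding covariant_valuation_iff by blast
  then show "z_rot_equivariant z \<longleftrightarrow> (\<exists>\<alpha>\<in>Cc_halfline. \<forall>u\<in>Conv_sc. z u = m_alpha \<alpha> u)"
    unfolding rot_equivariant_iff
  proof (rule equivariant_iff_radial)
    fix x y :: "real^'n" assume "norm x = norm y"
    then obtain f where "orthogonal_transformation f" "det (matrix f) = 1" "f x = y"
      by (rule rotation_exists[OF n])
    then show "\<exists>f\<in>{f. orthogonal_transformation f \<and> det (matrix f) = 1}. f x = y"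
      by blast
  qed auto
next
  assume n: "CARD('n) = 1"
    and "z_continuous z \<and> z_trans_covariant z \<and> z_vert_invariant z \<and> z_valuation z
            \<and> z_epi_homogeneous (real CARD('n) + 1) z"
  then have "\<exists>z0. covariant_valuation z z0" unfolding covariant_valuation_iff by blast
  then show "z_refl_equivariant z \<longleftrightarrow> (\<exists>\<alpha>\<in>Cc_halfline. \<forall>u\<in>Conv_sc. z u = m_alpha \<alpha> u)"
    unfolding refl_equivariant_iff
  proof (rule equivariant_iff_radial)
    fix x y :: "real^'n" assume "norm x = norm y"
    then show "\<exists>f\<in>{\<lambda>x. x, uminus}. f x = y"
      using norm_eq_CARD_1[OF n] by auto
  qed (auto simp: orthogonal_transformation_def linear_ident linear_uminus)
qed

end
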